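(* Let $r,s\in\mathbb{N}$, $p\in P^{Log}$, $\sigma>0$ and $f\in W_r^{p(\cdot)}$. Then there exists a $\Phi\in\mathcal{G}_{2\sigma,p(\cdot)}$ such that for all $k=0,1,\dots,r$ the inequalities $$\big\|f^{(k)}-\Phi^{(k)}\big\|_{p(\cdot)}\le\frac{C}{\sigma^{r-k}}\,\Omega_s\Big(f^{(r)},\frac1\sigma\Big)_{p(\cdot)}$$ hold with a positive constant $C$ depending only on $k$, $r$ and $p(\cdot)$.
   Context: $P$ is the class of measurable functions $p:\mathbb{R}\to[1,\infty)$ with $1\le \operatorname{ess\,inf}_{x\in\mathbb{R}}p(x)$ and $\operatorname{ess\,sup}_{x\in\mathbb{R}}p(x)<\infty$. $P^{Log}$ is the class of $p\in P$ for which there exist constants $c_1,c_2>0$ and $c_3\in\mathbb{R}$ with $|p(x)-p(y)|\ln(e+1/|x-y|)\le c_1$ for all $x,y\in\mathbb{R}$ and $|p(x)-c_3|\ln(e+|x|)\le c_2$ for all $x\in\mathbb{R}$. For $p\in P$, $L^{p(\cdot)}=L^{p(\cdot)}(\mathbb{R})$ is the Banach space of (measurable) functions $f:\mathbb{R}\to\mathbb{C}$ with $I_{p(\cdot)}(f/\lambda):=\int_{\mathbb{R}}|f(y)/\lambda|^{p(y)}dy<\infty$ for some $\lambda>0$, with norm $\|f\|_{p(\cdot)}=\inf\{\eta>0: I_{p(\cdot)}(f/\eta)<1\}$. For $r\in\mathbb{N}=\{1,2,\dots\}$, $W_r^{p(\cdot)}$ is the class of $f\in L^{p(\cdot)}$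 such that $f^{(r-1)}$ is absolutely continuous and $f^{(r)}\in L^{p(\cdot)}$. For $\sigma>0$, $\mathcal{G}_{\sigma,p(\cdot)}$ is the class of entire functions of exponential type $\le\sigma$ (whose restrictions to $\mathbb{R}$ are) belonging to $L^{p(\cdot)}$. For $\delta>0$, $T_\delta f(x):=\frac1\delta\int_0^\delta f(x+t)\,dt$, $I$ is the identity operator, and $\Omega_s(f,\delta)_{p(\cdot)}:=\|(I-T_\delta)^sf\|_{p(\cdot)}$.
   Formalization: The constant C is allowed to depend on s as well as on k, r and p(·); a constant independent of s is impossible (p=2, σ=1, f with spectrum near 5π/2 makes Ω_s tend to 0 as s grows). *)

theory Defs
  imports "HOL-Probability.Probability" "HOL-Complex_Analysis.Complex_Analysis"
begin

text \<open>The essential infimum of \<open>p\<close> is expressed as \<open>- esssup (-p)\<close>.\<close>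

definition exponents :: "(real \<Rightarrow> real) set" where
  "exponents =
     {p. p \<in> borel_measurable lebesgue \<and> (\<forall>x. 1 \<le> p x) \<and>
         1 \<le> - esssup lebesgue (\<lambda>x. - ereal (p x)) \<and>
         esssup lebesgue (\<lambda>x. ereal (p x)) < \<infinity>}"

text \<open>For \<open>x = y\<close> the first condition is trivially true, whatever the value of \<open>1 / 0\<close>.\<close>

definition log_exponents :: "(real \<Rightarrow> real) set" where
  "log_exponents =
     {p \<in> exponents. \<exists>c1 c2 c3 :: real. 0 < c1 \<and> 0 < c2 \<and>
        (\<forall>x y. \<bar>p x - p y\<bar> * ln (exp 1 + 1 / \<bar>x - y\<bar>) \<le> c1) \<and>
        (\<forall>x. \<bar>p x - c3\<bar> * ln (exp 1 + \<bar>x\<bar>) \<le> c2)}"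

definition modular :: "(real \<Rightarrow> real) \<Rightarrow> (real \<Rightarrow> complex) \<Rightarrow> ennreal" where
  "modular p f = (\<integral>\<^sup>+ y. ennreal (norm (f y) powr p y) \<partial>lebesgue)"

definition Lp_var :: "(real \<Rightarrow> real) \<Rightarrow> (real \<Rightarrow> complex) set" where
  "Lp_var p =
     {f \<in> borel_measurable lebesgue.
        \<exists>l>0. modular p (\<lambda>y. f y / complex_of_real l) < \<infinity>}"

text \<open>The norm takes values in the extended nonnegative reals, so that it is \<open>\<infinity>\<close>
  for measurable functions outside \<open>Lp_var p\<close>.\<close>

definition norm_var :: "(real \<Rightarrow> real) \<Rightarrow> (real \<Rightarrow> complex) \<Rightarrow> ennreal" where
  "norm_var p f =
     Inf {ennreal \<eta> | \<eta>. 0 < \<eta> \<and> modular p (\<lambda>y. f y / complex_of_real \<eta>) < 1}"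

definition nth_deriv :: "nat \<Rightarrow> (real \<Rightarrow> complex) \<Rightarrow> real \<Rightarrow> complex" where
  "nth_deriv k f = ((\<lambda>g x. vector_derivative g (at x)) ^^ k) f"

definition abs_continuous_on :: "real set \<Rightarrow> (real \<Rightarrow> complex) \<Rightarrow> bool" where
  "abs_continuous_on S f \<longleftrightarrow>
     (\<forall>\<epsilon>>0. \<exists>\<delta>>0. \<forall>D :: (real \<times> real) set.
        finite D \<and> (\<forall>(u, v)\<in>D. u \<le> v \<and> {u..v} \<subseteq> S) \<and>
        pairwise (\<lambda>(u, v) (u', v'). {u<..<v} \<inter> {u'<..<v'} = {}) D \<and>
        (\<Sum>(u, v)\<in>D. v - u) < \<delta>
        \<longrightarrow> (\<Sum>(u, v)\<in>D. norm (f v - f u)) < \<epsilon>)"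

text \<open>Absolute continuity on the line means absolute continuity on every compact interval.
  Since \<open>vector_derivative\<close> is a total function, differentiability of the derivatives of order
  below \<open>r - 1\<close> has to be required explicitly. The derivative of order \<open>r\<close> exists only almost
  everywhere; on the exceptional null set \<open>nth_deriv r f\<close> has an irrelevant value.\<close>

definition sobolev_var :: "nat \<Rightarrow> (real \<Rightarrow> real) \<Rightarrow> (real \<Rightarrow> complex) set" where
  "sobolev_var r p =
     {f \<in> Lp_var p.
        (\<forall>j<r - 1. \<forall>x. nth_deriv j f differentiable (at x)) \<and>
        (\<forall>a b. abs_continuous_on {a..b} (nth_deriv (r - 1) f)) \<and>
        nth_deriv r f \<in> Lp_var p}"

definition exp_type_le :: "real \<Rightarrow> (complex \<Rightarrow> complex) \<Rightarrow> bool" where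
  "exp_type_le \<sigma> \<Phi> \<longleftrightarrow>
     (\<forall>\<epsilon>>0. \<exists>A. \<forall>z. norm (\<Phi> z) \<le> A * exp ((\<sigma> + \<epsilon>) * norm z))"

definition entire_var :: "real \<Rightarrow> (real \<Rightarrow> real) \<Rightarrow> (complex \<Rightarrow> complex) set" where
  "entire_var \<sigma> p =
     {\<Phi>. \<Phi> holomorphic_on UNIV \<and> exp_type_le \<sigma> \<Phi> \<and> (\<lambda>x. \<Phi> (complex_of_real x)) \<in> Lp_var p}"

definition steklov :: "real \<Rightarrow> (real \<Rightarrow> complex) \<Rightarrow> real \<Rightarrow> complex" where
  "steklov \<delta> f x = complex_of_real (1 / \<delta>) * (LINT t:{0..\<delta>}|lebesgue. f (x + t))"

text \<open>On \<open>L\<^sup>2\<close> the operator \<open>I - T\<^sub>\<delta>\<close> is the Fourier multiplier \<open>1 - (exp (\<i>v) - 1) / (\<i>v)\<close> with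
  \<open>v = \<delta>u\<close>, whose modulus is below \<open>1\<close> near \<open>v = 5\<pi>/2\<close>. Hence the constant of a Jackson inequality
  by functions of type \<open>2/\<delta>\<close> cannot be uniform in the order \<open>s\<close> of the modulus.\<close>

definition smoothness_modulus ::
  "nat \<Rightarrow> (real \<Rightarrow> real) \<Rightarrow> (real \<Rightarrow> complex) \<Rightarrow> real \<Rightarrow> ennreal" where
  "smoothness_modulus s p f \<delta> = norm_var p (((\<lambda>g x. g x - steklov \<delta> g x) ^^ s) f)"

end

theory Submission
  imports Defs "HOL-Real_Asymp.Real_Asymp"
begin

text \<open>
Why the theorem holds. Put \<open>\<delta> = 1 / \<sigma>\<close>, let \<open>T\<close> be the Steklov mean over steps of length \<open>\<delta>\<close>
and let \<open>A\<close> be convolution with the Jackson kernel \<open>c (sin (t/2) / (t/2)) ^ 4\<close>, rescaled by \<open>\<delta>\<close>.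
A function \<open>A g\<close> extends to an entire function of exponential type at most \<open>2 / \<delta> = 2\<sigma>\<close>
(\<open>jext_holomorphic\<close>, \<open>jext_exp_type\<close>). The approximant is \<open>\<Phi> = A (\<Sum>j<n. (I - A)^j f)\<close> with
\<open>n = r + s\<close>: since \<open>A = I - (I - A)\<close> the sum telescopes, and since \<open>A\<close> commutes with
differentiation, \<open>\<Phi>^(k) = f^(k) - (I - A)^n f^(k)\<close> on the real line. It remains to bound
\<open>(I - A)^n f^(k)\<close>, and two estimates for a single factor \<open>I - A\<close> suffice.

\<^item> \<open>norm ((I - A) F) \<le> C \<delta> norm F'\<close> (\<open>norm_jackson_diff_le_derivative\<close>). Using it \<open>r - k\<close> times turns
  \<open>f^(k)\<close> into \<open>f^(r)\<close> and produces the power of \<open>\<sigma>\<close>.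
\<^item> \<open>norm ((I - A) g) \<le> C norm ((I - T) g)\<close> (\<open>norm_jackson_diff_le_steklov_diff\<close>). As \<open>A\<close> and \<open>T\<close>
  commute, using it \<open>s\<close> times produces the modulus of smoothness.

The remaining \<open>k\<close> factors are bounded operators.

The second estimate asks for \<open>I - T\<close> to be inverted on the range of \<open>I - A\<close> at one fixed step. The
formal inverse \<open>\<Sum>n. T^n\<close> has as kernel the renewal function \<open>u\<close> of uniformly distributed steps.
It does not decay, but it converges to a constant exponentially fast (\<open>renewal_decay\<close>): beyond
\<open>1\<close> it is a moving average of itself, and moving averages contract the oscillation on unit
windows. Since \<open>I - A\<close> annihilates constants, the kernel \<open>u - J * u\<close>, where \<open>J\<close> is the Jackson
kernel, does decay, and \<open>I - A = (I - A) (I - T) + M (I - T)\<close> holds with \<open>M\<close> the convolution by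
it (\<open>jackson_diff_parametrix\<close>).

Every kernel that occurs is \<open>O(1 / (1 + t^2))\<close>. Hence all boundedness statements follow from a
single one, that averages against the Cauchy kernel at scale \<open>\<delta>\<close> are bounded in the norm uniformly
in \<open>\<delta>\<close> (\<open>cauchy_avg_bounded\<close>). The Cauchy kernel lies below a multiple of a convex combination of
uniform kernels on intervals of dyadic lengths. For averages over intervals of radius \<open>R\<close> one splits
the function at height \<open>1\<close>. The large part is integrable, so its average is at most \<open>1 / (2R)\<close>, and
the local condition on \<open>p\<close> says that the oscillation of \<open>p\<close> over such an interval changes
powers of \<open>1 / (2R)\<close> by a bounded factor. On the small part the condition at infinity allows \<open>p\<close> to be
replaced by a constant exponent, for which Jensen's inequality is enough. No maximal function
enters, which is why the exponent may take the value \<open>1\<close>.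

The identities between operators are proved for functions that are integrable against
\<open>1 / (1 + t^2)\<close>. These comprise the whole space with exponent \<open>p\<close>, and also the intermediate
derivatives of a Sobolev function (\<open>sobolev_var_chain\<close>), about whose norm nothing is known
beforehand. The derivative of order \<open>r\<close> exists only almost everywhere, so that recovering
\<open>f^(r - 1)\<close> from it is Lebesgue's theorem on absolutely continuous functions (\<open>abs_continuous_FTC\<close>).
\<close>

section \<open>Norms with a variable exponent\<close>

text \<open>The graph of \<open>a powr q\<close> lies above its tangent at \<open>b\<close>. The terms are arranged without subtraction, so that the inequality can be integrated in the extended nonnegative reals.\<close>

lemma powr_tangent:
  fixes a b q :: real
  assumes "0 \<le> a" "0 \<le> b" "1 \<le> q"
  shows "b powr q + q * b powr (q - 1) * a \<le> a powr q + q * b powr (q - 1) * b"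
proof (cases "b = 0")
  case True then show ?thesis using assms by simp
next
  case False
  then have b: "0 < b" using assms by simp
  have key: "1 + q * (x - 1) \<le> x powr q" if "0 \<le> x" for x :: real
  proof (cases "x = 0")
    case True then show ?thesis using assms by simp
  next
    case False
    then have x: "0 < x" using that by simp
    have c: "convex_on {0<..} (\<lambda>x::real. x powr q)" using powr_convex[OF assms(3)] by simp
    have "x powr q - 1 powr q \<ge> (q * 1 powr (q - 1)) * (x - 1)"
      by (rule convex_on_imp_above_tangent[OF c])
         (auto intro!: derivative_eq_intros simp: x interior_open)
    then show ?thesis by simp
  qed
  have "b powr q * (1 + q * (a / b - 1)) \<le> b powr q * ((a / b) powr q)"
    by (intro mult_left_mono key) (use assms b in auto)
  also have "b powr q * ((a / b) powr q) = a powr q"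
    using b assms by (simp add: powr_mult[symmetric])
  finally show ?thesis
    using b by (simp add: powr_diff field_simps)
qed

text \<open>Jensen's inequality: integrate the tangent inequality at the mean.\<close>

lemma powr_Jensen:
  fixes g :: "'a \<Rightarrow> real"
  assumes [measurable]: "g \<in> borel_measurable M" and one: "emeasure M (space M) = 1"
    and nn: "\<And>x. 0 \<le> g x" and q: "1 \<le> q" and m: "(\<integral>\<^sup>+x. ennreal (g x) \<partial>M) = ennreal m" "0 \<le> m"
  shows "ennreal (m powr q) \<le> (\<integral>\<^sup>+x. ennreal (g x powr q) \<partial>M)"
proof -
  define c where "c = q * m powr (q - 1)"
  have c: "0 \<le> c" unfolding c_def using q by simp
  have "ennreal (m powr q) + ennreal c * ennreal m = (\<integral>\<^sup>+x. ennreal (m powr q) + ennreal c * ennreal (g x) \<partial>M)"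
    by (subst nn_integral_add) (auto simp: nn_integral_cmult m one)
  also have "\<dots> \<le> (\<integral>\<^sup>+x. ennreal (g x powr q) + ennreal c * ennreal m \<partial>M)"
  proof (rule nn_integral_mono)
    fix x
    have "m powr q + c * g x \<le> g x powr q + c * m"
      unfolding c_def using powr_tangent[OF nn[of x] m(2) q] by simp
    then show "ennreal (m powr q) + ennreal c * ennreal (g x) \<le> ennreal (g x powr q) + ennreal c * ennreal m"
      using nn[of x] c m(2) by (simp add: ennreal_mult[symmetric] ennreal_plus[symmetric] del: ennreal_plus)
  qed
  also have "\<dots> = (\<integral>\<^sup>+x. ennreal (g x powr q) \<partial>M) + ennreal c * ennreal m"
    by (subst nn_integral_add) (auto simp: one)
  finally show ?thesis
    by (metis ennreal_add_left_cancel_le add.commute ennreal_mult_less_top ennreal_less_top less_irrefl infinity_ennreal_def)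
qed

lemma powr_divide_le:
  fixes a l q :: real
  assumes "0 \<le> a" "1 \<le> l" "1 \<le> q"
  shows "(a / l) powr q \<le> a powr q / l"
proof -
  have "l powr 1 \<le> l powr q" using assms by (intro powr_mono) auto
  then have "a powr q / l powr q \<le> a powr q / l" using assms
    by (intro divide_left_mono) auto
  then show ?thesis using assms by (simp add: powr_divide)
qed

lemma exponents_ge_1: "p \<in> exponents \<Longrightarrow> 1 \<le> p x"
  by (auto simp: exponents_def)

lemma exponents_measurable: "p \<in> exponents \<Longrightarrow> p \<in> borel_measurable lebesgue"
  by (auto simp: exponents_def)

text \<open>Dividing by \<open>m + 1\<close>, where \<open>m\<close> is a finite value of the modular, brings the modular below \<open>1\<close>.\<close>

lemma Lp_var_iff_norm_var_finite:
  assumes p: "p \<in> exponents"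
  shows "f \<in> Lp_var p \<longleftrightarrow> f \<in> borel_measurable lebesgue \<and> norm_var p f < \<infinity>"
proof safe
  assume f: "f \<in> Lp_var p"
  then show [measurable]: "f \<in> borel_measurable lebesgue" by (simp add: Lp_var_def)
  note [measurable] = exponents_measurable[OF p]
  obtain l where l: "0 < l" "modular p (\<lambda>y. f y / complex_of_real l) < \<infinity>"
    using f by (auto simp: Lp_var_def)
  obtain m where m: "modular p (\<lambda>y. f y / complex_of_real l) = ennreal m" "0 \<le> m"
    using l(2) by (metis ennreal_cases infinity_ennreal_def less_irrefl)
  have "modular p (\<lambda>y. f y / complex_of_real (l * (m + 1))) \<le>
     (\<integral>\<^sup>+y. ennreal (1 / (m + 1)) * ennreal (norm (f y / complex_of_real l) powr p y) \<partial>lebesgue)"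
    unfolding modular_def
  proof (rule nn_integral_mono)
    fix y
    have "(norm (f y / complex_of_real l) / (m + 1)) powr p y \<le> norm (f y / complex_of_real l) powr p y / (m + 1)"
      using m exponents_ge_1[OF p] by (intro powr_divide_le) auto
    then show "ennreal (norm (f y / complex_of_real (l * (m + 1))) powr p y) \<le>
        ennreal (1 / (m + 1)) * ennreal (norm (f y / complex_of_real l) powr p y)"
      using l m by (simp add: ennreal_mult[symmetric] norm_divide norm_mult del: of_real_add of_real_mult)
  qed
  also have "\<dots> = ennreal (1 / (m + 1)) * modular p (\<lambda>y. f y / complex_of_real l)"
    unfolding modular_def by (subst nn_integral_cmult) auto
  also have "\<dots> = ennreal (m / (m + 1))" using m by (simp add: ennreal_mult[symmetric])
  also have "\<dots> < 1" using m by (simp add: ennreal_less_one_iff)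
  finally have "norm_var p f \<le> ennreal (l * (m + 1))"
    unfolding norm_var_def using l m by (intro Inf_lower) auto
  then show "norm_var p f < \<infinity>" using le_less_trans ennreal_less_top by (metis infinity_ennreal_def)
next
  assume f: "f \<in> borel_measurable lebesgue" and n: "norm_var p f < \<infinity>"
  then obtain \<eta> where "0 < \<eta>" "modular p (\<lambda>y. f y / complex_of_real \<eta>) < 1"
    unfolding norm_var_def Inf_less_iff by auto
  then show "f \<in> Lp_var p" unfolding Lp_var_def using f
    by (auto intro!: exI[of _ \<eta>] elim: less_trans)
qed

text \<open>The infima that define the two norms are compared on the admissible numbers. All norm bounds below reduce to such a comparison of modulars.\<close>

lemma norm_var_transfer:
  assumes K: "0 < K" and *: "\<And>\<eta>. 0 < \<eta> \<Longrightarrow> modular p (\<lambda>y. g y / complex_of_real \<eta>) < 1 \<Longrightarrow>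
     modular p (\<lambda>y. f y / complex_of_real (K * \<eta>)) < 1"
  shows "norm_var p f \<le> ennreal K * norm_var p g"
proof -
  have "ennreal (1 / K) * norm_var p f \<le> norm_var p g"
    unfolding norm_var_def[of p g]
  proof (rule Inf_greatest, clarsimp)
    fix \<eta> assume \<eta>: "0 < \<eta>" "modular p (\<lambda>y. g y / complex_of_real \<eta>) < 1"
    have "norm_var p f \<le> ennreal (K * \<eta>)"
      unfolding norm_var_def using *[OF \<eta>] K \<eta> by (intro Inf_lower) auto
    then have "ennreal (1 / K) * norm_var p f \<le> ennreal (1 / K) * ennreal (K * \<eta>)"
      by (rule mult_left_mono) simp
    also have "\<dots> = ennreal \<eta>" using K \<eta> by (simp add: ennreal_mult[symmetric])
    finally show "ennreal (1 / K) * norm_var p f \<le> ennreal \<eta>" .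
  qed
  then have "ennreal K * (ennreal (1 / K) * norm_var p f) \<le> ennreal K * norm_var p g"
    by (rule mult_left_mono) simp
  moreover have "ennreal K * (ennreal (1 / K) * norm_var p f) = norm_var p f"
    using K by (simp add: mult.assoc[symmetric] ennreal_mult[symmetric])
  ultimately show ?thesis by simp
qed

lemma norm_var_mono_AE:
  assumes p: "p \<in> exponents" and K: "0 < K" and "AE x in lborel. norm (f x) \<le> K * norm (g x)"
  shows "norm_var p f \<le> ennreal K * norm_var p g"
proof (rule norm_var_transfer[OF K])
  fix \<eta> :: real assume \<eta>: "0 < \<eta>" "modular p (\<lambda>y. g y / complex_of_real \<eta>) < 1"
  have "modular p (\<lambda>y. f y / complex_of_real (K * \<eta>)) \<le> modular p (\<lambda>y. g y / complex_of_real \<eta>)"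
    unfolding modular_def nn_integral_completion
    using assms(3)
  proof (intro nn_integral_mono_AE, eventually_elim)
    case (elim x)
    have "norm (f x / complex_of_real (K * \<eta>)) \<le> norm (g x / complex_of_real \<eta>)"
      using elim K \<eta> by (simp add: norm_divide norm_mult field_simps)
    then show ?case using exponents_ge_1[OF p, of x] by (intro ennreal_leI powr_mono2) auto
  qed
  then show "modular p (\<lambda>y. f y / complex_of_real (K * \<eta>)) < 1" using \<eta> by simp
qed

lemma norm_var_cong_AE:
  assumes "p \<in> exponents" "AE x in lborel. f x = g x"
  shows "norm_var p f = norm_var p g"
proof -
  have "norm_var p f \<le> ennreal 1 * norm_var p g" "norm_var p g \<le> ennreal 1 * norm_var p f"
    by (rule norm_var_mono_AE; use assms in auto)+
  then show ?thesis by simp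
qed

lemma norm_var_add_le:
  assumes p: "p \<in> exponents" and [measurable]: "f \<in> borel_measurable lebesgue" "g \<in> borel_measurable lebesgue"
  shows "norm_var p (\<lambda>x. f x + g x) \<le> norm_var p f + norm_var p g"
proof (rule ennreal_le_epsilon)
  note [measurable] = exponents_measurable[OF p]
  fix e :: real assume fin: "norm_var p f + norm_var p g < top" and e: "0 < e"
  have "norm_var p f < norm_var p f + ennreal (e/2)" "norm_var p g < norm_var p g + ennreal (e/2)"
    using fin e by (auto simp: ennreal_add_left_cancel_less less_top)
  then obtain \<eta> \<theta> where \<eta>: "0 < \<eta>" "modular p (\<lambda>y. f y / complex_of_real \<eta>) < 1" "ennreal \<eta> < norm_var p f + ennreal (e/2)"
    and \<theta>: "0 < \<theta>" "modular p (\<lambda>y. g y / complex_of_real \<theta>) < 1" "ennreal \<theta> < norm_var p g + ennreal (e/2)"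
    unfolding norm_var_def[of p f] norm_var_def[of p g] Inf_less_iff by blast
  \<comment> \<open>With these weights \<open>(f + g) / (\<eta> + \<theta>)\<close> is a convex combination of \<open>f / \<eta>\<close> and \<open>g / \<theta>\<close>.\<close>
  define s where "s = \<eta> / (\<eta> + \<theta>)"
  have s: "0 < s" "0 < 1 - s" unfolding s_def using \<eta> \<theta> by (auto simp: field_simps)
  have conv: "(s * a + (1 - s) * b) powr q \<le> s * a powr q + (1 - s) * b powr q"
    if "0 \<le> a" "0 \<le> b" "1 \<le> q" for a b q :: real
  proof -
    define m where "m = s * a + (1 - s) * b"
    define c where "c = q * m powr (q - 1)"
    have m: "0 \<le> m" unfolding m_def using s that by simp
    have "s * (m powr q + c * a) + (1 - s) * (m powr q + c * b) \<le> s * (a powr q + c * m) + (1 - s) * (b powr q + c * m)"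
      using powr_tangent[OF that(1) m that(3)] powr_tangent[OF that(2) m that(3)] s
      unfolding c_def[symmetric] by (rule_tac add_mono; rule_tac mult_left_mono) auto
    moreover have "s * (m powr q + c * a) + (1 - s) * (m powr q + c * b) = m powr q + c * m"
      unfolding m_def by (simp add: algebra_simps)
    moreover have "s * (a powr q + c * m) + (1 - s) * (b powr q + c * m) = s * a powr q + (1 - s) * b powr q + c * m"
      by (simp add: algebra_simps)
    ultimately show ?thesis unfolding m_def by linarith
  qed
  have "modular p (\<lambda>y. (f y + g y) / complex_of_real (\<eta> + \<theta>)) \<le>
    (\<integral>\<^sup>+y. ennreal s * ennreal (norm (f y / complex_of_real \<eta>) powr p y) +
            ennreal (1 - s) * ennreal (norm (g y / complex_of_real \<theta>) powr p y) \<partial>lebesgue)"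
    unfolding modular_def
  proof (rule nn_integral_mono)
    fix y
    have "norm ((f y + g y) / complex_of_real (\<eta> + \<theta>)) \<le> (norm (f y) + norm (g y)) / (\<eta> + \<theta>)"
      using \<eta> \<theta> by (simp add: norm_divide divide_right_mono norm_triangle_ineq del: of_real_add)
    also have "\<dots> = s * norm (f y / complex_of_real \<eta>) + (1 - s) * norm (g y / complex_of_real \<theta>)"
    proof -
      have "1 - s = \<theta> / (\<eta> + \<theta>)" unfolding s_def using \<eta> \<theta> by (simp add: field_simps)
      then show ?thesis using \<eta> \<theta> by (simp add: s_def norm_divide add_divide_distrib)
    qed
    finally have "norm ((f y + g y) / complex_of_real (\<eta> + \<theta>)) powr p y \<le>
        (s * norm (f y / complex_of_real \<eta>) + (1 - s) * norm (g y / complex_of_real \<theta>)) powr p y"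
      using exponents_ge_1[OF p, of y] by (intro powr_mono2) auto
    also have "\<dots> \<le> s * norm (f y / complex_of_real \<eta>) powr p y + (1 - s) * norm (g y / complex_of_real \<theta>) powr p y"
      using exponents_ge_1[OF p, of y] by (intro conv) auto
    finally show "ennreal (norm ((f y + g y) / complex_of_real (\<eta> + \<theta>)) powr p y) \<le>
       ennreal s * ennreal (norm (f y / complex_of_real \<eta>) powr p y) +
            ennreal (1 - s) * ennreal (norm (g y / complex_of_real \<theta>) powr p y)"
      using s by (simp add: ennreal_mult[symmetric] ennreal_plus[symmetric] del: ennreal_plus)
  qed
  also have "\<dots> = ennreal s * modular p (\<lambda>y. f y / complex_of_real \<eta>) + ennreal (1 - s) * modular p (\<lambda>y. g y / complex_of_real \<theta>)"
    unfolding modular_def by (subst nn_integral_add) (auto simp: nn_integral_cmult)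
  also have "\<dots> < 1"
  proof -
    obtain a b where ab: "modular p (\<lambda>y. f y / complex_of_real \<eta>) = ennreal a" "0 \<le> a"
        "modular p (\<lambda>y. g y / complex_of_real \<theta>) = ennreal b" "0 \<le> b"
      using \<eta>(2) \<theta>(2) by (metis ennreal_cases not_less_iff_gr_or_eq top.not_eq_extremum ennreal_one_less_top less_trans)
    then have "a < 1" "b < 1" using \<eta>(2) \<theta>(2) by (auto simp: ennreal_less_one_iff)
    then have "s * a < s * 1" "(1 - s) * b < (1 - s) * 1"
      using s by (auto intro!: mult_strict_left_mono)
    then have "s * a + (1 - s) * b < 1" by simp
    then show ?thesis using ab s
      by (simp add: ennreal_mult[symmetric] ennreal_plus[symmetric] ennreal_less_one_iff del: ennreal_plus)
  qed
  finally have "norm_var p (\<lambda>x. f x + g x) \<le> ennreal (\<eta> + \<theta>)"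
    unfolding norm_var_def using \<eta> \<theta> by (intro Inf_lower CollectI exI[of _ "\<eta> + \<theta>"]) auto
  also have "\<dots> = ennreal \<eta> + ennreal \<theta>" using \<eta> \<theta> by simp
  also have "\<dots> \<le> (norm_var p f + ennreal (e/2)) + (norm_var p g + ennreal (e/2))"
    using \<eta> \<theta> by (intro add_mono) auto
  also have "\<dots> = norm_var p f + norm_var p g + ennreal e"
    using e by (simp add: ennreal_plus[symmetric] ac_simps del: ennreal_plus)
  finally show "norm_var p (\<lambda>x. f x + g x) \<le> norm_var p f + norm_var p g + ennreal e" .
qed

section \<open>Averages against the Cauchy kernel\<close>

text \<open>The average of \<open>norm g\<close> against the Cauchy kernel at scale \<open>\<delta>\<close>, without the normalizing factor \<open>1 / \<pi>\<close>.\<close>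

definition cauchy_avg :: "real \<Rightarrow> (real \<Rightarrow> complex) \<Rightarrow> real \<Rightarrow> ennreal" where
  "cauchy_avg \<delta> g x = (\<integral>\<^sup>+ t. ennreal (norm (g (x + \<delta> * t)) / (1 + t\<^sup>2)) \<partial>lborel)"

abbreviation unif :: "real measure" where
  "unif \<equiv> uniform_measure lborel {-1..1}"

abbreviation interval_avg :: "real \<Rightarrow> (real \<Rightarrow> real) \<Rightarrow> real \<Rightarrow> ennreal" where
  "interval_avg R g x \<equiv> (\<integral>\<^sup>+s. ennreal (g (x + R * s)) \<partial>unif)"

lemma prob_space_unif: "prob_space unif"
  by (rule prob_space_uniform_measure) auto

lemma nn_integral_unif:
  assumes [measurable]: "f \<in> borel_measurable borel"
  shows "(\<integral>\<^sup>+s. f s \<partial>unif) = (\<integral>\<^sup>+s. f s * indicator {-1..1} s \<partial>lborel) / 2"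
  by (subst nn_integral_uniform_measure) auto

lemma nn_integral_unif_le:
  assumes [measurable]: "f \<in> borel_measurable borel" and R: "0 < R"
  shows "(\<integral>\<^sup>+s. f (x + R * s) \<partial>unif) \<le> ennreal (1 / (2 * R)) * (\<integral>\<^sup>+y. f y \<partial>lborel)"
proof -
  have "(\<integral>\<^sup>+s. f (x + R * s) \<partial>unif) \<le> (\<integral>\<^sup>+s. f (x + R * s) \<partial>lborel) / 2"
    by (subst nn_integral_unif)
       (auto intro!: divide_right_mono_ennreal nn_integral_mono simp: indicator_def)
  also have "(\<integral>\<^sup>+s. f (x + R * s) \<partial>lborel) = ennreal (1 / R) * (\<integral>\<^sup>+y. f y \<partial>lborel)"
    using R by (subst (2) nn_integral_real_affine[where c=R and t=x])
      (auto simp: mult.assoc[symmetric] ennreal_mult[symmetric])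
  also have "ennreal (1 / R) * (\<integral>\<^sup>+y. f y \<partial>lborel) / 2 = ennreal (1 / (2 * R)) * (\<integral>\<^sup>+y. f y \<partial>lborel)"
  proof -
    have "ennreal (1 / (2 * R)) = ennreal (1 / R) / ennreal 2"
      using R by (subst divide_ennreal) (auto simp: field_simps)
    then show ?thesis by (simp add: ennreal_divide_times ennreal_times_divide mult.commute)
  qed
  finally show ?thesis .
qed

lemma nn_integral_unif_Tonelli:
  assumes [measurable]: "f \<in> borel_measurable borel"
  shows "(\<integral>\<^sup>+x. (\<integral>\<^sup>+s. f (x + R * s) \<partial>unif) \<partial>lborel) = (\<integral>\<^sup>+y. f y \<partial>lborel)"
proof -
  interpret U: prob_space unif by (rule prob_space_unif)
  interpret P: pair_sigma_finite lborel unif ..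
  have "(\<integral>\<^sup>+x. (\<integral>\<^sup>+s. f (x + R * s) \<partial>unif) \<partial>lborel) = (\<integral>\<^sup>+s. (\<integral>\<^sup>+x. f (x + R * s) \<partial>lborel) \<partial>unif)"
    by (rule P.Fubini'[symmetric]) measurable
  also have "\<dots> = (\<integral>\<^sup>+s. (\<integral>\<^sup>+y. f y \<partial>lborel) \<partial>unif)"
  proof (rule nn_integral_cong)
    fix s
    show "(\<integral>\<^sup>+x. f (x + R * s) \<partial>lborel) = (\<integral>\<^sup>+y. f y \<partial>lborel)"
      by (subst (2) nn_integral_real_affine[where c=1 and t="R * s"]) (auto simp: add.commute)
  qed
  also have "\<dots> = (\<integral>\<^sup>+y. f y \<partial>lborel)" using U.emeasure_space_1 by simp
  finally show ?thesis .
qed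

text \<open>The local condition makes \<open>p\<close> a Borel function, as Tonelli's theorem requires.\<close>

lemma log_continuous:
  fixes p :: "real \<Rightarrow> real"
  assumes lh: "\<And>x y. \<bar>p x - p y\<bar> * ln (exp 1 + 1 / \<bar>x - y\<bar>) \<le> c1" and c1: "0 < c1"
  shows "continuous_on UNIV p"
  unfolding continuous_on_iff
proof (intro ballI allI impI)
  fix x e :: real assume e: "0 < e"
  define d where "d = exp (- (c1 / e))"
  show "\<exists>d>0. \<forall>y\<in>UNIV. dist y x < d \<longrightarrow> dist (p y) (p x) < e"
  proof (intro exI[of _ d] conjI ballI impI)
    show "0 < d" by (simp add: d_def)
    fix y assume y: "dist y x < d"
    show "dist (p y) (p x) < e"
    proof (cases "y = x")
      case False
      then have "exp (c1 / e) < 1 / \<bar>y - x\<bar>"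
        using y by (simp add: d_def dist_real_def exp_minus field_simps)
      also have "\<dots> < exp 1 + 1 / \<bar>y - x\<bar>" by simp
      finally have "ln (exp (c1 / e)) < ln (exp 1 + 1 / \<bar>y - x\<bar>)"
        by (subst ln_less_cancel_iff) (auto intro: add_pos_nonneg)
      then have l: "c1 / e < ln (exp 1 + 1 / \<bar>y - x\<bar>)" by simp
      show ?thesis
      proof (rule ccontr)
        assume "\<not> ?thesis"
        then have "e \<le> \<bar>p y - p x\<bar>" by (simp add: dist_real_def)
        moreover have "0 < c1 / e" using c1 e by simp
        ultimately have "e * (c1 / e) < \<bar>p y - p x\<bar> * ln (exp 1 + 1 / \<bar>y - x\<bar>)"
          using e l by (intro mult_le_less_imp_less) auto
        then show False using lh[of y x] e by simp
      qed
    qed (use e in auto)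
  qed
qed

text \<open>If \<open>a\<close> is at least \<open>(e + \<bar>x\<bar>)^-2\<close>, then changing the exponent by \<open>c / ln (e + \<bar>x\<bar>)\<close> costs a factor of at most \<open>exp (2 * c)\<close>. Smaller \<open>a\<close> are absorbed by the integrable error term, because both exponents are at least \<open>1\<close>.\<close>

lemma powr_compare_decay:
  fixes a \<alpha> \<beta> x c :: real
  assumes a: "0 \<le> a" "a \<le> 1" and "1 \<le> \<alpha>" "1 \<le> \<beta>" and c: "\<bar>\<alpha> - \<beta>\<bar> * ln (exp 1 + \<bar>x\<bar>) \<le> c"
  shows "a powr \<alpha> \<le> exp (2 * c) * a powr \<beta> + 1 / (1 + x\<^sup>2)"
proof -
  define t where "t = exp 1 + \<bar>x\<bar>"
  have t: "1 + \<bar>x\<bar> \<le> t" using exp_ge_add_one_self[of 1] by (simp add: t_def)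
  have t2: "1 / t\<^sup>2 \<le> 1 / (1 + x\<^sup>2)"
  proof (rule divide_left_mono)
    have "1 + x\<^sup>2 \<le> (1 + \<bar>x\<bar>)\<^sup>2" by (simp add: power2_sum)
    also have "\<dots> \<le> t\<^sup>2" using t by (intro power_mono) auto
    finally show "1 + x\<^sup>2 \<le> t\<^sup>2" .
    show "0 < t\<^sup>2 * (1 + x\<^sup>2)" using t by (auto simp: zero_less_mult_iff add_pos_nonneg)
  qed simp
  show ?thesis
  proof (cases "a < 1 / t\<^sup>2")
    case True
    have "a powr \<alpha> \<le> a powr 1" using a assms by (intro powr_mono') auto
    also have "\<dots> \<le> 1 / (1 + x\<^sup>2)" using True t2 a by simp
    finally show ?thesis by (intro add_increasing) auto
  next
    case False
    then have "1 / t\<^sup>2 \<le> a" by simp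
    moreover have tp: "0 < 1 / t\<^sup>2" using t by simp
    ultimately have a0: "0 < a" by linarith
    have "ln (1 / t\<^sup>2) \<le> ln a" using \<open>1 / t\<^sup>2 \<le> a\<close> tp a0 by (subst ln_le_cancel_iff) auto
    moreover have "0 < t" using t by linarith
    then have "ln (1 / t\<^sup>2) = - (2 * ln t)" by (simp add: ln_div ln_realpow)
    ultimately have "- ln a \<le> 2 * ln t" by simp
    moreover have "ln a \<le> 0" using a a0 by simp
    ultimately have "\<bar>ln a\<bar> \<le> 2 * ln t" by simp
    then have "\<bar>\<alpha> - \<beta>\<bar> * \<bar>ln a\<bar> \<le> \<bar>\<alpha> - \<beta>\<bar> * (2 * ln t)"
      by (intro mult_left_mono) auto
    then have "(\<alpha> - \<beta>) * ln a \<le> \<bar>\<alpha> - \<beta>\<bar> * (2 * ln t)"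
      using abs_ge_self[of "(\<alpha> - \<beta>) * ln a"] unfolding abs_mult by linarith
    also have "\<dots> \<le> 2 * c" using c by (simp add: t_def)
    finally have "exp ((\<alpha> - \<beta>) * ln a) \<le> exp (2 * c)" by simp
    then have "a powr (\<alpha> - \<beta>) * a powr \<beta> \<le> exp (2 * c) * a powr \<beta>"
      using a0 by (intro mult_right_mono) (auto simp: powr_def)
    then have "a powr \<alpha> \<le> exp (2 * c) * a powr \<beta>" by (simp add: powr_add[symmetric])
    then show ?thesis by (intro add_increasing2) auto
  qed
qed

text \<open>The constant \<open>c3\<close> is the limit of \<open>p\<close> at infinity.\<close>

lemma log_limit_ge_1:
  fixes p :: "real \<Rightarrow> real"
  assumes ld: "\<And>x. \<bar>p x - c3\<bar> * ln (exp 1 + \<bar>x\<bar>) \<le> c2" and p1: "\<And>x. 1 \<le> p x" and c2: "0 < c2"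
  shows "1 \<le> c3"
proof (rule ccontr)
  assume "\<not> 1 \<le> c3"
  then have c3: "0 < 1 - c3" by simp
  define x where "x = exp (c2 / (1 - c3))"
  have "ln x < ln (exp 1 + \<bar>x\<bar>)"
    unfolding x_def by (subst ln_less_cancel_iff) (auto intro: add_pos_nonneg)
  then have "c2 / (1 - c3) < ln (exp 1 + \<bar>x\<bar>)" by (simp add: x_def)
  moreover have "1 - c3 \<le> \<bar>p x - c3\<bar>" using p1[of x] by linarith
  moreover have "0 < c2 / (1 - c3)" using c2 c3 by simp
  ultimately have "(1 - c3) * (c2 / (1 - c3)) < \<bar>p x - c3\<bar> * ln (exp 1 + \<bar>x\<bar>)"
    using c3 by (intro mult_le_less_imp_less) auto
  then show False using ld[of x] c3 by simp
qed

text \<open>Jensen's inequality is applied with an exponent \<open>q\<close> below all values of \<open>p\<close> on the interval, which is harmless since \<open>g\<close> has no values strictly between \<open>0\<close> and \<open>1\<close>. Passing from \<open>q\<close> back to \<open>p x\<close> costs a bounded factor, because the average is at most \<open>1 / (2 * R)\<close> and \<open>p x - q\<close> is of order \<open>1 / ln (1 / R)\<close>.\<close>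

lemma avg_powr_large:
  fixes p g :: "real \<Rightarrow> real"
  assumes lh: "\<And>x y. \<bar>p x - p y\<bar> * ln (exp 1 + 1 / \<bar>x - y\<bar>) \<le> c1" and c1: "0 < c1"
    and p1: "\<And>x. 1 \<le> p x" and [measurable]: "p \<in> borel_measurable borel" "g \<in> borel_measurable borel"
    and g: "\<And>x. g x = 0 \<or> 1 \<le> g x" and mod: "(\<integral>\<^sup>+y. ennreal (g y powr p y) \<partial>lborel) \<le> 1"
    and R: "0 < R" and m: "(interval_avg R g x) = ennreal m" "0 \<le> m"
  shows "ennreal (m powr p x) \<le> ennreal (exp c1) * (\<integral>\<^sup>+s. ennreal (g (x + R * s) powr p (x + R * s)) \<partial>unif)"
proof -
  interpret U: prob_space unif by (rule prob_space_unif)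
  define L where "L = ln (exp 1 + 1 / R)"
  have L: "0 < L" unfolding L_def using R
    using exp_ge_add_one_self[of "1::real"] divide_pos_pos[of 1 R] by (intro ln_gt_zero) linarith
  \<comment> \<open>A lower bound of \<open>p\<close> on the interval, by the local condition.\<close>
  define q where "q = max 1 (p x - c1 / L)"
  have q: "1 \<le> q" "q \<le> p x" "p x - q \<le> c1 / L"
    using p1[of x] c1 L by (auto simp: q_def max_def)
  have gn: "0 \<le> g y" for y using g[of y] by auto
  have qp: "q \<le> p y" if "\<bar>y - x\<bar> \<le> R" for y
  proof (cases "y = x")
    case False
    have "L \<le> ln (exp 1 + 1 / \<bar>x - y\<bar>)"
      unfolding L_def using False that R
      by (subst ln_le_cancel_iff) (auto intro!: divide_left_mono add_pos_pos add_mono simp: abs_minus_commute)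
    then have "\<bar>p x - p y\<bar> * L \<le> c1"
      using lh[of x y] mult_left_mono[of L _ "\<bar>p x - p y\<bar>"] by (meson abs_ge_zero order.trans)
    then have "\<bar>p x - p y\<bar> \<le> c1 / L" using L by (simp add: field_simps)
    then show ?thesis using p1[of y] by (auto simp: q_def)
  qed (use q in auto)
  have gp: "g y \<le> g y powr p y" for y
    using g[of y] p1[of y] powr_mono[of 1 "p y" "g y"] by auto
  have "ennreal m \<le> ennreal (1 / (2 * R)) * (\<integral>\<^sup>+y. ennreal (g y) \<partial>lborel)"
    using nn_integral_unif_le[of "\<lambda>y. ennreal (g y)" R x] R m by simp
  also have "\<dots> \<le> ennreal (1 / (2 * R)) * 1"
    by (intro mult_left_mono order.trans[OF _ mod] nn_integral_mono ennreal_leI gp) auto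
  finally have mR: "m \<le> 1 / (2 * R)" using R by simp
  have "m powr p x \<le> exp c1 * m powr q"
  proof (cases "m \<le> 1")
    case True
    then have "m powr p x \<le> 1 * m powr q" using q m by (simp add: powr_mono')
    also have "\<dots> \<le> exp c1 * m powr q" using c1 by (intro mult_right_mono) auto
    finally show ?thesis .
  next
    case False
    have "m \<le> exp 1 + 1 / R"
    proof -
      have "1 / (2 * R) \<le> 1 / R" using R by (simp add: field_simps)
      then show ?thesis using mR exp_gt_zero[of "1::real"] by linarith
    qed
    then have "m powr (p x - q) \<le> (exp 1 + 1 / R) powr (p x - q)"
      using False q by (intro powr_mono2) auto
    also have "\<dots> = exp ((p x - q) * L)"
      unfolding L_def powr_def using R by (simp add: add_pos_pos add_nonneg_eq_0_iff)
    also have "\<dots> \<le> exp c1" using q L by (simp add: field_simps)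
    finally have "m powr (p x - q) * m powr q \<le> exp c1 * m powr q" by (intro mult_right_mono) auto
    then show ?thesis by (simp add: powr_add[symmetric])
  qed
  then have "ennreal (m powr p x) \<le> ennreal (exp c1) * ennreal (m powr q)"
    by (simp add: ennreal_mult[symmetric])
  also have "ennreal (m powr q) \<le> (\<integral>\<^sup>+s. ennreal (g (x + R * s) powr q) \<partial>unif)"
    by (rule powr_Jensen) (use U.emeasure_space_1 q m gn in auto)
  also have "\<dots> \<le> (\<integral>\<^sup>+s. ennreal (g (x + R * s) powr p (x + R * s)) \<partial>unif)"
  proof (rule nn_integral_mono_AE)
    have "AE s in unif. s \<in> {-1..1}"
      by (rule AE_uniform_measureI) auto
    then show "AE s in unif. ennreal (g (x + R * s) powr q) \<le> ennreal (g (x + R * s) powr p (x + R * s))"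
    proof eventually_elim
      case (elim s)
      then have "\<bar>s\<bar> \<le> 1" by auto
      then have "R * \<bar>s\<bar> \<le> R" using R by (simp add: mult_left_le)
      then have "q \<le> p (x + R * s)" using R by (intro qp) (simp add: abs_mult)
      then show ?case using g[of "x + R * s"] by (elim disjE) (simp_all add: ennreal_leI powr_mono)
    qed
  qed
  finally show ?thesis by (simp add: mult_left_mono)
qed

lemma nn_integral_cauchy: "(\<integral>\<^sup>+x. ennreal (1 / (1 + x\<^sup>2)) \<partial>lborel) = ennreal pi"
proof -
  have "(\<integral>\<^sup>+x. ennreal (1 / (1 + x\<^sup>2)) * indicator {0..} x \<partial>lborel) = ennreal (pi / 2 - arctan 0)"
    by (rule nn_integral_FTC_atLeast)
       (auto intro!: derivative_eq_intros simp: tendsto_arctan_at_top power2_eq_square inverse_eq_divide add_nonneg_eq_0_iff)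
  then have pos: "(\<integral>\<^sup>+x. ennreal (1 / (1 + x\<^sup>2)) * indicator {0..} x \<partial>lborel) = ennreal (pi / 2)" by simp
  have "(\<integral>\<^sup>+x. ennreal (1 / (1 + x\<^sup>2)) * indicator {..0} x \<partial>lborel) = (\<integral>\<^sup>+x. ennreal (1 / (1 + x\<^sup>2)) * indicator {0..} x \<partial>lborel)"
    by (subst nn_integral_real_affine[where c="-1" and t=0]) (auto simp: indicator_def intro!: nn_integral_cong)
  moreover have "(\<integral>\<^sup>+x. ennreal (1 / (1 + x\<^sup>2)) \<partial>lborel) =
      (\<integral>\<^sup>+x. ennreal (1 / (1 + x\<^sup>2)) * indicator {0..} x + ennreal (1 / (1 + x\<^sup>2)) * indicator {..0} x \<partial>lborel)"
    by (intro nn_integral_cong_AE AE_I[where N="{0}"]) (auto simp: indicator_def split: if_splits)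
  ultimately show ?thesis
    using pos by (simp add: nn_integral_add ennreal_plus[symmetric] del: ennreal_plus)
qed

lemma integrable_cauchy: "integrable lborel (\<lambda>x::real. 1 / (1 + x\<^sup>2))"
  by (rule integrableI_nonneg) (auto simp: nn_integral_cauchy)

text \<open>The function is split at height \<open>1\<close>: \<open>avg_powr_large\<close> bounds the average of the large part, and for the small part the constant exponent \<open>c3\<close> takes the place of \<open>p\<close> before and after averaging.\<close>

lemma avg_modular_bound:
  fixes p :: "real \<Rightarrow> real"
  assumes lh: "\<And>x y. \<bar>p x - p y\<bar> * ln (exp 1 + 1 / \<bar>x - y\<bar>) \<le> c1" and c1: "0 < c1"
    and ld: "\<And>x. \<bar>p x - c3\<bar> * ln (exp 1 + \<bar>x\<bar>) \<le> c2" and c2: "0 < c2"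
    and p1: "\<And>x. 1 \<le> p x" and [measurable]: "p \<in> borel_measurable borel" "g \<in> borel_measurable borel"
    and g: "\<And>x. 0 \<le> g x" and mod: "(\<integral>\<^sup>+y. ennreal (g y powr p y) \<partial>lborel) \<le> 1"
    and R: "0 < R"
  shows "(\<integral>\<^sup>+x. ennreal ((enn2real (interval_avg R g x) / 2) powr p x) \<partial>lborel)
    \<le> ennreal (exp c1 + exp (2 * c2) * (exp (2 * c2) + pi) + pi)"
proof -
  interpret U: prob_space unif by (rule prob_space_unif)
  have c3: "1 \<le> c3" using log_limit_ge_1[OF ld p1 c2] .
  define g1 where "g1 y = (if 1 \<le> g y then g y else 0)" for y
  define g2 where "g2 y = (if 1 \<le> g y then 0 else g y)" for y
  have [measurable]: "g1 \<in> borel_measurable borel" "g2 \<in> borel_measurable borel"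
    unfolding g1_def g2_def by measurable
  have g12: "g y = g1 y + g2 y" "0 \<le> g1 y" "0 \<le> g2 y" "g2 y \<le> 1" for y
    using g[of y] by (auto simp: g1_def g2_def)
  have mod1: "(\<integral>\<^sup>+y. ennreal (g1 y powr p y) \<partial>lborel) \<le> 1"
    by (rule order.trans[OF nn_integral_mono mod]) (auto simp: g1_def intro!: ennreal_leI)
  have mod2: "(\<integral>\<^sup>+y. ennreal (g2 y powr p y) \<partial>lborel) \<le> 1"
    by (rule order.trans[OF nn_integral_mono mod]) (auto simp: g2_def intro!: ennreal_leI)
  define m1 where "m1 x = enn2real (interval_avg R g1 x)" for x
  define m2 where "m2 x = enn2real (interval_avg R g2 x)" for x
  have [measurable]: "m1 \<in> borel_measurable borel" "m2 \<in> borel_measurable borel"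
    unfolding m1_def m2_def by measurable
  have m0: "0 \<le> m1 x" "0 \<le> m2 x" for x by (auto simp: m1_def m2_def)
  have g1p: "g1 y \<le> g1 y powr p y" for y
    using p1[of y] powr_mono[of 1 "p y" "g1 y"] by (auto simp: g1_def)
  have m1: "(interval_avg R g1 x) = ennreal (m1 x)" for x
  proof -
    have "(interval_avg R g1 x) \<le> ennreal (1 / (2 * R)) * (\<integral>\<^sup>+y. ennreal (g1 y) \<partial>lborel)"
      using nn_integral_unif_le[of "\<lambda>y. ennreal (g1 y)" R x] R by simp
    also have "\<dots> \<le> ennreal (1 / (2 * R)) * 1"
      by (intro mult_left_mono order.trans[OF _ mod1] nn_integral_mono ennreal_leI g1p) auto
    also have "\<dots> < top" by simp
    finally show ?thesis unfolding m1_def by simp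
  qed
  have m2le: "(interval_avg R g2 x) \<le> 1" for x
  proof -
    have "(interval_avg R g2 x) \<le> (\<integral>\<^sup>+s. 1 \<partial>unif)"
      by (intro nn_integral_mono) (use g12 in auto)
    also have "\<dots> = 1" using U.emeasure_space_1 by simp
    finally show ?thesis .
  qed
  have m2: "(interval_avg R g2 x) = ennreal (m2 x)" for x
    unfolding m2_def using m2le[of x] ennreal_enn2real[of "\<integral>\<^sup>+s. ennreal (g2 (x + R * s)) \<partial>unif"]
    by (metis ennreal_one_less_top le_less_trans)
  have m2_1: "m2 x \<le> 1" for x using m2le[of x] m2[of x] by simp
  have M: "enn2real (interval_avg R g x) = m1 x + m2 x" for x
  proof -
    have "(interval_avg R g x) = (\<integral>\<^sup>+s. ennreal (g1 (x + R * s)) + ennreal (g2 (x + R * s)) \<partial>unif)"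
      using g12 by (intro nn_integral_cong) simp
    also have "\<dots> = ennreal (m1 x) + ennreal (m2 x)"
      by (subst nn_integral_add) (auto simp: m1 m2)
    finally show ?thesis using m0[of x] by (simp add: ennreal_plus[symmetric] del: ennreal_plus)
  qed
  have I1: "(\<integral>\<^sup>+x. ennreal (m1 x powr p x) \<partial>lborel) \<le> ennreal (exp c1)"
  proof -
    have "(\<integral>\<^sup>+x. ennreal (m1 x powr p x) \<partial>lborel) \<le>
       (\<integral>\<^sup>+x. ennreal (exp c1) * (\<integral>\<^sup>+s. ennreal (g1 (x + R * s) powr p (x + R * s)) \<partial>unif) \<partial>lborel)"
      by (intro nn_integral_mono avg_powr_large[OF lh c1 p1 _ _ _ mod1 R m1 m0(1)]) (auto simp: g1_def)
    also have "\<dots> = ennreal (exp c1) * (\<integral>\<^sup>+y. ennreal (g1 y powr p y) \<partial>lborel)"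
      using nn_integral_unif_Tonelli[of "\<lambda>y. ennreal (g1 y powr p y)" R] by (subst nn_integral_cmult) auto
    also have "\<dots> \<le> ennreal (exp c1) * 1" by (intro mult_left_mono mod1) auto
    finally show ?thesis by simp
  qed
  have I2: "(\<integral>\<^sup>+x. ennreal (m2 x powr p x) \<partial>lborel) \<le> ennreal (exp (2 * c2) * (exp (2 * c2) + pi) + pi)"
  proof -
    have J: "(\<integral>\<^sup>+x. ennreal (exp (2 * c2) * h x + 1 / (1 + x\<^sup>2)) \<partial>lborel) \<le> ennreal (exp (2 * c2) * b + pi)"
      if [measurable]: "h \<in> borel_measurable borel" and h: "\<And>x. 0 \<le> h x" "(\<integral>\<^sup>+x. ennreal (h x) \<partial>lborel) \<le> ennreal b" "0 \<le> b"
      for h b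
    proof -
      have "(\<integral>\<^sup>+x. ennreal (exp (2 * c2) * h x + 1 / (1 + x\<^sup>2)) \<partial>lborel) =
        (\<integral>\<^sup>+x. ennreal (exp (2 * c2)) * ennreal (h x) + ennreal (1 / (1 + x\<^sup>2)) \<partial>lborel)"
        using h by (intro nn_integral_cong) (auto simp: ennreal_mult[symmetric] ennreal_plus[symmetric] simp del: ennreal_plus)
      also have "\<dots> = ennreal (exp (2 * c2)) * (\<integral>\<^sup>+x. ennreal (h x) \<partial>lborel) + ennreal pi"
        by (subst nn_integral_add) (auto simp: nn_integral_cmult nn_integral_cauchy)
      also have "\<dots> \<le> ennreal (exp (2 * c2)) * ennreal b + ennreal pi"
        by (intro add_right_mono mult_left_mono h) auto
      also have "\<dots> = ennreal (exp (2 * c2) * b + pi)"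
        using h by (simp add: ennreal_mult[symmetric] ennreal_plus[symmetric] del: ennreal_plus)
      finally show ?thesis .
    qed
    have "(\<integral>\<^sup>+x. ennreal (g2 x powr c3) \<partial>lborel) \<le> (\<integral>\<^sup>+x. ennreal (exp (2 * c2) * g2 x powr p x + 1 / (1 + x\<^sup>2)) \<partial>lborel)"
      using ld by (intro nn_integral_mono ennreal_leI powr_compare_decay)
        (auto simp: g12 c3 p1 abs_minus_commute)
    also have "\<dots> \<le> ennreal (exp (2 * c2) * 1 + pi)"
      by (rule J) (use mod2 in auto)
    finally have G: "(\<integral>\<^sup>+x. ennreal (g2 x powr c3) \<partial>lborel) \<le> ennreal (exp (2 * c2) + pi)" by simp
    have "(\<integral>\<^sup>+x. ennreal (m2 x powr c3) \<partial>lborel) \<le> (\<integral>\<^sup>+x. (\<integral>\<^sup>+s. ennreal (g2 (x + R * s) powr c3) \<partial>unif) \<partial>lborel)"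
      using U.emeasure_space_1 by (intro nn_integral_mono powr_Jensen) (auto simp: m2 m0 c3 g12)
    also have "\<dots> = (\<integral>\<^sup>+x. ennreal (g2 x powr c3) \<partial>lborel)"
      by (rule nn_integral_unif_Tonelli[of "\<lambda>y. ennreal (g2 y powr c3)"]) auto
    finally have H: "(\<integral>\<^sup>+x. ennreal (m2 x powr c3) \<partial>lborel) \<le> ennreal (exp (2 * c2) + pi)" using G by simp
    have "(\<integral>\<^sup>+x. ennreal (m2 x powr p x) \<partial>lborel) \<le> (\<integral>\<^sup>+x. ennreal (exp (2 * c2) * m2 x powr c3 + 1 / (1 + x\<^sup>2)) \<partial>lborel)"
      using ld by (intro nn_integral_mono ennreal_leI powr_compare_decay) (auto simp: m0 m2_1 c3 p1)
    also have "\<dots> \<le> ennreal (exp (2 * c2) * (exp (2 * c2) + pi) + pi)"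
      by (rule J) (use H in auto)
    finally show ?thesis .
  qed
  have "(\<integral>\<^sup>+x. ennreal ((enn2real (interval_avg R g x) / 2) powr p x) \<partial>lborel)
    \<le> (\<integral>\<^sup>+x. ennreal (m1 x powr p x) + ennreal (m2 x powr p x) \<partial>lborel)"
  proof (rule nn_integral_mono)
    fix x
    have "((m1 x + m2 x) / 2) powr p x \<le> (max (m1 x) (m2 x)) powr p x"
      using p1[of x] m0[of x] by (intro powr_mono2) auto
    also have "\<dots> \<le> m1 x powr p x + m2 x powr p x" by (auto simp: max_def)
    finally show "ennreal ((enn2real (interval_avg R g x) / 2) powr p x) \<le> ennreal (m1 x powr p x) + ennreal (m2 x powr p x)"
      unfolding M by (simp add: ennreal_plus[symmetric] del: ennreal_plus)
  qed
  also have "\<dots> = (\<integral>\<^sup>+x. ennreal (m1 x powr p x) \<partial>lborel) + (\<integral>\<^sup>+x. ennreal (m2 x powr p x) \<partial>lborel)"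
    by (rule nn_integral_add) auto
  also have "\<dots> \<le> ennreal (exp c1) + ennreal (exp (2 * c2) * (exp (2 * c2) + pi) + pi)"
    by (intro add_mono I1 I2)
  also have "\<dots> = ennreal (exp c1 + exp (2 * c2) * (exp (2 * c2) + pi) + pi)"
    by (subst ennreal_plus[symmetric]) (auto simp: add.assoc)
  finally show ?thesis .
qed

text \<open>Weights \<open>2 ^ - (k + 1)\<close> of dyadic scales, as a probability measure to which Jensen's inequality applies.\<close>

abbreviation dyadic :: "nat measure" where "dyadic \<equiv> measure_pmf (geometric_pmf (1/2))"

lemma nn_integral_dyadic: "(\<integral>\<^sup>+k. f k \<partial>dyadic) = (\<Sum>k. ennreal ((1/2) ^ Suc k) * f k)"
  by (simp add: nn_integral_measure_pmf nn_integral_count_space_nat geometric_pmf.rep_eq mult.commute)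

text \<open>At a point \<open>v\<close> it is enough to keep the summand whose index \<open>k\<close> is least with \<open>\<bar>v\<bar> \<le> 2 ^ k\<close>.\<close>

lemma cauchy_avg_le_dyadic:
  assumes [measurable]: "g \<in> borel_measurable borel" and \<delta>: "0 < \<delta>"
  shows "cauchy_avg \<delta> g x \<le> (\<integral>\<^sup>+k. 16 * (interval_avg (\<delta> * 2 ^ k) (\<lambda>y. norm (g y)) x) \<partial>dyadic)"
proof -
  define w where "w k v = ennreal (4 / 4 ^ k) * indicator {- (2 ^ k)..2 ^ k} v" for k and v :: real
  have w: "ennreal (1 / (1 + v\<^sup>2)) \<le> (\<Sum>k. w k v)" for v :: real
  proof -
    define P where "P k \<longleftrightarrow> \<bar>v\<bar> \<le> 2 ^ k" for k :: nat
    obtain n where "\<bar>v\<bar> < 2 ^ n" using real_arch_pow[of 2 "\<bar>v\<bar>"] by auto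
    then have ex: "P n" by (simp add: P_def)
    define k where "k = (LEAST k. P k)"
    have k: "P k" unfolding k_def using ex by (rule LeastI)
    have "1 / (1 + v\<^sup>2) \<le> 4 / 4 ^ k"
    proof (cases k)
      case 0 then show ?thesis by (simp add: divide_le_eq add_pos_nonneg add_increasing2)
    next
      case (Suc j)
      then have "\<not> P j" using not_less_Least[of j P] by (simp add: k_def)
      then have "(2 ^ j)\<^sup>2 \<le> \<bar>v\<bar>\<^sup>2" unfolding P_def by (intro power_mono) auto
      then have "4 ^ j \<le> v\<^sup>2" by (simp add: power_mult[symmetric] power_mult mult.commute power2_eq_square flip: power_mult_distrib)
      then show ?thesis using Suc by (simp add: field_simps add_pos_nonneg)
    qed
    then have "ennreal (1 / (1 + v\<^sup>2)) \<le> w k v"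
      using k unfolding w_def P_def by (auto simp: indicator_def abs_le_iff intro!: ennreal_leI)
    also have "\<dots> \<le> (\<Sum>k. w k v)"
      using sum_le_suminf[of "\<lambda>k. w k v" "{k}"] by simp
    finally show ?thesis .
  qed
  have "cauchy_avg \<delta> g x \<le> (\<integral>\<^sup>+v. (\<Sum>k. w k v * ennreal (norm (g (x + \<delta> * v)))) \<partial>lborel)"
    unfolding cauchy_avg_def
  proof (rule nn_integral_mono)
    fix v
    have "ennreal (norm (g (x + \<delta> * v)) / (1 + v\<^sup>2)) = ennreal (1 / (1 + v\<^sup>2)) * ennreal (norm (g (x + \<delta> * v)))"
      by (simp add: ennreal_mult[symmetric])
    also have "\<dots> \<le> (\<Sum>k. w k v) * ennreal (norm (g (x + \<delta> * v)))" by (intro mult_right_mono w) auto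
    finally show "ennreal (norm (g (x + \<delta> * v)) / (1 + v\<^sup>2)) \<le> (\<Sum>k. w k v * ennreal (norm (g (x + \<delta> * v))))"
      by simp
  qed
  also have "\<dots> = (\<Sum>k. \<integral>\<^sup>+v. w k v * ennreal (norm (g (x + \<delta> * v))) \<partial>lborel)"
    unfolding w_def by (rule nn_integral_suminf) measurable
  also have "\<dots> = (\<Sum>k. ennreal ((1/2) ^ Suc k) * (16 * (interval_avg (\<delta> * 2 ^ k) (\<lambda>y. norm (g y)) x)))"
  proof (rule suminf_cong)
    fix k :: nat
    have "(\<integral>\<^sup>+v. w k v * ennreal (norm (g (x + \<delta> * v))) \<partial>lborel) =
      ennreal (2 ^ k) * (\<integral>\<^sup>+s. w k (2 ^ k * s) * ennreal (norm (g (x + \<delta> * (2 ^ k * s)))) \<partial>lborel)"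
      by (subst nn_integral_real_affine[where c="2 ^ k" and t=0]) (auto simp: w_def)
    also have "\<dots> = ennreal (2 ^ k) * (\<integral>\<^sup>+s. ennreal (4 / 4 ^ k) * (ennreal (norm (g (x + (\<delta> * 2 ^ k) * s))) * indicator {-1..1} s) \<partial>lborel)"
    proof (rule arg_cong2[where f="(*)"], rule refl, rule nn_integral_cong)
      fix s :: real
      have "2 ^ k * s \<le> 2 ^ k * 1 \<longleftrightarrow> s \<le> 1" "2 ^ k * - 1 \<le> 2 ^ k * s \<longleftrightarrow> - 1 \<le> s"
        by (subst mult_le_cancel_left_pos; simp)+
      then show "w k (2 ^ k * s) * ennreal (norm (g (x + \<delta> * (2 ^ k * s)))) =
          ennreal (4 / 4 ^ k) * (ennreal (norm (g (x + (\<delta> * 2 ^ k) * s))) * indicator {-1..1} s)"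
        by (auto simp: w_def indicator_def mult.assoc)
    qed
    also have "\<dots> = ennreal (2 ^ k) * ennreal (4 / 4 ^ k) * (\<integral>\<^sup>+s. ennreal (norm (g (x + (\<delta> * 2 ^ k) * s))) * indicator {-1..1} s \<partial>lborel)"
      by (subst nn_integral_cmult) (auto simp: mult.assoc)
    also have "ennreal (2 ^ k) * ennreal (4 / 4 ^ k) = ennreal ((1/2) ^ Suc k) * 16 / 2"
    proof -
      have "(2::real) ^ k * (4 / 4 ^ k) = (1/2) ^ Suc k * 16 / 2"
        by (simp add: power_divide field_simps flip: power_mult_distrib)
      then show ?thesis
        by (simp add: ennreal_mult[symmetric] ennreal_numeral[symmetric] divide_ennreal del: ennreal_numeral)
    qed
    finally show "(\<integral>\<^sup>+v. w k v * ennreal (norm (g (x + \<delta> * v))) \<partial>lborel) =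
      ennreal ((1/2) ^ Suc k) * (16 * (interval_avg (\<delta> * 2 ^ k) (\<lambda>y. norm (g y)) x))"
      by (subst nn_integral_unif) (auto simp: ennreal_divide_times ennreal_times_divide mult_ac)
  qed
  finally show ?thesis unfolding nn_integral_dyadic .
qed

text \<open>By Jensen's inequality for the dyadic weights the modular of the Cauchy average is controlled by the modulars of interval averages, all of which obey the same bound \<open>C\<close>. A final division by \<open>C + 1\<close> makes the modular smaller than \<open>1\<close>, as the definition of the norm demands.\<close>

theorem cauchy_avg_bounded:
  assumes "p \<in> log_exponents"
  shows "\<exists>K>0. \<forall>\<delta>>0. \<forall>g f. g \<in> borel_measurable borel \<longrightarrow>
     (\<forall>x. ennreal (norm (f x)) \<le> cauchy_avg \<delta> g x) \<longrightarrow> norm_var p f \<le> ennreal K * norm_var p g"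
proof -
  obtain c1 c2 c3 :: real where c1: "0 < c1" and c2: "0 < c2"
    and lh: "\<And>x y. \<bar>p x - p y\<bar> * ln (exp 1 + 1 / \<bar>x - y\<bar>) \<le> c1"
    and ld: "\<And>x. \<bar>p x - c3\<bar> * ln (exp 1 + \<bar>x\<bar>) \<le> c2" and p: "p \<in> exponents"
    using assms unfolding log_exponents_def by blast
  have p1: "1 \<le> p x" for x using p by (rule exponents_ge_1)
  have [measurable]: "p \<in> borel_measurable borel"
    using log_continuous[OF lh c1] by (rule borel_measurable_continuous_onI)
  define C where "C = exp c1 + exp (2 * c2) * (exp (2 * c2) + pi) + pi"
  have C: "0 < C" unfolding C_def by (intro add_pos_pos mult_pos_pos) auto
  have "norm_var p f \<le> ennreal (32 * (C + 1)) * norm_var p g"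
    if \<delta>: "0 < \<delta>" and g[measurable]: "g \<in> borel_measurable borel" and f: "\<And>x. ennreal (norm (f x)) \<le> cauchy_avg \<delta> g x"
    for \<delta> and f g :: "real \<Rightarrow> complex"
  proof (rule norm_var_transfer)
    show "0 < 32 * (C + 1)" using C by simp
    fix \<eta> :: real assume \<eta>: "0 < \<eta>" and mod: "modular p (\<lambda>y. g y / complex_of_real \<eta>) < 1"
    define h where "h y = norm (g y) / \<eta>" for y
    have [measurable]: "h \<in> borel_measurable borel" unfolding h_def by measurable
    have h0: "0 \<le> h y" for y using \<eta> by (simp add: h_def)
    have modh: "(\<integral>\<^sup>+y. ennreal (h y powr p y) \<partial>lborel) \<le> 1"
      using mod \<eta> unfolding modular_def nn_integral_completion by (simp add: h_def norm_divide less_imp_le)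
    define m where "m k x = enn2real (interval_avg (\<delta> * 2 ^ k) h x)" for k x
    interpret U: prob_space unif by (rule prob_space_unif)
    have [measurable]: "m k \<in> borel_measurable borel" for k unfolding m_def by measurable
    have m0: "0 \<le> m k x" for k x by (simp add: m_def)
    have mfin: "(interval_avg (\<delta> * 2 ^ k) h x) \<le> 1 + ennreal (1 / (2 * \<delta>))" for k x
    proof -
      have "(interval_avg (\<delta> * 2 ^ k) h x) \<le>
         (\<integral>\<^sup>+s. 1 + ennreal (h (x + (\<delta> * 2 ^ k) * s) powr p (x + (\<delta> * 2 ^ k) * s)) \<partial>unif)"
      proof (rule nn_integral_mono)
        fix s
        have "h y \<le> 1 + h y powr p y" for y
          using p1[of y] powr_mono[of 1 "p y" "h y"] h0[of y] add_increasing2[of "h y powr p y" "h y" 1] by (cases "h y \<le> 1") auto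
        then show "ennreal (h (x + (\<delta> * 2 ^ k) * s)) \<le> 1 + ennreal (h (x + (\<delta> * 2 ^ k) * s) powr p (x + (\<delta> * 2 ^ k) * s))"
          by (simp add: ennreal_plus[symmetric] ennreal_1[symmetric] del: ennreal_plus ennreal_1)
      qed
      also have "\<dots> = 1 + (\<integral>\<^sup>+s. ennreal (h (x + (\<delta> * 2 ^ k) * s) powr p (x + (\<delta> * 2 ^ k) * s)) \<partial>unif)"
        using U.emeasure_space_1 by (subst nn_integral_add) auto
      also have "\<dots> \<le> 1 + ennreal (1 / (2 * (\<delta> * 2 ^ k))) * (\<integral>\<^sup>+y. ennreal (h y powr p y) \<partial>lborel)"
        using nn_integral_unif_le[of "\<lambda>y. ennreal (h y powr p y)" "\<delta> * 2 ^ k" x] \<delta> by (intro add_left_mono) auto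
      also have "\<dots> \<le> 1 + ennreal (1 / (2 * \<delta>)) * 1"
      proof (intro add_left_mono mult_mono modh ennreal_leI)
        have "\<delta> * 1 \<le> \<delta> * 2 ^ k" using \<delta> by (intro mult_left_mono) auto
        then show "1 / (2 * (\<delta> * 2 ^ k)) \<le> 1 / (2 * \<delta>)" using \<delta> by (intro divide_left_mono) auto
      qed auto
      finally show ?thesis by simp
    qed
    have m: "(interval_avg (\<delta> * 2 ^ k) h x) = ennreal (m k x)" for k x
      unfolding m_def using mfin[of x k] by (simp add: le_less_trans)
    have bound: "ennreal ((norm (f x / complex_of_real \<eta>) / 32) powr p x) \<le> (\<integral>\<^sup>+k. ennreal ((m k x / 2) powr p x) \<partial>dyadic)" for x
    proof -
      define v where "v = (\<integral>\<^sup>+k. ennreal (m k x / 2) \<partial>dyadic)"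
      have "v \<le> (\<integral>\<^sup>+k. 1 + ennreal (1 / (2 * \<delta>)) \<partial>dyadic)"
        unfolding v_def
      proof (rule nn_integral_mono)
        fix k
        have "ennreal (m k x / 2) \<le> ennreal (m k x)" using m0[of k x] by (intro ennreal_leI) auto
        then show "ennreal (m k x / 2) \<le> 1 + ennreal (1 / (2 * \<delta>))" using mfin[of x k] m[of x k] by simp
      qed
      also have "\<dots> < top" by (simp add: measure_pmf.emeasure_space_1)
      finally obtain r where r: "v = ennreal r" "0 \<le> r" by (metis ennreal_cases less_irrefl)
      have "ennreal (norm (f x)) \<le> (\<integral>\<^sup>+k. 16 * (interval_avg (\<delta> * 2 ^ k) (\<lambda>y. norm (g y)) x) \<partial>dyadic)"
        using f[of x] cauchy_avg_le_dyadic[OF g \<delta>, of x] by (rule order.trans)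
      also have "\<dots> = (\<integral>\<^sup>+k. ennreal (32 * \<eta>) * ennreal (m k x / 2) \<partial>dyadic)"
      proof (rule nn_integral_cong)
        fix k
        have "(interval_avg (\<delta> * 2 ^ k) (\<lambda>y. norm (g y)) x) =
            (\<integral>\<^sup>+s. ennreal \<eta> * ennreal (h (x + (\<delta> * 2 ^ k) * s)) \<partial>unif)"
          using \<eta> by (intro nn_integral_cong) (simp add: h_def ennreal_mult[symmetric])
        also have "\<dots> = ennreal \<eta> * ennreal (m k x)" by (subst nn_integral_cmult) (auto simp: m)
        finally show "16 * (interval_avg (\<delta> * 2 ^ k) (\<lambda>y. norm (g y)) x) = ennreal (32 * \<eta>) * ennreal (m k x / 2)"
          using \<eta> m0[of k x]
          by (simp add: ennreal_mult[symmetric] ennreal_numeral[symmetric] del: ennreal_numeral)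
      qed
      also have "\<dots> = ennreal (32 * \<eta>) * ennreal r"
        by (subst nn_integral_cmult) (auto simp: v_def[symmetric] r)
      finally have "norm (f x) \<le> 32 * \<eta> * r" using \<eta> r by (simp add: ennreal_mult[symmetric])
      then have "norm (f x / complex_of_real \<eta>) / 32 \<le> r" using \<eta> by (simp add: norm_divide field_simps)
      then have "ennreal ((norm (f x / complex_of_real \<eta>) / 32) powr p x) \<le> ennreal (r powr p x)"
        using p1[of x] by (intro ennreal_leI powr_mono2) auto
      also have "\<dots> \<le> (\<integral>\<^sup>+k. ennreal ((m k x / 2) powr p x) \<partial>dyadic)"
        using m0 p1 r by (intro powr_Jensen) (auto simp: v_def[symmetric] measure_pmf.emeasure_space_1)
      finally show ?thesis .
    qed
    have "(\<integral>\<^sup>+x. (\<integral>\<^sup>+k. ennreal ((m k x / 2) powr p x) \<partial>dyadic) \<partial>lborel) = (\<Sum>k. ennreal ((1/2) ^ Suc k) * (\<integral>\<^sup>+x. ennreal ((m k x / 2) powr p x) \<partial>lborel))"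
      unfolding nn_integral_dyadic by (subst nn_integral_suminf) (auto simp: nn_integral_cmult)
    also have "\<dots> = (\<integral>\<^sup>+k. (\<integral>\<^sup>+x. ennreal ((m k x / 2) powr p x) \<partial>lborel) \<partial>dyadic)"
      by (rule nn_integral_dyadic[symmetric])
    also have "\<dots> \<le> (\<integral>\<^sup>+k. ennreal C \<partial>dyadic)"
      unfolding C_def m_def
      by (intro nn_integral_mono avg_modular_bound[OF lh c1 ld c2 p1 _ _ h0 modh]) (use \<delta> in auto)
    also have "\<dots> = ennreal C" by (simp add: measure_pmf.emeasure_space_1)
    finally have dyC: "(\<integral>\<^sup>+x. (\<integral>\<^sup>+k. ennreal ((m k x / 2) powr p x) \<partial>dyadic) \<partial>lborel) \<le> ennreal C" .
    have "modular p (\<lambda>y. f y / complex_of_real (32 * (C + 1) * \<eta>)) \<le>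
       (\<integral>\<^sup>+x. ennreal (1 / (C + 1)) * (\<integral>\<^sup>+k. ennreal ((m k x / 2) powr p x) \<partial>dyadic) \<partial>lborel)"
      unfolding modular_def nn_integral_completion
    proof (rule nn_integral_mono)
      fix x
      have e: "norm (f x / complex_of_real (32 * (C + 1) * \<eta>)) = norm (f x / complex_of_real \<eta>) / 32 / (C + 1)"
        using C \<eta> by (simp add: norm_divide norm_mult del: of_real_add)
      have "norm (f x / complex_of_real (32 * (C + 1) * \<eta>)) powr p x \<le> (norm (f x / complex_of_real \<eta>) / 32) powr p x / (C + 1)"
        unfolding e using C p1 by (intro powr_divide_le) auto
      then have "ennreal (norm (f x / complex_of_real (32 * (C + 1) * \<eta>)) powr p x) \<le>
          ennreal (1 / (C + 1)) * ennreal ((norm (f x / complex_of_real \<eta>) / 32) powr p x)"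
        using C by (subst ennreal_mult[symmetric]) (auto intro: ennreal_leI)
      also have "\<dots> \<le> ennreal (1 / (C + 1)) * (\<integral>\<^sup>+k. ennreal ((m k x / 2) powr p x) \<partial>dyadic)"
        by (intro mult_left_mono bound) auto
      finally show "ennreal (norm (f x / complex_of_real (32 * (C + 1) * \<eta>)) powr p x) \<le>
          ennreal (1 / (C + 1)) * (\<integral>\<^sup>+k. ennreal ((m k x / 2) powr p x) \<partial>dyadic)" .
    qed
    also have "\<dots> = ennreal (1 / (C + 1)) * (\<integral>\<^sup>+x. (\<integral>\<^sup>+k. ennreal ((m k x / 2) powr p x) \<partial>dyadic) \<partial>lborel)"
      unfolding nn_integral_dyadic by (rule nn_integral_cmult) measurable
    also have "\<dots> \<le> ennreal (1 / (C + 1)) * ennreal C"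
      using dyC by (intro mult_left_mono) auto
    also have "\<dots> < 1" using C by (simp add: ennreal_mult[symmetric] ennreal_less_one_iff)
    finally show "modular p (\<lambda>y. f y / complex_of_real (32 * (C + 1) * \<eta>)) < 1" .
  qed
  then show ?thesis using C by (intro exI[of _ "32 * (C + 1)"]) auto
qed

section \<open>Convolution with kernels of quadratic decay\<close>

definition cauchy_integrable :: "(real \<Rightarrow> complex) \<Rightarrow> bool" where
  "cauchy_integrable g \<longleftrightarrow> g \<in> borel_measurable borel \<and> integrable lborel (\<lambda>t. norm (g t) / (1 + t\<^sup>2))"

definition cauchy_kernel :: "(real \<Rightarrow> real) \<Rightarrow> bool" where
  "cauchy_kernel k \<longleftrightarrow> k \<in> borel_measurable borel \<and> (\<exists>B. \<forall>t. \<bar>k t\<bar> \<le> B / (1 + t\<^sup>2))"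

text \<open>The scale \<open>\<delta>\<close> multiplies the argument of the kernel rather than the kernel. Then one kernel serves all scales, and composition of operators is convolution of kernels whatever \<open>\<delta>\<close> is. On functions integrable against \<open>1 / (1 + t^2)\<close> these integrals converge at every point.\<close>

definition cconv :: "real \<Rightarrow> (real \<Rightarrow> real) \<Rightarrow> (real \<Rightarrow> complex) \<Rightarrow> real \<Rightarrow> complex" where
  "cconv \<delta> k g x = (LINT t|lborel. k t *\<^sub>R g (x + \<delta> * t))"

definition kconv :: "(real \<Rightarrow> real) \<Rightarrow> (real \<Rightarrow> real) \<Rightarrow> real \<Rightarrow> real" where
  "kconv k l v = (LINT t|lborel. k t * l (v - t))"

lemma one_plus_square_pos [simp]: "0 < 1 + (t::real)\<^sup>2"
  by (simp add: add_pos_nonneg)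

lemma cauchy_kernelE:
  assumes "cauchy_kernel k"
  obtains B where "0 < B" "\<And>t. \<bar>k t\<bar> \<le> B / (1 + t\<^sup>2)" "k \<in> borel_measurable borel"
proof -
  obtain B where B: "\<And>t. \<bar>k t\<bar> \<le> B / (1 + t\<^sup>2)" and k: "k \<in> borel_measurable borel"
    using assms by (auto simp: cauchy_kernel_def)
  have "\<bar>k t\<bar> \<le> (\<bar>B\<bar> + 1) / (1 + t\<^sup>2)" for t
    by (rule order.trans[OF B]) (simp add: divide_right_mono)
  then show thesis using k by (intro that[of "\<bar>B\<bar> + 1"]) auto
qed

lemma cauchy_kernel_measurable: "cauchy_kernel k \<Longrightarrow> k \<in> borel_measurable borel"
  by (simp add: cauchy_kernel_def)

lemma cauchy_integrable_measurable: "cauchy_integrable g \<Longrightarrow> g \<in> borel_measurable borel"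
  by (simp add: cauchy_integrable_def)

lemma cauchy_kernel_integrable:
  assumes "cauchy_kernel k"
  shows "integrable lborel k"
proof -
  obtain B where B: "0 < B" "\<And>t. \<bar>k t\<bar> \<le> B / (1 + t\<^sup>2)" and [measurable]: "k \<in> borel_measurable borel"
    using cauchy_kernelE[OF assms] by blast
  show ?thesis
    using integrable_mult_right[OF integrable_cauchy, of B]
    by (rule Bochner_Integration.integrable_bound) (use B in \<open>auto simp: abs_mult\<close>)
qed

lemma cauchy_kernel_abs: "cauchy_kernel k \<Longrightarrow> cauchy_kernel (\<lambda>t. \<bar>k t\<bar>)"
  by (auto simp: cauchy_kernel_def)

lemma cauchy_kernel_cmult:
  assumes "cauchy_kernel k"
  shows "cauchy_kernel (\<lambda>t. c * k t)"
proof -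
  obtain B where B: "0 < B" "\<And>t. \<bar>k t\<bar> \<le> B / (1 + t\<^sup>2)" and [measurable]: "k \<in> borel_measurable borel"
    using cauchy_kernelE[OF assms] by blast
  have "\<bar>c * k t\<bar> \<le> (\<bar>c\<bar> * B) / (1 + t\<^sup>2)" for t
    using mult_left_mono[OF B(2)[of t], of "\<bar>c\<bar>"] by (simp add: abs_mult)
  then show ?thesis unfolding cauchy_kernel_def by auto
qed

lemma cauchy_kernel_add:
  assumes "cauchy_kernel k" "cauchy_kernel l"
  shows "cauchy_kernel (\<lambda>t. k t + l t)"
proof -
  obtain B B' where B: "\<And>t. \<bar>k t\<bar> \<le> B / (1 + t\<^sup>2)" "\<And>t. \<bar>l t\<bar> \<le> B' / (1 + t\<^sup>2)"
    and [measurable]: "k \<in> borel_measurable borel" "l \<in> borel_measurable borel"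
    using assms unfolding cauchy_kernel_def by auto
  have "\<bar>k t + l t\<bar> \<le> (B + B') / (1 + t\<^sup>2)" for t
    unfolding add_divide_distrib using B[of t] by linarith
  then show ?thesis unfolding cauchy_kernel_def by auto
qed

lemma cauchy_integrable_norm: "cauchy_integrable g \<Longrightarrow> cauchy_integrable (\<lambda>t. of_real (norm (g t)))"
  by (auto simp: cauchy_integrable_def)

lemma cauchy_integrable_add:
  assumes "cauchy_integrable f" "cauchy_integrable g"
  shows "cauchy_integrable (\<lambda>t. f t + g t)"
proof -
  note [measurable] = assms[THEN cauchy_integrable_measurable]
  have "integrable lborel (\<lambda>t. norm (f t) / (1 + t\<^sup>2) + norm (g t) / (1 + t\<^sup>2))"
    using assms by (auto simp: cauchy_integrable_def)
  then have "integrable lborel (\<lambda>t. norm (f t + g t) / (1 + t\<^sup>2))"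
    by (rule Bochner_Integration.integrable_bound)
       (auto simp: add_divide_distrib[symmetric] intro!: divide_right_mono norm_triangle_ineq)
  then show ?thesis by (simp add: cauchy_integrable_def)
qed

lemma cauchy_integrable_uminus: "cauchy_integrable f \<Longrightarrow> cauchy_integrable (\<lambda>t. - f t)"
  by (auto simp: cauchy_integrable_def)

lemma cauchy_integrable_diff:
  "cauchy_integrable f \<Longrightarrow> cauchy_integrable g \<Longrightarrow> cauchy_integrable (\<lambda>t. f t - g t)"
  using cauchy_integrable_add[OF _ cauchy_integrable_uminus, of f g] by simp

lemma cauchy_weight_affine:
  "1 / (1 + (t::real)\<^sup>2) \<le> (1 + 2 * x\<^sup>2 + 2 * \<delta>\<^sup>2) / (1 + (x + \<delta> * t)\<^sup>2)"
proof -
  have "0 \<le> (x - \<delta> * t)\<^sup>2" by simp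
  then have "1 + (x + \<delta> * t)\<^sup>2 \<le> 1 + 2 * x\<^sup>2 + 2 * (\<delta>\<^sup>2 * t\<^sup>2)"
    by (simp add: power2_sum power2_diff power_mult_distrib)
  also have "\<dots> \<le> (1 + 2 * x\<^sup>2 + 2 * \<delta>\<^sup>2) * (1 + t\<^sup>2)" by (simp add: algebra_simps)
  finally show ?thesis by (simp add: divide_le_eq field_simps)
qed

lemma cauchy_integrable_affine:
  assumes g: "cauchy_integrable g" and \<delta>: "\<delta> \<noteq> 0"
  shows "cauchy_integrable (\<lambda>t. g (x + \<delta> * t))"
proof -
  note [measurable] = cauchy_integrable_measurable[OF g]
  have "integrable lborel (\<lambda>t. norm (g (x + \<delta> * t)) / (1 + (x + \<delta> * t)\<^sup>2))"
    using lborel_integrable_real_affine[OF _ \<delta>, of "\<lambda>t. norm (g t) / (1 + t\<^sup>2)" x] g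
    by (simp add: cauchy_integrable_def)
  then have "integrable lborel (\<lambda>t. (1 + 2 * x\<^sup>2 + 2 * \<delta>\<^sup>2) * (norm (g (x + \<delta> * t)) / (1 + (x + \<delta> * t)\<^sup>2)))"
    by (rule integrable_mult_right)
  then have "integrable lborel (\<lambda>t. norm (g (x + \<delta> * t)) / (1 + t\<^sup>2))"
  proof (rule Bochner_Integration.integrable_bound)
    show "AE t in lborel. norm (norm (g (x + \<delta> * t)) / (1 + t\<^sup>2)) \<le>
       norm ((1 + 2 * x\<^sup>2 + 2 * \<delta>\<^sup>2) * (norm (g (x + \<delta> * t)) / (1 + (x + \<delta> * t)\<^sup>2)))"
    proof (rule AE_I2)
      fix t
      show "norm (norm (g (x + \<delta> * t)) / (1 + t\<^sup>2)) \<le>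
         norm ((1 + 2 * x\<^sup>2 + 2 * \<delta>\<^sup>2) * (norm (g (x + \<delta> * t)) / (1 + (x + \<delta> * t)\<^sup>2)))"
        using mult_left_mono[OF cauchy_weight_affine[of t x \<delta>], of "norm (g (x + \<delta> * t))"]
        by (simp add: abs_mult mult.commute add_nonneg_nonneg)
    qed
  qed measurable
  then show ?thesis by (simp add: cauchy_integrable_def)
qed

lemma cauchy_integrable_mult_kernel:
  assumes k: "cauchy_kernel k" and g: "cauchy_integrable g"
  shows "integrable lborel (\<lambda>t. k t *\<^sub>R g t)"
proof -
  obtain B where B: "0 < B" "\<And>t. \<bar>k t\<bar> \<le> B / (1 + t\<^sup>2)" and [measurable]: "k \<in> borel_measurable borel"
    using cauchy_kernelE[OF k] by blast
  note [measurable] = cauchy_integrable_measurable[OF g]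
  have "integrable lborel (\<lambda>t. B * (norm (g t) / (1 + t\<^sup>2)))"
    using g by (intro integrable_mult_right) (auto simp: cauchy_integrable_def)
  then show ?thesis
  proof (rule Bochner_Integration.integrable_bound)
    show "AE t in lborel. norm (k t *\<^sub>R g t) \<le> norm (B * (norm (g t) / (1 + t\<^sup>2)))"
      using B by (intro AE_I2) (simp add: abs_mult mult_right_mono[OF B(2)] flip: times_divide_eq_left)
  qed measurable
qed

lemma integrable_cconv:
  assumes "cauchy_kernel k" "cauchy_integrable g" "\<delta> \<noteq> 0"
  shows "integrable lborel (\<lambda>t. k t *\<^sub>R g (x + \<delta> * t))"
  by (rule cauchy_integrable_mult_kernel[OF assms(1) cauchy_integrable_affine[OF assms(2,3)]])

lemma norm_cconv_le:
  assumes ck: "cauchy_kernel k" and k: "\<And>t. \<bar>k t\<bar> \<le> B / (1 + t\<^sup>2)" and B: "0 \<le> B" and g: "cauchy_integrable g" and \<delta>: "\<delta> \<noteq> 0"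
  shows "ennreal (norm (cconv \<delta> k g x)) \<le> cauchy_avg \<delta> (\<lambda>y. B *\<^sub>R g y) x"
proof -
  have i: "integrable lborel (\<lambda>t. B * (norm (g (x + \<delta> * t)) / (1 + t\<^sup>2)))"
    using cauchy_integrable_affine[OF g \<delta>, of x] by (intro integrable_mult_right) (auto simp: cauchy_integrable_def)
  have "norm (cconv \<delta> k g x) \<le> (LINT t|lborel. B * (norm (g (x + \<delta> * t)) / (1 + t\<^sup>2)))"
    unfolding cconv_def
    by (rule Bochner_Integration.integral_norm_bound_integral[OF integrable_cconv[OF ck g \<delta>] i])
       (auto intro!: mult_right_mono[OF k] simp flip: times_divide_eq_left)
  then have "ennreal (norm (cconv \<delta> k g x)) \<le> ennreal (LINT t|lborel. B * (norm (g (x + \<delta> * t)) / (1 + t\<^sup>2)))"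
    by (rule ennreal_leI)
  also have "\<dots> = cauchy_avg \<delta> (\<lambda>y. B *\<^sub>R g y) x"
    unfolding cauchy_avg_def using B i by (subst nn_integral_eq_integral) auto
  finally show ?thesis .
qed

lemma measurable_cconv [measurable]:
  assumes [measurable]: "k \<in> borel_measurable borel" "g \<in> borel_measurable borel"
  shows "cconv \<delta> k g \<in> borel_measurable borel"
  unfolding cconv_def by measurable

lemma measurable_kconv [measurable]:
  assumes [measurable]: "k \<in> borel_measurable borel" "l \<in> borel_measurable borel"
  shows "kconv k l \<in> borel_measurable borel"
  unfolding kconv_def by measurable

text \<open>Since \<open>y\<close> is the sum of \<open>y - \<delta> * t\<close> and \<open>\<delta> * t\<close>, one of the two factors on the left is already of the order \<open>1 / (1 + y^2)\<close>.\<close>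

lemma cauchy_product_le:
  fixes t y \<delta> :: real
  shows "1 / (1 + t\<^sup>2) * (1 / (1 + (y - \<delta> * t)\<^sup>2)) \<le>
    (2 + 2 * \<delta>\<^sup>2) / (1 + y\<^sup>2) * (1 / (1 + t\<^sup>2) + 1 / (1 + (y - \<delta> * t)\<^sup>2))"
proof -
  define a where "a = 1 + t\<^sup>2"
  define b where "b = 1 + (y - \<delta> * t)\<^sup>2"
  have ab: "0 < a" "0 < b" by (simp_all add: a_def b_def)
  have "0 \<le> (y - 2 * \<delta> * t)\<^sup>2" by simp
  then have "1 + y\<^sup>2 \<le> 1 + 2 * (y - \<delta> * t)\<^sup>2 + 2 * \<delta>\<^sup>2 * t\<^sup>2"
    by (simp add: power2_diff power_mult_distrib algebra_simps)
  also have "\<dots> \<le> (2 + 2 * \<delta>\<^sup>2) * (a + b)"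
    by (simp add: a_def b_def algebra_simps)
  finally have "1 / (a * b) * (1 + y\<^sup>2) \<le> 1 / (a * b) * ((2 + 2 * \<delta>\<^sup>2) * (a + b))"
    using ab by (intro mult_left_mono) auto
  moreover have "1 / (a * b) * ((2 + 2 * \<delta>\<^sup>2) * (a + b)) = (2 + 2 * \<delta>\<^sup>2) * (1 / a + 1 / b)"
    using ab by (simp add: field_simps)
  ultimately have "1 / (a * b) \<le> (2 + 2 * \<delta>\<^sup>2) * (1 / a + 1 / b) / (1 + y\<^sup>2)"
    by (simp add: pos_le_divide_eq)
  then show ?thesis by (simp add: a_def b_def)
qed

lemma nn_integral_cauchy_affine:
  assumes "\<delta> \<noteq> 0"
  shows "(\<integral>\<^sup>+t. ennreal (1 / (1 + (y - \<delta> * t)\<^sup>2)) \<partial>lborel) = ennreal (pi / \<bar>\<delta>\<bar>)"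
proof -
  have "ennreal pi = ennreal \<bar>\<delta>\<bar> * (\<integral>\<^sup>+t. ennreal (1 / (1 + (y - \<delta> * t)\<^sup>2)) \<partial>lborel)"
    unfolding nn_integral_cauchy[symmetric] using assms
    by (subst nn_integral_real_affine[where c="-\<delta>" and t=y]) auto
  then have "ennreal (1 / \<bar>\<delta>\<bar>) * ennreal pi = ennreal (1 / \<bar>\<delta>\<bar>) * (ennreal \<bar>\<delta>\<bar> * (\<integral>\<^sup>+t. ennreal (1 / (1 + (y - \<delta> * t)\<^sup>2)) \<partial>lborel))"
    by simp
  then show ?thesis using assms by (simp add: mult.assoc[symmetric] ennreal_mult[symmetric])
qed

lemma nn_integral_cauchy_product_le:
  assumes "\<delta> \<noteq> 0"
  shows "(\<integral>\<^sup>+t. ennreal (1 / (1 + t\<^sup>2) * (1 / (1 + (y - \<delta> * t)\<^sup>2))) \<partial>lborel)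
    \<le> ennreal ((2 + 2 * \<delta>\<^sup>2) * (pi + pi / \<bar>\<delta>\<bar>) / (1 + y\<^sup>2))"
proof -
  have "(\<integral>\<^sup>+t. ennreal (1 / (1 + t\<^sup>2) * (1 / (1 + (y - \<delta> * t)\<^sup>2))) \<partial>lborel) \<le>
    (\<integral>\<^sup>+t. ennreal ((2 + 2 * \<delta>\<^sup>2) / (1 + y\<^sup>2)) * (ennreal (1 / (1 + t\<^sup>2)) + ennreal (1 / (1 + (y - \<delta> * t)\<^sup>2))) \<partial>lborel)"
  proof (rule nn_integral_mono)
    fix t
    have "ennreal ((2 + 2 * \<delta>\<^sup>2) / (1 + y\<^sup>2)) * (ennreal (1 / (1 + t\<^sup>2)) + ennreal (1 / (1 + (y - \<delta> * t)\<^sup>2))) =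
      ennreal ((2 + 2 * \<delta>\<^sup>2) / (1 + y\<^sup>2) * (1 / (1 + t\<^sup>2) + 1 / (1 + (y - \<delta> * t)\<^sup>2)))"
      by (subst ennreal_plus[symmetric], simp, simp, subst ennreal_mult[symmetric]) (auto intro!: add_nonneg_nonneg divide_nonneg_nonneg)
    then show "ennreal (1 / (1 + t\<^sup>2) * (1 / (1 + (y - \<delta> * t)\<^sup>2))) \<le>
      ennreal ((2 + 2 * \<delta>\<^sup>2) / (1 + y\<^sup>2)) * (ennreal (1 / (1 + t\<^sup>2)) + ennreal (1 / (1 + (y - \<delta> * t)\<^sup>2)))"
      using ennreal_leI[OF cauchy_product_le[of t y \<delta>]] by simp
  qed
  also have "\<dots> = ennreal ((2 + 2 * \<delta>\<^sup>2) / (1 + y\<^sup>2)) * (ennreal pi + ennreal (pi / \<bar>\<delta>\<bar>))"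
    by (subst nn_integral_cmult, measurable, subst nn_integral_add)
       (auto simp: nn_integral_cauchy nn_integral_cauchy_affine[OF assms])
  also have "\<dots> = ennreal ((2 + 2 * \<delta>\<^sup>2) * (pi + pi / \<bar>\<delta>\<bar>) / (1 + y\<^sup>2))"
    by (simp add: ennreal_plus[symmetric] ennreal_mult[symmetric] add_nonneg_nonneg del: ennreal_plus)
  finally show ?thesis .
qed

text \<open>Exchanging the integrals reduces this to the fact that the convolution of two Cauchy kernels is again bounded by a Cauchy kernel.\<close>

lemma cauchy_integrable_cconv:
  assumes k: "cauchy_kernel k" and g: "cauchy_integrable g" and \<delta>: "\<delta> \<noteq> 0"
  shows "cauchy_integrable (cconv \<delta> k g)"
proof -
  obtain B where B: "0 < B" "\<And>t. \<bar>k t\<bar> \<le> B / (1 + t\<^sup>2)" and [measurable]: "k \<in> borel_measurable borel"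
    using cauchy_kernelE[OF k] by blast
  note [measurable] = cauchy_integrable_measurable[OF g]
  define D where "D = (2 + 2 * \<delta>\<^sup>2) * (pi + pi / \<bar>\<delta>\<bar>)"
  have D: "0 \<le> D" unfolding D_def by (auto intro!: mult_nonneg_nonneg add_nonneg_nonneg)
  have ib: "integrable lborel (\<lambda>t. B * norm (g t) / (1 + t\<^sup>2))"
    using integrable_mult_right[where c=B and M=lborel and f="\<lambda>t. norm (g t) / (1 + t\<^sup>2)"] g by (auto simp: cauchy_integrable_def)
  have "(\<integral>\<^sup>+x. ennreal (norm (cconv \<delta> k g x) / (1 + x\<^sup>2)) \<partial>lborel) \<le>
    (\<integral>\<^sup>+x. (\<integral>\<^sup>+t. ennreal (B * norm (g (x + \<delta> * t)) * (1 / (1 + t\<^sup>2) * (1 / (1 + x\<^sup>2)))) \<partial>lborel) \<partial>lborel)"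
  proof (rule nn_integral_mono)
    fix x
    have "ennreal (norm (cconv \<delta> k g x) / (1 + x\<^sup>2)) = ennreal (1 / (1 + x\<^sup>2)) * ennreal (norm (cconv \<delta> k g x))"
      by (simp add: ennreal_mult[symmetric])
    also have "\<dots> \<le> ennreal (1 / (1 + x\<^sup>2)) * cauchy_avg \<delta> (\<lambda>y. B *\<^sub>R g y) x"
      by (intro mult_left_mono norm_cconv_le[OF k B(2) _ g \<delta>]) (use B in auto)
    also have "\<dots> = (\<integral>\<^sup>+t. ennreal (B * norm (g (x + \<delta> * t)) * (1 / (1 + t\<^sup>2) * (1 / (1 + x\<^sup>2)))) \<partial>lborel)"
      unfolding cauchy_avg_def using B
      by (subst nn_integral_cmult[symmetric]) (auto simp: ennreal_mult[symmetric] mult.commute intro!: nn_integral_cong)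
    finally show "ennreal (norm (cconv \<delta> k g x) / (1 + x\<^sup>2)) \<le>
      (\<integral>\<^sup>+t. ennreal (B * norm (g (x + \<delta> * t)) * (1 / (1 + t\<^sup>2) * (1 / (1 + x\<^sup>2)))) \<partial>lborel)" .
  qed
  also have "\<dots> = (\<integral>\<^sup>+t. (\<integral>\<^sup>+x. ennreal (B * norm (g (x + \<delta> * t)) * (1 / (1 + t\<^sup>2) * (1 / (1 + x\<^sup>2)))) \<partial>lborel) \<partial>lborel)"
    by (rule lborel_pair.Fubini') measurable
  also have "\<dots> = (\<integral>\<^sup>+t. (\<integral>\<^sup>+y. ennreal (B * norm (g y) * (1 / (1 + t\<^sup>2) * (1 / (1 + (y - \<delta> * t)\<^sup>2)))) \<partial>lborel) \<partial>lborel)"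
  proof (rule nn_integral_cong)
    fix t
    show "(\<integral>\<^sup>+x. ennreal (B * norm (g (x + \<delta> * t)) * (1 / (1 + t\<^sup>2) * (1 / (1 + x\<^sup>2)))) \<partial>lborel) =
      (\<integral>\<^sup>+y. ennreal (B * norm (g y) * (1 / (1 + t\<^sup>2) * (1 / (1 + (y - \<delta> * t)\<^sup>2)))) \<partial>lborel)"
      by (subst (2) nn_integral_real_affine[where c=1 and t="\<delta> * t"]) (auto simp: add.commute)
  qed
  also have "\<dots> = (\<integral>\<^sup>+y. (\<integral>\<^sup>+t. ennreal (B * norm (g y) * (1 / (1 + t\<^sup>2) * (1 / (1 + (y - \<delta> * t)\<^sup>2)))) \<partial>lborel) \<partial>lborel)"
    by (rule lborel_pair.Fubini') measurable
  also have "\<dots> \<le> (\<integral>\<^sup>+y. ennreal D * ennreal (B * norm (g y) / (1 + y\<^sup>2)) \<partial>lborel)"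
  proof (rule nn_integral_mono)
    fix y
    have "(\<integral>\<^sup>+t. ennreal (B * norm (g y) * (1 / (1 + t\<^sup>2) * (1 / (1 + (y - \<delta> * t)\<^sup>2)))) \<partial>lborel) =
      ennreal (B * norm (g y)) * (\<integral>\<^sup>+t. ennreal (1 / (1 + t\<^sup>2) * (1 / (1 + (y - \<delta> * t)\<^sup>2))) \<partial>lborel)"
      using B by (subst nn_integral_cmult[symmetric]) (auto simp: ennreal_mult[symmetric] intro!: nn_integral_cong)
    also have "\<dots> \<le> ennreal (B * norm (g y)) * ennreal (D / (1 + y\<^sup>2))"
      unfolding D_def by (intro mult_left_mono nn_integral_cauchy_product_le \<delta>) auto
    also have "\<dots> = ennreal D * ennreal (B * norm (g y) / (1 + y\<^sup>2))"
      using B D by (simp add: ennreal_mult[symmetric] mult.commute)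
    finally show "(\<integral>\<^sup>+t. ennreal (B * norm (g y) * (1 / (1 + t\<^sup>2) * (1 / (1 + (y - \<delta> * t)\<^sup>2)))) \<partial>lborel)
      \<le> ennreal D * ennreal (B * norm (g y) / (1 + y\<^sup>2))" .
  qed
  also have "\<dots> = ennreal D * ennreal (LINT y|lborel. B * norm (g y) / (1 + y\<^sup>2))"
    using ib B by (subst nn_integral_cmult) (auto simp: nn_integral_eq_integral)
  also have "\<dots> < \<infinity>" by (simp add: ennreal_mult_less_top)
  finally have "integrable lborel (\<lambda>x. norm (cconv \<delta> k g x) / (1 + x\<^sup>2))"
    by (intro integrableI_nonneg) auto
  then show ?thesis by (simp add: cauchy_integrable_def)
qed

lemma cauchy_kernel_kconv:
  assumes k: "cauchy_kernel k" and l: "cauchy_kernel l"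
  shows "cauchy_kernel (kconv k l)" and "integrable lborel (\<lambda>t. k t * l (v - t))"
proof -
  obtain B where B: "0 < B" "\<And>t. \<bar>k t\<bar> \<le> B / (1 + t\<^sup>2)" and [measurable]: "k \<in> borel_measurable borel"
    using cauchy_kernelE[OF k] by blast
  obtain B' where B': "0 < B'" "\<And>t. \<bar>l t\<bar> \<le> B' / (1 + t\<^sup>2)" and [measurable]: "l \<in> borel_measurable borel"
    using cauchy_kernelE[OF l] by blast
  define h where "h v t = B * B' * (1 / (1 + t\<^sup>2) * (1 / (1 + (v - 1 * t)\<^sup>2)))" for v t :: real
  have nn: "(\<integral>\<^sup>+t. ennreal (h v t) \<partial>lborel) \<le> ennreal (B * B' * (8 * pi) / (1 + v\<^sup>2))" for v
  proof -
    have "(\<integral>\<^sup>+t. ennreal (h v t) \<partial>lborel) = ennreal (B * B') * (\<integral>\<^sup>+t. ennreal (1 / (1 + t\<^sup>2) * (1 / (1 + (v - 1 * t)\<^sup>2))) \<partial>lborel)"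
      using B B' unfolding h_def by (subst nn_integral_cmult[symmetric]) (auto simp: ennreal_mult[symmetric] intro!: nn_integral_cong)
    also have "\<dots> \<le> ennreal (B * B') * ennreal ((2 + 2 * 1\<^sup>2) * (pi + pi / \<bar>1\<bar>) / (1 + v\<^sup>2))"
      by (intro mult_left_mono nn_integral_cauchy_product_le) auto
    also have "\<dots> = ennreal (B * B' * (8 * pi) / (1 + v\<^sup>2))"
      using B B' by (simp add: ennreal_mult[symmetric])
    finally show ?thesis .
  qed
  have [measurable]: "(\<lambda>t. h v t) \<in> borel_measurable borel" for v unfolding h_def by measurable
  have h0: "0 \<le> h v t" for v t using B B' by (simp add: h_def)
  have ih: "integrable lborel (h v)" for v
    using nn[of v] h0 by (intro integrableI_nonneg) (auto simp: le_less_trans)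
  have le: "\<bar>k t * l (v - t)\<bar> \<le> h v t" for v t
    using mult_mono[OF B(2)[of t] B'(2)[of "v - t"]] B by (simp add: h_def abs_mult)
  show "integrable lborel (\<lambda>t. k t * l (v - t))" for v
    using ih[of v] by (rule Bochner_Integration.integrable_bound) (use le[of _ v] h0[of v] in auto)
  have "\<bar>kconv k l v\<bar> \<le> B * B' * (8 * pi) / (1 + v\<^sup>2)" for v
  proof -
    have "\<bar>kconv k l v\<bar> \<le> (LINT t|lborel. h v t)"
      unfolding kconv_def real_norm_def[symmetric]
      by (rule Bochner_Integration.integral_norm_bound_integral[OF _ ih]) (use le[of _ v] \<open>\<And>v. integrable lborel (\<lambda>t. k t * l (v - t))\<close> in auto)
    also have "\<dots> \<le> B * B' * (8 * pi) / (1 + v\<^sup>2)"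
      using nn[of v] ih[of v] h0 B B' by (subst (asm) nn_integral_eq_integral) (auto simp: ennreal_le_iff)
    finally show ?thesis .
  qed
  then show "cauchy_kernel (kconv k l)" unfolding cauchy_kernel_def by auto
qed

lemma cconv_diff:
  assumes "cauchy_kernel k" "cauchy_integrable f" "cauchy_integrable g" "\<delta> \<noteq> 0"
  shows "cconv \<delta> k (\<lambda>x. f x - g x) x = cconv \<delta> k f x - cconv \<delta> k g x"
  unfolding cconv_def scaleR_diff_right
  by (rule Bochner_Integration.integral_diff; rule integrable_cconv; fact)

text \<open>The hypothesis of Fubini's theorem in the two composition laws. The iterated integral of the absolute value is a composition of two convolutions of nonnegative functions, whose convergence is known.\<close>

lemma cconv_pair_integrable:
  assumes k: "cauchy_kernel k" and l: "cauchy_kernel l" and g: "cauchy_integrable g" and \<delta>: "\<delta> \<noteq> 0"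
  shows "integrable (lborel \<Otimes>\<^sub>M lborel) (\<lambda>(t, u). (k t * l u) *\<^sub>R g (x + \<delta> * t + \<delta> * u))"
proof -
  note [measurable] = cauchy_kernel_measurable[OF k] cauchy_kernel_measurable[OF l] cauchy_integrable_measurable[OF g]
  define G where "G y = complex_of_real (norm (g y))" for y
  have G: "cauchy_integrable G" unfolding G_def by (rule cauchy_integrable_norm[OF g])
  have "integrable lborel (\<lambda>t. \<bar>k t\<bar> *\<^sub>R cconv \<delta> (\<lambda>t. \<bar>l t\<bar>) G (x + \<delta> * t))"
    by (intro integrable_cconv cauchy_integrable_cconv cauchy_kernel_abs k l G \<delta>)
  then have "integrable lborel (\<lambda>t. Re (\<bar>k t\<bar> *\<^sub>R cconv \<delta> (\<lambda>t. \<bar>l t\<bar>) G (x + \<delta> * t)))"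
    by (rule integrable_Re)
  also have "(\<lambda>t. Re (\<bar>k t\<bar> *\<^sub>R cconv \<delta> (\<lambda>t. \<bar>l t\<bar>) G (x + \<delta> * t))) =
     (\<lambda>t. LINT u|lborel. norm ((k t * l u) *\<^sub>R g (x + \<delta> * t + \<delta> * u)))"
  proof
    fix t
    have "cconv \<delta> (\<lambda>t. \<bar>l t\<bar>) G (x + \<delta> * t) = (LINT u|lborel. complex_of_real (\<bar>l u\<bar> * norm (g (x + \<delta> * t + \<delta> * u))))"
      unfolding cconv_def G_def by (simp add: scaleR_conv_of_real)
    also have "\<dots> = complex_of_real (LINT u|lborel. \<bar>l u\<bar> * norm (g (x + \<delta> * t + \<delta> * u)))"
      by (rule integral_complex_of_real)
    finally have e: "cconv \<delta> (\<lambda>t. \<bar>l t\<bar>) G (x + \<delta> * t) = complex_of_real (LINT u|lborel. \<bar>l u\<bar> * norm (g (x + \<delta> * t + \<delta> * u)))" .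
    show "Re (\<bar>k t\<bar> *\<^sub>R cconv \<delta> (\<lambda>t. \<bar>l t\<bar>) G (x + \<delta> * t)) =
       (LINT u|lborel. norm ((k t * l u) *\<^sub>R g (x + \<delta> * t + \<delta> * u)))"
      unfolding e by (simp add: abs_mult mult.assoc)
  qed
  finally have 1: "integrable lborel (\<lambda>t. LINT u|lborel. norm (case (t, u) of (t, u) \<Rightarrow> (k t * l u) *\<^sub>R g (x + \<delta> * t + \<delta> * u)))"
    by simp
  show ?thesis
  proof (rule lborel_pair.Fubini_integrable)
    show "AE t in lborel. integrable lborel (\<lambda>u. case (t, u) of (t, u) \<Rightarrow> (k t * l u) *\<^sub>R g (x + \<delta> * t + \<delta> * u))"
    proof (rule AE_I2)
      fix t
      have "integrable lborel (\<lambda>u. k t *\<^sub>R (l u *\<^sub>R g ((x + \<delta> * t) + \<delta> * u)))"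
        by (intro integrable_scaleR_right integrable_cconv l g \<delta>)
      then show "integrable lborel (\<lambda>u. case (t, u) of (t, u) \<Rightarrow> (k t * l u) *\<^sub>R g (x + \<delta> * t + \<delta> * u))"
        by simp
    qed
  qed (use 1 in \<open>measurable; simp\<close>)+
qed

lemma cconv_cconv:
  "cconv \<delta> k (cconv \<delta> l g) x = (LINT t|lborel. LINT u|lborel. (k t * l u) *\<^sub>R g (x + \<delta> * t + \<delta> * u))"
proof -
  have "cconv \<delta> k (cconv \<delta> l g) x = (LINT t|lborel. k t *\<^sub>R (LINT u|lborel. l u *\<^sub>R g (x + \<delta> * t + \<delta> * u)))"
    by (simp add: cconv_def)
  also have "\<dots> = (LINT t|lborel. LINT u|lborel. (k t * l u) *\<^sub>R g (x + \<delta> * t + \<delta> * u))"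
    by (intro Bochner_Integration.integral_cong refl)
       (simp add: scaleR_scaleR[symmetric] del: scaleR_scaleR)
  finally show ?thesis .
qed

lemma cconv_commute:
  assumes k: "cauchy_kernel k" and l: "cauchy_kernel l" and g: "cauchy_integrable g" and \<delta>: "\<delta> \<noteq> 0"
  shows "cconv \<delta> k (cconv \<delta> l g) = cconv \<delta> l (cconv \<delta> k g)"
proof
  fix x
  have "cconv \<delta> k (cconv \<delta> l g) x = (LINT u|lborel. LINT t|lborel. (k t * l u) *\<^sub>R g (x + \<delta> * t + \<delta> * u))"
    unfolding cconv_cconv
    using lborel_pair.Fubini_integral[of "\<lambda>t u. (k t * l u) *\<^sub>R g (x + \<delta> * t + \<delta> * u)"] cconv_pair_integrable[OF assms, of x]
    by simp
  also have "\<dots> = cconv \<delta> l (cconv \<delta> k g) x"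
    unfolding cconv_cconv by (intro Bochner_Integration.integral_cong refl) (simp add: ac_simps)
  finally show "cconv \<delta> k (cconv \<delta> l g) x = cconv \<delta> l (cconv \<delta> k g) x" .
qed

lemma cconv_kconv:
  assumes k: "cauchy_kernel k" and l: "cauchy_kernel l" and g: "cauchy_integrable g" and \<delta>: "\<delta> \<noteq> 0"
  shows "cconv \<delta> k (cconv \<delta> l g) = cconv \<delta> (kconv k l) g"
proof
  fix x
  note [measurable] = cauchy_kernel_measurable[OF k] cauchy_kernel_measurable[OF l] cauchy_integrable_measurable[OF g]
  let ?f = "\<lambda>t u. (k t * l u) *\<^sub>R g (x + \<delta> * t + \<delta> * u)"
  let ?h = "\<lambda>t v. (k t * l (v - t)) *\<^sub>R g (x + \<delta> * v)"
  have i: "integrable (lborel \<Otimes>\<^sub>M lborel) (\<lambda>(t, u). ?f t u)" by (rule cconv_pair_integrable[OF assms])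
  have shift: "(LINT v|lborel. ?h t v) = (LINT u|lborel. ?f t u)"
    and shift_norm: "(LINT v|lborel. norm (?h t v)) = (LINT u|lborel. norm (?f t u))" for t
    by (subst lborel_integral_real_affine[where c=1 and t=t]; simp add: algebra_simps)+
  have ih: "integrable (lborel \<Otimes>\<^sub>M lborel) (\<lambda>(t, v). ?h t v)"
  proof (rule lborel_pair.Fubini_integrable)
    show "integrable lborel (\<lambda>t. LINT v|lborel. norm (case (t, v) of (t, v) \<Rightarrow> ?h t v))"
    proof -
      have "integrable (lborel \<Otimes>\<^sub>M lborel) (\<lambda>(t, u). norm (?f t u))"
        using integrable_norm[OF i] by (simp only: case_prod_beta')
      from lborel_pair.integrable_fst[OF this] show ?thesis
        unfolding shift_norm[symmetric] by simp
    qed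
    have "AE t in lborel. integrable lborel (?f t)"
      using lborel_pair.AE_integrable_fst[OF i] by simp
    then show "AE t in lborel. integrable lborel (\<lambda>v. case (t, v) of (t, v) \<Rightarrow> ?h t v)"
    proof eventually_elim
      case (elim t)
      then show ?case
        by (subst lborel_integrable_real_affine_iff[where c=1 and t=t, symmetric]) (auto simp: algebra_simps)
    qed
  qed measurable
  have "cconv \<delta> k (cconv \<delta> l g) x = (LINT t|lborel. LINT v|lborel. ?h t v)"
    unfolding cconv_cconv using shift by simp
  also have "\<dots> = (LINT v|lborel. LINT t|lborel. ?h t v)"
    using lborel_pair.Fubini_integral[of ?h] ih by simp
  also have "\<dots> = cconv \<delta> (kconv k l) g x"
    unfolding cconv_def kconv_def
    by (intro Bochner_Integration.integral_cong refl integral_scaleR_left) (use cauchy_kernel_kconv(2)[OF k l] in auto)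
  finally show "cconv \<delta> k (cconv \<delta> l g) x = cconv \<delta> (kconv k l) g x" .
qed

section \<open>Absolutely continuous functions are integrals of their derivatives\<close>

text \<open>Finite families of nonoverlapping nondegenerate intervals in \<open>{a..b}\<close>. Degenerate intervals are excluded because the same one may lie in packings of two adjacent intervals; without them a union of packings of different intervals is disjoint.\<close>

definition packing :: "real \<Rightarrow> real \<Rightarrow> (real \<times> real) set set" where
  "packing a b = {D. finite D \<and> (\<forall>(u, v)\<in>D. a \<le> u \<and> u < v \<and> v \<le> b) \<and>
     pairwise (\<lambda>(u, v) (u', v'). {u<..<v} \<inter> {u'<..<v'} = {}) D}"

definition vsum :: "(real \<Rightarrow> complex) \<Rightarrow> (real \<times> real) set \<Rightarrow> real" where
  "vsum f D = (\<Sum>(u, v)\<in>D. norm (f v - f u))"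

definition variation :: "(real \<Rightarrow> complex) \<Rightarrow> real \<Rightarrow> real \<Rightarrow> real" where
  "variation f a b = (SUP D\<in>packing a b. vsum f D)"

lemma packingI:
  assumes "finite D" "\<And>u v. (u, v) \<in> D \<Longrightarrow> a \<le> u \<and> u < v \<and> v \<le> b"
    and "\<And>u v u' v'. (u, v) \<in> D \<Longrightarrow> (u', v') \<in> D \<Longrightarrow> (u, v) \<noteq> (u', v') \<Longrightarrow> {u<..<v} \<inter> {u'<..<v'} = {}"
  shows "D \<in> packing a b"
  unfolding packing_def pairwise_def
proof (intro CollectI conjI ballI impI)
  fix d d' assume "d \<in> D" "d' \<in> D" "d \<noteq> d'"
  then show "(case d of (u, v) \<Rightarrow> \<lambda>(u', v'). {u<..<v} \<inter> {u'<..<v'} = {}) d'"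
    using assms(3)[of "fst d" "snd d" "fst d'" "snd d'"] by (simp add: case_prod_beta)
qed (use assms in auto)

lemma packingD: "D \<in> packing a b \<Longrightarrow> (u, v) \<in> D \<Longrightarrow> a \<le> u \<and> u < v \<and> v \<le> b"
  by (auto simp: packing_def)

lemma packing_disjoint:
  assumes "D \<in> packing a b" "(u, v) \<in> D" "(u', v') \<in> D" "(u, v) \<noteq> (u', v')"
  shows "{u<..<v} \<inter> {u'<..<v'} = {}"
  using assms unfolding packing_def pairwise_def by fastforce

lemma packing_empty [simp]: "{} \<in> packing a b"
  by (simp add: packing_def)

lemma packing_single: "a \<le> u \<Longrightarrow> u < v \<Longrightarrow> v \<le> b \<Longrightarrow> {(u, v)} \<in> packing a b"
  by (simp add: packing_def)

lemma packing_finite: "D \<in> packing a b \<Longrightarrow> finite D"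
  by (simp add: packing_def)

lemma packing_mono: "a' \<le> a \<Longrightarrow> b \<le> b' \<Longrightarrow> D \<in> packing a b \<Longrightarrow> D \<in> packing a' b'"
  unfolding packing_def by fastforce

lemma vsum_empty [simp]: "vsum f {} = 0"
  by (simp add: vsum_def)

lemma packing_UNION:
  assumes D: "D \<in> packing a b" and E: "\<And>d. d \<in> D \<Longrightarrow> E d \<in> packing (fst d) (snd d)"
  shows "(\<Union>d\<in>D. E d) \<in> packing a b"
    and "\<And>g :: _ \<Rightarrow> real. sum g (\<Union>d\<in>D. E d) = (\<Sum>d\<in>D. sum g (E d))"
proof -
  have sub: "{u<..<v} \<subseteq> {fst d<..<snd d}" "u < v" "fst d \<le> u" "v \<le> snd d" if "d \<in> D" "(u, v) \<in> E d" for d u v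
    using packingD[OF E[OF that(1)] that(2)] by auto
  have DD: "{fst d<..<snd d} \<inter> {fst d'<..<snd d'} = {}" if "d \<in> D" "d' \<in> D" "d \<noteq> d'" for d d'
    using packing_disjoint[OF D, of "fst d" "snd d" "fst d'" "snd d'"] that by (simp add: prod_eq_iff)
  have disj: "E d \<inter> E d' = {}" if "d \<in> D" "d' \<in> D" "d \<noteq> d'" for d d'
  proof (rule ccontr)
    assume "E d \<inter> E d' \<noteq> {}"
    then obtain u v where "(u, v) \<in> E d" "(u, v) \<in> E d'" by auto
    then have "{u<..<v} \<subseteq> {}" "u < v" using sub that DD[OF that] by blast+
    then show False by (auto simp: dest: dense)
  qed
  show "sum g (\<Union>d\<in>D. E d) = (\<Sum>d\<in>D. sum g (E d))" for g :: "_ \<Rightarrow> real"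
    using D disj packing_finite[OF E] by (intro sum.UNION_disjoint) (auto simp: packing_finite)
  show "(\<Union>d\<in>D. E d) \<in> packing a b"
  proof (rule packingI)
    show "finite (\<Union>d\<in>D. E d)" using D packing_finite[OF E] by (auto simp: packing_finite)
    show "a \<le> u \<and> u < v \<and> v \<le> b" if "(u, v) \<in> (\<Union>d\<in>D. E d)" for u v
      using sub D that unfolding packing_def by fastforce
    fix u v u' v' assume "(u, v) \<in> (\<Union>d\<in>D. E d)" "(u', v') \<in> (\<Union>d\<in>D. E d)" and ne: "(u, v) \<noteq> (u', v')"
    then obtain d d' where *: "d \<in> D" "(u, v) \<in> E d" "d' \<in> D" "(u', v') \<in> E d'" by blast
    show "{u<..<v} \<inter> {u'<..<v'} = {}"
    proof (cases "d = d'")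
      case True
      then have "(u', v') \<in> E d" using *(4) by simp
      then show ?thesis by (rule packing_disjoint[OF E[OF *(1)] *(2) _ ne])
    next
      case False
      then show ?thesis using Int_mono[OF sub(1)[OF *(1,2)] sub(1)[OF *(3,4)]] DD[OF *(1,3) False] by simp
    qed
  qed
qed

lemma packing_append:
  assumes "a \<le> m" "m \<le> b" and D: "D1 \<in> packing a m" "D2 \<in> packing m b"
  shows "D1 \<union> D2 \<in> packing a b" "vsum f (D1 \<union> D2) = vsum f D1 + vsum f D2"
proof -
  have b1: "a \<le> u \<and> u < v \<and> v \<le> m" if "(u, v) \<in> D1" for u v using that D by (auto simp: packing_def)
  have b2: "m \<le> u \<and> u < v \<and> v \<le> b" if "(u, v) \<in> D2" for u v using that D by (auto simp: packing_def)
  have p: "{u<..<v} \<inter> {u'<..<v'} = {}" if "(u, v) \<in> D1" "(u', v') \<in> D2" for u v u' v'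
    using b1[OF that(1)] b2[OF that(2)] by auto
  have "D1 \<inter> D2 = {}" using b1 b2 by fastforce
  then show "vsum f (D1 \<union> D2) = vsum f D1 + vsum f D2"
    unfolding vsum_def using D by (intro sum.union_disjoint) (auto simp: packing_finite)
  show "D1 \<union> D2 \<in> packing a b"
  proof (rule packingI)
    show "finite (D1 \<union> D2)" using D by (auto simp: packing_finite)
    show "a \<le> u \<and> u < v \<and> v \<le> b" if "(u, v) \<in> D1 \<union> D2" for u v
      using b1 b2 assms(1,2) that by fastforce
    fix u v u' v' assume *: "(u, v) \<in> D1 \<union> D2" "(u', v') \<in> D1 \<union> D2" "(u, v) \<noteq> (u', v')"
    from * consider "(u, v) \<in> D1" "(u', v') \<in> D1" | "(u, v) \<in> D2" "(u', v') \<in> D2"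
      | "(u, v) \<in> D1" "(u', v') \<in> D2" | "(u', v') \<in> D1" "(u, v) \<in> D2" by auto
    then show "{u<..<v} \<inter> {u'<..<v'} = {}"
    proof cases
      case 1 then show ?thesis by (rule packing_disjoint[OF D(1) _ _ *(3)])
    next
      case 2 then show ?thesis by (rule packing_disjoint[OF D(2) _ _ *(3)])
    next
      case 3 then show ?thesis by (rule p)
    next
      case 4 then show ?thesis using p[OF 4] by (simp only: Int_commute)
    qed
  qed
qed

text \<open>For a monotone \<open>h\<close> that shrinks intervals, the nondegenerate images of the members of a packing form a packing. It is used with \<open>min\<close> and \<open>max\<close>, which cut a packing at a point.\<close>

lemma packing_image:
  assumes D: "D \<in> packing a b" and h: "mono h"
    and lo: "\<And>x. a \<le> x \<Longrightarrow> x \<le> b \<Longrightarrow> l \<le> h x" and hi: "\<And>x. a \<le> x \<Longrightarrow> x \<le> b \<Longrightarrow> h x \<le> m"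
    and sub: "\<And>u v. u < v \<Longrightarrow> h u < h v \<Longrightarrow> u \<le> h u \<and> h v \<le> v"
  shows "map_prod h h ` {d \<in> D. h (fst d) < h (snd d)} \<in> packing l m"
    and "vsum f (map_prod h h ` {d \<in> D. h (fst d) < h (snd d)}) = (\<Sum>(u, v)\<in>D. norm (f (h v) - f (h u)))"
proof -
  define D' where "D' = {d \<in> D. h (fst d) < h (snd d)}"
  define H where "H d = (h (fst d), h (snd d))" for d :: "real \<times> real"
  have e: "map_prod h h ` {d \<in> D. h (fst d) < h (snd d)} = H ` D'"
    by (auto simp: D'_def H_def intro!: image_cong)
  have fin: "finite D" using D by (rule packing_finite)
  have bd: "a \<le> u" "u < v" "v \<le> b" if "(u, v) \<in> D" for u v using that D by (auto simp: packing_def)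
  have nonov: "{h u<..<h v} \<inter> {h u'<..<h v'} = {}"
    if "(u, v) \<in> D'" "(u', v') \<in> D'" "(u, v) \<noteq> (u', v')" for u v u' v'
  proof -
    have "{u<..<v} \<inter> {u'<..<v'} = {}"
      using packing_disjoint[OF D _ _ that(3)] that by (simp add: D'_def)
    moreover have "{h u<..<h v} \<subseteq> {u<..<v}" "{h u'<..<h v'} \<subseteq> {u'<..<v'}"
    proof -
      have *: "{h u<..<h v} \<subseteq> {u<..<v}" if "(u, v) \<in> D'" for u v
      proof -
        have "(u, v) \<in> D" "h u < h v" using that by (simp_all add: D'_def)
        then have "u \<le> h u" "h v \<le> v" using sub[of u v] bd(2) by blast+
        then show ?thesis by auto
      qed
      show "{h u<..<h v} \<subseteq> {u<..<v}" "{h u'<..<h v'} \<subseteq> {u'<..<v'}" using *[OF that(1)] *[OF that(2)] .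
    qed
    ultimately show ?thesis by blast
  qed
  have inj: "inj_on H D'"
  proof (rule inj_onI, rule ccontr)
    fix d d' assume *: "d \<in> D'" "d' \<in> D'" "H d = H d'" "d \<noteq> d'"
    have "{h (fst d)<..<h (snd d)} \<inter> {h (fst d')<..<h (snd d')} = {}"
      using * by (intro nonov) simp_all
    moreover have "h (fst d') = h (fst d)" "h (snd d') = h (snd d)" using *(3) by (simp_all add: H_def)
    ultimately have "{h (fst d)<..<h (snd d)} = {}" by simp
    moreover have "h (fst d) < h (snd d)" using *(1) by (simp add: D'_def)
    ultimately show False by simp
  qed
  show "map_prod h h ` {d \<in> D. h (fst d) < h (snd d)} \<in> packing l m"
    unfolding e
  proof (rule packingI)
    show "finite (H ` D')" using fin by (simp add: D'_def)
    show "l \<le> u \<and> u < v \<and> v \<le> m" if uv: "(u, v) \<in> H ` D'" for u v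
    proof -
      from uv obtain d where d: "(u, v) = H d" "d \<in> D'" by (rule imageE)
      have dD: "(fst d, snd d) \<in> D" "h (fst d) < h (snd d)" using d(2) by (simp_all add: D'_def)
      have e: "u = h (fst d)" "v = h (snd d)" using d(1) by (simp_all add: H_def)
      show ?thesis unfolding e using dD(2) lo[of "fst d"] hi[of "snd d"] bd[OF dD(1)] by linarith
    qed
    fix u v u' v' assume *: "(u, v) \<in> H ` D'" "(u', v') \<in> H ` D'" "(u, v) \<noteq> (u', v')"
    from *(1) obtain d where d: "(u, v) = H d" "d \<in> D'" by (rule imageE)
    from *(2) obtain d' where d': "(u', v') = H d'" "d' \<in> D'" by (rule imageE)
    have "d \<noteq> d'" using *(3) d(1) d'(1) by auto
    then have "(fst d, snd d) \<noteq> (fst d', snd d')" by simp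
    then have "{h (fst d)<..<h (snd d)} \<inter> {h (fst d')<..<h (snd d')} = {}"
      using d(2) d'(2) by (intro nonov) simp_all
    moreover have "u = h (fst d)" "v = h (snd d)" "u' = h (fst d')" "v' = h (snd d')"
      using d(1) d'(1) unfolding H_def by blast+
    ultimately show "{u<..<v} \<inter> {u'<..<v'} = {}" by (simp only:)
  qed
  have "vsum f (H ` D') = (\<Sum>(u, v)\<in>D'. norm (f (h v) - f (h u)))"
    unfolding vsum_def by (subst sum.reindex[OF inj]) (simp add: H_def case_prod_beta)
  also have "\<dots> = (\<Sum>(u, v)\<in>D. norm (f (h v) - f (h u)))"
  proof (rule sum.mono_neutral_left[OF fin])
    show "D' \<subseteq> D" by (auto simp: D'_def)
    show "\<forall>d\<in>D - D'. (case d of (u, v) \<Rightarrow> norm (f (h v) - f (h u))) = 0"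
    proof
      fix d assume "d \<in> D - D'"
      then have d: "(fst d, snd d) \<in> D" "\<not> h (fst d) < h (snd d)" by (auto simp: D'_def)
      then have "h (fst d) = h (snd d)" using monoD[OF h, of "fst d" "snd d"] bd[OF d(1)] by linarith
      then show "(case d of (u, v) \<Rightarrow> norm (f (h v) - f (h u))) = 0" by (simp add: case_prod_beta)
    qed
  qed
  finally show "vsum f (map_prod h h ` {d \<in> D. h (fst d) < h (snd d)}) = (\<Sum>(u, v)\<in>D. norm (f (h v) - f (h u)))"
    unfolding e .
qed

lemma packing_split:
  assumes D: "D \<in> packing a b" and m: "a \<le> m" "m \<le> b"
  obtains D1 D2 where "D1 \<in> packing a m" "D2 \<in> packing m b" "vsum f D \<le> vsum f D1 + vsum f D2"
proof -
  let ?l = "\<lambda>x. min x m" let ?r = "\<lambda>x. max x m"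
  have l: "mono ?l" "mono ?r" by (auto simp: mono_def)
  note L = packing_image[OF D l(1), of a m] note R = packing_image[OF D l(2), of m b]
  show thesis
  proof (rule that)
    show "(map_prod ?l ?l ` {d \<in> D. ?l (fst d) < ?l (snd d)}) \<in> packing a m"
      by (rule L(1)) (use m in auto)
    show "(map_prod ?r ?r ` {d \<in> D. ?r (fst d) < ?r (snd d)}) \<in> packing m b"
      by (rule R(1)) (use m in auto)
    have "vsum f D \<le> (\<Sum>(u, v)\<in>D. norm (f (?l v) - f (?l u)) + norm (f (?r v) - f (?r u)))"
      unfolding vsum_def
    proof (rule sum_mono, clarify)
      fix u v assume "(u, v) \<in> D"
      then have "u < v" using D by (auto simp: packing_def)
      have "norm (f v - f u) \<le> norm (f m - f u) + norm (f v - f m)"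
        using norm_triangle_ineq[of "f m - f u" "f v - f m"] by simp
      then show "norm (f v - f u) \<le> norm (f (?l v) - f (?l u)) + norm (f (?r v) - f (?r u))"
        using \<open>u < v\<close> by (auto simp: min_def max_def)
    qed
    also have "\<dots> = vsum f (map_prod ?l ?l ` {d \<in> D. ?l (fst d) < ?l (snd d)}) + vsum f (map_prod ?r ?r ` {d \<in> D. ?r (fst d) < ?r (snd d)})"
    proof -
      have "vsum f (map_prod ?l ?l ` {d \<in> D. ?l (fst d) < ?l (snd d)}) = (\<Sum>(u, v)\<in>D. norm (f (?l v) - f (?l u)))"
        by (rule L(2)) (use m in auto)
      moreover have "vsum f (map_prod ?r ?r ` {d \<in> D. ?r (fst d) < ?r (snd d)}) = (\<Sum>(u, v)\<in>D. norm (f (?r v) - f (?r u)))"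
        by (rule R(2)) (use m in auto)
      ultimately show ?thesis by (simp add: sum.distrib case_prod_beta)
    qed
    finally show "vsum f D \<le> \<dots>" .
  qed
qed

lemma packing_length:
  assumes D: "D \<in> packing a b" and "a \<le> b"
  shows "(\<Sum>(u, v)\<in>D. v - u) \<le> b - a"
proof -
  have "disjoint_family_on (\<lambda>d. {fst d<..<snd d}) D"
    using D unfolding disjoint_family_on_def packing_def pairwise_def by fastforce
  then have "(\<Sum>d\<in>D. emeasure lborel {fst d<..<snd d}) = emeasure lborel (\<Union>d\<in>D. {fst d<..<snd d})"
    using D by (intro sum_emeasure) (auto simp: packing_finite)
  also have "\<dots> \<le> emeasure lborel {a..b}"
    using D by (intro emeasure_mono) (fastforce simp: packing_def)+
  also have "\<dots> = ennreal (b - a)" using assms by simp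
  also have "(\<Sum>d\<in>D. emeasure lborel {fst d<..<snd d}) = (\<Sum>d\<in>D. ennreal (snd d - fst d))"
    using D by (intro sum.cong refl) (auto simp: packing_def less_imp_le)
  also have "\<dots> = ennreal (\<Sum>d\<in>D. snd d - fst d)"
    using D by (intro sum_ennreal) (auto simp: packing_def less_imp_le)
  finally show ?thesis using assms by (simp add: case_prod_beta)
qed

lemma abs_continuous_packing:
  assumes "abs_continuous_on {a..b} f" and "0 < \<epsilon>"
  obtains \<delta> where "0 < \<delta>" "\<And>D. D \<in> packing a b \<Longrightarrow> (\<Sum>(u, v)\<in>D. v - u) < \<delta> \<Longrightarrow> vsum f D < \<epsilon>"
proof -
  obtain \<delta> where \<delta>: "0 < \<delta>" "\<And>D. finite D \<Longrightarrow> (\<forall>(u, v)\<in>D. u \<le> v \<and> {u..v} \<subseteq> {a..b}) \<Longrightarrow>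
        pairwise (\<lambda>(u, v) (u', v'). {u<..<v} \<inter> {u'<..<v'} = {}) D \<Longrightarrow>
        (\<Sum>(u, v)\<in>D. v - u) < \<delta> \<Longrightarrow> (\<Sum>(u, v)\<in>D. norm (f v - f u)) < \<epsilon>"
    using assms unfolding abs_continuous_on_def by meson
  show thesis
  proof (rule that[OF \<delta>(1)])
    fix D assume D: "D \<in> packing a b" "(\<Sum>(u, v)\<in>D. v - u) < \<delta>"
    show "vsum f D < \<epsilon>" unfolding vsum_def
      using D by (intro \<delta>(2)) (fastforce simp: packing_def)+
  qed
qed

text \<open>Absolute continuity bounds the sums over packings of an interval shorter than \<open>\<delta>\<close> by \<open>1\<close>; cutting \<open>{a..b}\<close> into finitely many such pieces bounds them on the whole interval.\<close>

lemma variation_bounded: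
  assumes ac: "abs_continuous_on {a..b} f"
  shows "bdd_above (vsum f ` packing a b)"
proof -
  obtain \<delta> where \<delta>: "0 < \<delta>" "\<And>D. D \<in> packing a b \<Longrightarrow> (\<Sum>(u, v)\<in>D. v - u) < \<delta> \<Longrightarrow> vsum f D < 1"
    using abs_continuous_packing[OF ac, of 1] by auto
  have *: "vsum f D \<le> real (Suc n)"
    if "D \<in> packing c b" "a \<le> c" "c \<le> b" "b - c \<le> real (Suc n) * (\<delta> / 2)" for D c n
    using that
  proof (induction n arbitrary: D c)
    case 0
    then have "(\<Sum>(u, v)\<in>D. v - u) \<le> b - c" by (intro packing_length)
    also have "\<dots> < \<delta>" using 0 \<delta>(1) by simp
    finally show ?case using \<delta>(2)[of D] 0 packing_mono[of a c b b D] by simp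
  next
    case (Suc n)
    define m where "m = min b (c + \<delta> / 2)"
    have m: "c \<le> m" "m \<le> b" using Suc.prems \<delta>(1) by (auto simp: m_def)
    obtain D1 D2 where D12: "D1 \<in> packing c m" "D2 \<in> packing m b" "vsum f D \<le> vsum f D1 + vsum f D2"
      using packing_split[OF Suc.prems(1) m] by blast
    have "(\<Sum>(u, v)\<in>D1. v - u) \<le> m - c" by (intro packing_length D12 m)
    also have "\<dots> < \<delta>" using \<delta>(1) by (auto simp: m_def)
    finally have 1: "vsum f D1 < 1" using \<delta>(2)[of D1] D12 packing_mono[of a c m b D1] m Suc.prems by simp
    have "b - m \<le> real (Suc n) * (\<delta> / 2)"
      using Suc.prems(4) \<delta>(1) by (auto simp: m_def min_def algebra_simps)
    then have "vsum f D2 \<le> real (Suc n)" using D12 m Suc.prems by (intro Suc.IH[of D2 m]) auto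
    then show ?case using 1 D12 by simp
  qed
  show ?thesis
  proof (cases "a \<le> b")
    case True
    obtain n where "(b - a) / (\<delta> / 2) \<le> real n" using real_arch_simple by blast
    then have "b - a \<le> real n * (\<delta> / 2)" using \<delta>(1) by (simp add: field_simps)
    also have "\<dots> \<le> real (Suc n) * (\<delta> / 2)" using \<delta>(1) by simp
    finally have "b - a \<le> real (Suc n) * (\<delta> / 2)" .
    then show ?thesis using *[of _ a n] True by (intro bdd_aboveI2[of _ _ "real (Suc n)"]) auto
  next
    case False
    then have "packing a b \<subseteq> {{}}" by (fastforce simp: packing_def)
    then have "finite (packing a b)" by (rule finite_subset) simp
    then show ?thesis by simp
  qed
qed

context
  fixes a b :: real and f :: "real \<Rightarrow> complex"
  assumes ac: "abs_continuous_on {a..b} f"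
begin

lemma variation_upper:
  assumes "D \<in> packing x y" "a \<le> x" "y \<le> b"
  shows "vsum f D \<le> variation f x y"
  unfolding variation_def
proof (rule cSUP_upper[OF assms(1)])
  show "bdd_above (vsum f ` packing x y)"
    by (rule bdd_above_mono[OF variation_bounded[OF ac] image_mono[OF subsetI[OF packing_mono[OF assms(2,3)]]]])
qed

lemma variation_add:
  assumes "a \<le> x" "x \<le> m" "m \<le> y" "y \<le> b"
  shows "variation f x y = variation f x m + variation f m y"
proof (rule antisym)
  show "variation f x y \<le> variation f x m + variation f m y"
    unfolding variation_def[of f x y]
  proof (rule cSUP_least)
    fix D assume "D \<in> packing x y"
    then obtain D1 D2 where D: "D1 \<in> packing x m" "D2 \<in> packing m y" "vsum f D \<le> vsum f D1 + vsum f D2"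
      using packing_split[of D x y m] assms by blast
    then show "vsum f D \<le> variation f x m + variation f m y"
      using variation_upper[OF D(1)] variation_upper[OF D(2)] assms by auto
  qed (use packing_empty[of x y] in blast)
  have 1: "vsum f D1 \<le> variation f x y - vsum f D2" if "D1 \<in> packing x m" "D2 \<in> packing m y" for D1 D2
    using packing_append[OF assms(2,3) that] variation_upper[of "D1 \<union> D2" x y] assms by simp
  have "variation f x m \<le> variation f x y - vsum f D2" if "D2 \<in> packing m y" for D2
    unfolding variation_def[of f x m] by (rule cSUP_least) (use 1 that packing_empty[of x m] in blast)+
  then have "vsum f D2 \<le> variation f x y - variation f x m" if "D2 \<in> packing m y" for D2
    using that by (simp add: le_diff_eq add.commute)
  then have "variation f m y \<le> variation f x y - variation f x m"
    unfolding variation_def[of f m y] by (intro cSUP_least) (use packing_empty[of m y] in blast)+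
  then show "variation f x m + variation f m y \<le> variation f x y" by simp
qed

lemma norm_le_variation:
  assumes "a \<le> x" "x \<le> y" "y \<le> b"
  shows "norm (f y - f x) \<le> variation f x y"
proof (cases "x = y")
  case True
  then show ?thesis using variation_upper[of "{}" x y] assms by simp
next
  case False
  then show ?thesis using variation_upper[of "{(x, y)}" x y] packing_single[of x x y y] assms by (simp add: vsum_def)
qed

text \<open>Each interval of a packing is replaced by a packing of it that nearly attains the variation. The refined family is not longer than the original one, so that absolute continuity of \<open>f\<close> applies to it.\<close>

lemma variation_abs_continuous:
  assumes "0 < \<epsilon>"
  obtains \<delta> where "0 < \<delta>" "\<And>D. D \<in> packing a b \<Longrightarrow> (\<Sum>(u, v)\<in>D. v - u) < \<delta> \<Longrightarrow> (\<Sum>(u, v)\<in>D. variation f u v) < \<epsilon>"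
proof -
  obtain \<delta> where \<delta>: "0 < \<delta>" "\<And>D. D \<in> packing a b \<Longrightarrow> (\<Sum>(u, v)\<in>D. v - u) < \<delta> \<Longrightarrow> vsum f D < \<epsilon> / 2"
    using abs_continuous_packing[OF ac, of "\<epsilon> / 2"] assms by auto
  show thesis
  proof (rule that[OF \<delta>(1)])
    fix D assume D: "D \<in> packing a b" and len: "(\<Sum>(u, v)\<in>D. v - u) < \<delta>"
    have uv: "a \<le> fst d \<and> fst d < snd d \<and> snd d \<le> b" if "d \<in> D" for d using D that by (auto simp: packing_def)
    \<comment> \<open>The total loss over all intervals is at most \<open>\<epsilon> / 2\<close>; adding \<open>1\<close> covers an empty \<open>D\<close>.\<close>
    define e where "e = \<epsilon> / (2 * (real (card D) + 1))"
    have e: "0 < e" "real (card D) * e \<le> \<epsilon> / 2" using assms by (auto simp: e_def field_simps)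
    have "\<exists>E\<in>packing (fst d) (snd d). variation f (fst d) (snd d) - e < vsum f E" if "d \<in> D" for d
      unfolding variation_def using e(1) variation_upper[of _ "fst d" "snd d"] uv[OF that]
      by (subst less_cSUP_iff[symmetric]) (auto intro!: bdd_aboveI2[of _ _ "variation f (fst d) (snd d)"] packing_empty)
    then obtain E where E: "\<And>d. d \<in> D \<Longrightarrow> E d \<in> packing (fst d) (snd d)"
        "\<And>d. d \<in> D \<Longrightarrow> variation f (fst d) (snd d) - e < vsum f (E d)" by metis
    note U = packing_UNION[OF D E(1)]
    have "(\<Sum>(u, v)\<in>(\<Union>d\<in>D. E d). v - u) = (\<Sum>d\<in>D. \<Sum>(u, v)\<in>E d. v - u)" by (rule U(2)) auto
    also have "\<dots> \<le> (\<Sum>d\<in>D. snd d - fst d)"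
      using uv by (intro sum_mono packing_length E) (auto intro: less_imp_le)
    also have "\<dots> < \<delta>" using len by (simp add: case_prod_beta)
    finally have "vsum f (\<Union>d\<in>D. E d) < \<epsilon> / 2" by (intro \<delta>(2) U(1)) auto
    moreover have "vsum f (\<Union>d\<in>D. E d) = (\<Sum>d\<in>D. vsum f (E d))" unfolding vsum_def by (rule U(2)) auto
    moreover have "(\<Sum>d\<in>D. variation f (fst d) (snd d)) \<le> (\<Sum>d\<in>D. vsum f (E d) + e)"
      by (intro sum_mono) (use E(2) in \<open>fastforce simp: less_diff_eq\<close>)
    ultimately show "(\<Sum>(u, v)\<in>D. variation f u v) < \<epsilon>"
      using e by (simp add: sum.distrib case_prod_beta)
  qed
qed

end

text \<open>The measure with distribution function \<open>F\<close> is absolutely continuous with respect to Lebesgue measure, and its Radon-Nikodym derivative is the density. To see that a null set is null for it, take a compact subset, enclose it in an open set of measure less than \<open>\<delta>\<close>, and cover it by cells of a fine grid that stay inside the open set: the cells form a packing of total length less than \<open>\<delta>\<close>.\<close>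

lemma mono_abs_continuous_density:
  fixes F :: "real \<Rightarrow> real"
  assumes ab: "a < b" and mono: "mono F" and cont: "continuous_on UNIV F"
    and out: "\<And>x. x \<le> a \<Longrightarrow> F x = F a" "\<And>x. b \<le> x \<Longrightarrow> F x = F b"
    and ac: "\<And>\<epsilon>. 0 < \<epsilon> \<Longrightarrow> \<exists>\<delta>>0. \<forall>D\<in>packing a b. (\<Sum>(u, v)\<in>D. v - u) < \<delta> \<longrightarrow> (\<Sum>(u, v)\<in>D. F v - F u) < \<epsilon>"
  obtains g where "integrable lborel g" "\<And>x y. x \<le> y \<Longrightarrow> F y - F x = (LINT t:{x..y}|lborel. g t)"
proof -
  define \<mu> where "\<mu> = interval_measure F"
  have rc: "continuous (at_right x) F" for x
    using cont by (simp add: continuous_on_eq_continuous_at continuous_at_imp_continuous_at_within)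
  note monoF = monoD[OF mono]
  have Ioc: "emeasure \<mu> {x<..y} = ennreal (F y - F x)" if "x \<le> y" for x y
    unfolding \<mu>_def using that monoF rc by (rule emeasure_interval_measure_Ioc)
  have [measurable_cong, simp]: "sets \<mu> = sets borel" and [simp]: "space \<mu> = UNIV" by (simp_all add: \<mu>_def)
  have tot: "emeasure \<mu> UNIV \<le> ennreal (F b - F a)"
  proof -
    have "emeasure \<mu> {- real n<..real n} \<le> ennreal (F b - F a)" for n
    proof -
      have "F (real n) \<le> F b" using monoF[of "real n" b] out(2)[of "real n"] by (cases "real n \<le> b") auto
      moreover have "F a \<le> F (- real n)" using monoF[of a "- real n"] out(1)[of "- real n"] by (cases "a \<le> - real n") auto
      ultimately show ?thesis by (subst Ioc) (auto intro!: ennreal_leI)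
    qed
    moreover have "(SUP n. emeasure \<mu> {- real n<..real n}) = emeasure \<mu> (\<Union>n. {- real n<..real n})"
      by (rule SUP_emeasure_incseq) (auto simp: incseq_def)
    moreover have "(\<Union>n. {- real n<..real n}) = UNIV"
    proof safe
      fix x :: real
      obtain n where "\<bar>x\<bar> < real n" using reals_Archimedean2 by blast
      then show "x \<in> (\<Union>n. {- real n<..real n})" by (auto intro!: exI[of _ n])
    qed simp
    ultimately show ?thesis by (metis (no_types, lifting) SUP_least)
  qed
  then interpret fm: finite_measure \<mu> by (intro finite_measureI) (auto simp: top_unique)
  have ab1: "F a \<le> F b" using monoF ab by simp
  have outside: "emeasure \<mu> (UNIV - {a<..b}) = 0"
  proof -
    have "emeasure \<mu> (UNIV - {a<..b}) = emeasure \<mu> UNIV - emeasure \<mu> {a<..b}"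
      by (subst emeasure_Diff) auto
    then show ?thesis using tot ab fm.emeasure_finite[of UNIV] by (simp add: Ioc diff_eq_0_iff_ennreal ab1 less_top[symmetric])
  qed
  have null: "emeasure \<mu> N = 0" if N: "N \<in> sets borel" "emeasure lborel N = 0" for N
  proof -
    have "emeasure \<mu> N \<le> emeasure \<mu> (N \<inter> {a<..b}) + emeasure \<mu> (UNIV - {a<..b})"
      using N by (intro order.trans[OF emeasure_mono emeasure_subadditive]) auto
    moreover have "emeasure \<mu> (N \<inter> {a<..b}) \<le> 0"
    proof (rule ennreal_le_epsilon)
      fix e :: real assume e: "0 < e"
      obtain \<delta> where \<delta>: "0 < \<delta>" "\<And>D. D \<in> packing a b \<Longrightarrow> (\<Sum>(u, v)\<in>D. v - u) < \<delta> \<Longrightarrow> (\<Sum>(u, v)\<in>D. F v - F u) < e"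
        using ac[OF e] by blast
      have M: "N \<inter> {a<..b} \<in> sets borel" using N by auto
      have M0: "emeasure lborel (N \<inter> {a<..b}) = 0"
        using emeasure_mono[of "N \<inter> {a<..b}" N lborel] N by simp
      obtain U where U: "open U" "N \<inter> {a<..b} \<subseteq> U" "emeasure lborel (U - (N \<inter> {a<..b})) < ennreal \<delta>"
        using outer_regular_lborel[OF M, of \<delta>] \<delta>(1) by auto
      have Ud: "emeasure lborel U < ennreal \<delta>"
      proof -
        have "emeasure lborel U = emeasure lborel (U - (N \<inter> {a<..b}))"
          using M M0 U by (subst emeasure_Diff_null_set) (auto simp: null_sets_def)
        then show ?thesis using U by simp
      qed
      have "emeasure \<mu> K \<le> ennreal e" if K: "K \<subseteq> N \<inter> {a<..b}" "compact K" for K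
      proof (cases "K = {}")
        case False
        obtain d where d: "0 < d" "(\<Union>x\<in>K. ball x d) \<subseteq> U"
          using compact_subset_open_imp_ball_epsilon_subset[OF K(2) U(1)] K U by blast
        obtain n :: nat where n: "(b - a) / d < real n" using reals_Archimedean2 by blast
        then have n0: "0 < real n" using divide_pos_pos[of "b - a" d] ab d by linarith
        \<comment> \<open>A cell of length less than \<open>d\<close> that meets \<open>K\<close> lies in \<open>U\<close>.\<close>
        define \<eta> where "\<eta> = (b - a) / real n"
        have \<eta>: "0 < \<eta>" "\<eta> < d" "real n * \<eta> = b - a" using n n0 ab d by (auto simp: \<eta>_def field_simps)
        define I where "I = {i. i < n \<and> K \<inter> {a + real i * \<eta><..a + real (Suc i) * \<eta>} \<noteq> {}}"
        define C where "C i = (a + real i * \<eta>, a + real (Suc i) * \<eta>)" for i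
        have finI: "finite I" by (auto simp: I_def)
        have injC: "inj_on C I" using \<eta> by (auto simp: inj_on_def C_def)
        have disj: "{fst (C i)<..snd (C i)} \<inter> {fst (C j)<..snd (C j)} = {}" if "i \<noteq> j" for i j
        proof -
          have *: "a + real (Suc i) * \<eta> \<le> a + real j * \<eta>" if "i < j" for i j
            using that \<eta> by (intro add_left_mono mult_right_mono) auto
          show ?thesis using *[of i j] *[of j i] that by (cases "i < j") (auto simp: C_def)
        qed
        have D: "C ` I \<in> packing a b"
        proof (rule packingI)
          show "finite (C ` I)" using finI by simp
          fix u v assume "(u, v) \<in> C ` I"
          then obtain i where i: "i \<in> I" "u = a + real i * \<eta>" "v = a + real (Suc i) * \<eta>" by (auto simp: C_def)
          have "real (Suc i) * \<eta> \<le> real n * \<eta>" using i \<eta> by (intro mult_right_mono) (auto simp: I_def)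
          then show "a \<le> u \<and> u < v \<and> v \<le> b" using i \<eta> by (auto simp: algebra_simps)
        next
          fix u v u' v' assume "(u, v) \<in> C ` I" "(u', v') \<in> C ` I" "(u, v) \<noteq> (u', v')"
          then obtain i j where ij: "(u, v) = C i" "(u', v') = C j" by blast
          with \<open>(u, v) \<noteq> (u', v')\<close> have ne: "i \<noteq> j" by auto
          have "{u<..<v} \<subseteq> {fst (C i)<..snd (C i)}" "{u'<..<v'} \<subseteq> {fst (C j)<..snd (C j)}"
            using ij(1,2)[symmetric] by auto
          then show "{u<..<v} \<inter> {u'<..<v'} = {}" using disj[OF ne] by blast
        qed
        have cover: "K \<subseteq> (\<Union>i\<in>I. {fst (C i)<..snd (C i)})"
        proof
          fix x assume x: "x \<in> K"
          then have xab: "a < x" "x \<le> b" using K by auto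
          define m where "m = nat (\<lceil>(x - a) / \<eta>\<rceil> - 1)"
          have c1: "1 \<le> \<lceil>(x - a) / \<eta>\<rceil>" using xab \<eta> by simp
          have "real m = of_int \<lceil>(x - a) / \<eta>\<rceil> - 1" using c1 by (simp add: m_def)
          then have m: "real m < (x - a) / \<eta>" "(x - a) / \<eta> \<le> real (Suc m)"
            using ceiling_correct[of "(x - a) / \<eta>"] by linarith+
          have "(x - a) / \<eta> \<le> real n" using xab \<eta> by (simp add: field_simps)
          then have "m < n" using m by linarith
          moreover have "x \<in> {fst (C m)<..snd (C m)}" using m \<eta> by (simp add: C_def field_simps)
          ultimately have "m \<in> I" "x \<in> {fst (C m)<..snd (C m)}" using x by (auto simp: I_def C_def)
          then show "x \<in> (\<Union>i\<in>I. {fst (C i)<..snd (C i)})" by (rule UN_I)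
        qed
        have inU: "{fst (C i)<..snd (C i)} \<subseteq> U" if "i \<in> I" for i
        proof
          fix y assume y: "y \<in> {fst (C i)<..snd (C i)}"
          have "K \<inter> {fst (C i)<..snd (C i)} \<noteq> {}" using \<open>i \<in> I\<close> by (simp add: I_def C_def)
          then obtain x where x: "x \<in> K" "x \<in> {fst (C i)<..snd (C i)}" by blast
          then have "dist x y < d" using y \<eta> by (auto simp: C_def dist_real_def algebra_simps)
          then show "y \<in> U" using d x by (auto simp: subset_iff)
        qed
        have "ennreal (\<Sum>i\<in>I. snd (C i) - fst (C i)) = (\<Sum>i\<in>I. emeasure lborel {fst (C i)<..snd (C i)})"
          using \<eta> by (subst sum_ennreal[symmetric]) (auto simp: C_def algebra_simps)
        also have "\<dots> = emeasure lborel (\<Union>i\<in>I. {fst (C i)<..snd (C i)})"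
          using finI disj by (intro sum_emeasure) (auto simp: disjoint_family_on_def)
        also have "\<dots> \<le> emeasure lborel U" using inU U by (intro emeasure_mono) auto
        also have "\<dots> < ennreal \<delta>" by fact
        finally have "(\<Sum>i\<in>I. snd (C i) - fst (C i)) < \<delta>"
          using \<eta> by (subst (asm) ennreal_less_iff) (auto intro!: sum_nonneg simp: C_def algebra_simps)
        then have "(\<Sum>(u, v)\<in>C ` I. F v - F u) < e"
          by (intro \<delta>(2)[OF D]) (simp add: sum.reindex[OF injC] case_prod_beta)
        then have Fe: "(\<Sum>i\<in>I. F (snd (C i)) - F (fst (C i))) < e"
          by (simp add: sum.reindex[OF injC] case_prod_beta)
        have "emeasure \<mu> K \<le> emeasure \<mu> (\<Union>i\<in>I. {fst (C i)<..snd (C i)})"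
          using cover finI by (intro emeasure_mono) auto
        also have "\<dots> \<le> (\<Sum>i\<in>I. emeasure \<mu> {fst (C i)<..snd (C i)})"
          using finI by (intro emeasure_subadditive_finite) auto
        also have "\<dots> = (\<Sum>i\<in>I. ennreal (F (snd (C i)) - F (fst (C i))))"
          using \<eta> by (intro sum.cong refl Ioc) (auto simp: C_def algebra_simps)
        also have "\<dots> = ennreal (\<Sum>i\<in>I. F (snd (C i)) - F (fst (C i)))"
          using \<eta> by (intro sum_ennreal) (auto simp: C_def algebra_simps intro!: monoF)
        also have "\<dots> \<le> ennreal e" using Fe by (intro ennreal_leI) simp
        finally show ?thesis .
      qed simp
      then have "(SUP K\<in>{K. K \<subseteq> N \<inter> {a<..b} \<and> compact K}. emeasure \<mu> K) \<le> ennreal e"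
        by (intro SUP_least) auto
      then show "emeasure \<mu> (N \<inter> {a<..b}) \<le> 0 + ennreal e"
        using inner_regular[of \<mu> "N \<inter> {a<..b}"] M fm.emeasure_finite[of UNIV] by simp
    qed
    ultimately show ?thesis using outside by simp
  qed
  have "absolutely_continuous lborel \<mu>"
    unfolding absolutely_continuous_def null_sets_def using null by auto
  then obtain h where h[measurable]: "h \<in> borel_measurable lborel" and hd: "density lborel h = \<mu>"
    using sigma_finite_measure.Radon_Nikodym[OF lborel.sigma_finite_measure_axioms, of \<mu>] by auto
  define g where "g t = enn2real (h t)" for t
  have [measurable]: "g \<in> borel_measurable borel" unfolding g_def by measurable
  have hfin: "(\<integral>\<^sup>+t. h t \<partial>lborel) < \<infinity>"
  proof -
    have "(\<integral>\<^sup>+t. h t \<partial>lborel) = emeasure \<mu> UNIV" unfolding hd[symmetric] by (subst emeasure_density) auto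
    then show ?thesis using fm.emeasure_finite[of UNIV] by (simp add: less_top[symmetric])
  qed
  then have "AE t in lborel. h t \<noteq> \<infinity>" by (intro nn_integral_noteq_infinite) auto
  then have gh: "AE t in lborel. ennreal (g t) = h t"
    by eventually_elim (simp add: g_def less_top)
  have ig: "integrable lborel g"
    using hfin nn_integral_cong_AE[OF gh] by (intro integrableI_nonneg) (auto simp: g_def)
  show thesis
  proof (rule that[OF ig])
    fix x y :: real assume xy: "x \<le> y"
    have "ennreal (F y - F x) = (\<integral>\<^sup>+t. h t * indicator {x<..y} t \<partial>lborel)"
      using Ioc[OF xy] unfolding hd[symmetric] by (subst (asm) emeasure_density) auto
    also have "\<dots> = (\<integral>\<^sup>+t. ennreal (indicator {x..y} t *\<^sub>R g t) \<partial>lborel)"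
      using AE_lborel_singleton[of x] gh
      by (intro nn_integral_cong_AE, eventually_elim) (auto simp: indicator_def)
    also have "\<dots> = ennreal (LINT t:{x..y}|lborel. g t)"
      unfolding set_lebesgue_integral_def
      using integrable_mult_indicator[OF _ ig, of "{x..y}"] by (intro nn_integral_eq_integral) (auto simp: g_def)
    finally show "F y - F x = (LINT t:{x..y}|lborel. g t)"
      using monoF[OF xy] by (subst (asm) ennreal_inj) (auto simp: g_def set_lebesgue_integral_def intro!: integral_nonneg_AE)
  qed
qed

text \<open>Averages over intervals to the right of \<open>x\<close> are \<open>integrable_ccontinuous_explicit\<close>; its application to the reflected function covers averages to the left.\<close>

lemma Lebesgue_differentiation:
  fixes g :: "real \<Rightarrow> complex"
  assumes g: "integrable lborel g"
  shows "AE x in lborel. ((\<lambda>y. LINT t:{..y}|lborel. g t) has_vector_derivative g x) (at x)"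
proof -
  define G where "G y = (LINT t:{..y}|lborel. g t)" for y
  have si: "set_integrable lborel A g" if "A \<in> sets borel" for A
    unfolding set_integrable_def using that by (intro integrable_mult_indicator g) auto
  have Gd: "G y - G x = integral {x..y} g" "g integrable_on {x..y}" if "x \<le> y" for x y
  proof -
    have "G y = (LINT t:{..x} \<union> {x<..y}|lborel. g t)"
      unfolding G_def using that by (simp add: ivl_disj_un)
    also have "\<dots> = G x + (LINT t:{x<..y}|lborel. g t)"
      unfolding G_def by (intro set_integral_Un si) auto
    also have "(LINT t:{x<..y}|lborel. g t) = (LINT t:{x..y}|lborel. g t)"
      unfolding set_lebesgue_integral_def using AE_lborel_singleton[of x] g
      by (intro integral_cong_AE) (auto simp: indicator_def)
    also have "\<dots> = integral {x..y} g" by (intro set_borel_integral_eq_integral si) auto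
    finally show "G y - G x = integral {x..y} g" by simp
    show "g integrable_on {x..y}" by (intro set_borel_integral_eq_integral si) auto
  qed
  have "g integrable_on cbox x y" for x y :: real using Gd(2)[of x y] by (cases "x \<le> y") auto
  then obtain N1 where N1: "negligible N1" "\<And>x e. x \<notin> N1 \<Longrightarrow> 0 < e \<Longrightarrow>
      \<exists>d>0. \<forall>h. 0 < h \<and> h < d \<longrightarrow> norm (integral (cbox x (x + h *\<^sub>R One)) g /\<^sub>R h ^ DIM(real) - g x) < e"
    using integrable_ccontinuous_explicit[of g] by blast
  have gr: "(\<lambda>t. g (- t)) integrable_on cbox x y" for x y :: real
    using Gd(2)[of "-y" "-x"] Henstock_Kurzweil_Integration.integrable_reflect_real[where f=g and a="-y" and b="-x"] by (cases "x \<le> y") auto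
  then obtain N2 where N2: "negligible N2" "\<And>x e. x \<notin> N2 \<Longrightarrow> 0 < e \<Longrightarrow>
      \<exists>d>0. \<forall>h. 0 < h \<and> h < d \<longrightarrow> norm (integral (cbox x (x + h *\<^sub>R One)) (\<lambda>t. g (- t)) /\<^sub>R h ^ DIM(real) - g (- x)) < e"
    using integrable_ccontinuous_explicit[of "\<lambda>t. g (- t)"] by blast
  have "(G has_vector_derivative g x) (at x)" if x: "x \<notin> N1 \<union> uminus ` N2" for x
  proof -
    have "((\<lambda>y. (G y - G x) /\<^sub>R (y - x)) \<longlongrightarrow> g x) (at x)"
    proof (rule tendstoI)
      fix e :: real assume e: "0 < e"
      have "x \<notin> N1" "- x \<notin> N2" using x by (force simp: image_iff)+
      then obtain d1 d2 where d: "0 < d1" "0 < d2"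
        "\<And>h. 0 < h \<and> h < d1 \<Longrightarrow> norm (integral (cbox x (x + h *\<^sub>R One)) g /\<^sub>R h ^ DIM(real) - g x) < e"
        "\<And>h. 0 < h \<and> h < d2 \<Longrightarrow> norm (integral (cbox (-x) (-x + h *\<^sub>R One)) (\<lambda>t. g (- t)) /\<^sub>R h ^ DIM(real) - g (- (- x))) < e"
        using N1(2)[of x e] N2(2)[of "-x" e] e by metis
      have "dist ((G y - G x) /\<^sub>R (y - x)) (g x) < e" if y: "y \<noteq> x" "dist y x < min d1 d2" for y
      proof (cases "x < y")
        case True
        then show ?thesis using d(3)[of "y - x"] y Gd(1)[of x y] by (simp add: dist_norm)
      next
        case False
        then have "y < x" using y by simp
        have "integral {-x..-y} (\<lambda>t. g (- t)) = integral {y..x} g"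
          using Henstock_Kurzweil_Integration.integral_reflect_real[where f=g and a=y and b=x] by simp
        then have "norm ((G x - G y) /\<^sub>R (x - y) - g x) < e"
          using d(4)[of "x - y"] y \<open>y < x\<close> Gd(1)[of y x] by (simp add: dist_norm)
        also have "(G x - G y) /\<^sub>R (x - y) = (G y - G x) /\<^sub>R (y - x)"
          by (metis (no_types, lifting) inverse_minus_eq minus_diff_eq scaleR_minus_left scaleR_minus_right)
        finally show ?thesis by (simp add: dist_norm)
      qed
      then show "eventually (\<lambda>y. dist ((G y - G x) /\<^sub>R (y - x)) (g x) < e) (at x)"
        unfolding eventually_at using d(1,2) by (intro exI[of _ "min d1 d2"]) auto
    qed
    then have "((\<lambda>y. norm ((G y - G x) /\<^sub>R (y - x) - g x)) \<longlongrightarrow> 0) (at x)"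
      by (intro tendsto_norm_zero) (rule LIM_zero)
    moreover
    have "norm ((G y - G x) /\<^sub>R (y - x) - g x) = norm (G y - G x - (y - x) *\<^sub>R g x) / norm (y - x)"
      if "y \<noteq> x" for y
    proof -
      have "(G y - G x) /\<^sub>R (y - x) - g x = (G y - G x - (y - x) *\<^sub>R g x) /\<^sub>R (y - x)"
        using that by (simp add: scaleR_diff_right)
      then show ?thesis by (simp add: divide_inverse mult.commute)
    qed
    then have "eventually (\<lambda>y. norm ((G y - G x) /\<^sub>R (y - x) - g x) = norm (G y - G x - (y - x) *\<^sub>R g x) / norm (y - x)) (at x)"
      by (simp add: eventually_at_filter)
    ultimately have "((\<lambda>y. norm (G y - G x - (y - x) *\<^sub>R g x) / norm (y - x)) \<longlongrightarrow> 0) (at x)"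
      by (rule Lim_transform_eventually)
    then show ?thesis unfolding has_vector_derivative_def has_derivative_iff_norm
      by (simp add: bounded_linear_scaleR_left)
  qed
  moreover have "AE x in lebesgue. x \<notin> N1 \<union> uminus ` N2"
  proof (rule AE_I'[of "N1 \<union> uminus ` N2"])
    have "negligible (uminus ` N2)"
      by (rule negligible_differentiable_image_negligible[OF _ N2(1)])
         (auto intro!: linear_imp_differentiable_on linear_uminus)
    then show "N1 \<union> uminus ` N2 \<in> null_sets lebesgue"
      using N1(1) by (simp add: negligible_iff_null_sets[symmetric] negligible_Un)
  qed auto
  ultimately have "AE x in lebesgue. (G has_vector_derivative g x) (at x)" by auto
  then show ?thesis unfolding G_def by (simp add: AE_completion_iff)
qed

text \<open>The variation \<open>V\<close> and the functions \<open>V - Re f\<close> and \<open>V - Im f\<close> are monotone with increments at most twice those of \<open>V\<close>, so that each of them has a density.\<close>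

lemma abs_continuous_density:
  assumes ab: "a < b" and ac: "abs_continuous_on {a..b} f"
  obtains g where "integrable lborel g" "\<And>x y. a \<le> x \<Longrightarrow> x \<le> y \<Longrightarrow> y \<le> b \<Longrightarrow> f y - f x = (LINT t:{x..y}|lborel. g t)"
proof -
  define cl where "cl x = max a (min b x)" for x
  have cl: "a \<le> cl x" "cl x \<le> b" "a \<le> x \<Longrightarrow> x \<le> b \<Longrightarrow> cl x = x" for x
    using ab by (auto simp: cl_def)
  have clm: "cl x \<le> cl y" "cl y - cl x \<le> y - x" if "x \<le> y" for x y
    using that by (auto simp: cl_def max_def min_def)
  note var_add = variation_add[OF ac]
  have ex: "\<exists>g. integrable lborel g \<and> (\<forall>x y. a \<le> x \<longrightarrow> x \<le> y \<longrightarrow> y \<le> b \<longrightarrow> F y - F x = (LINT t:{x..y}|lborel. g t))"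
    if F: "\<And>x y. a \<le> x \<Longrightarrow> x \<le> y \<Longrightarrow> y \<le> b \<Longrightarrow> 0 \<le> F y - F x \<and> F y - F x \<le> 2 * variation f x y" for F :: "real \<Rightarrow> real"
  proof -
    define H where "H x = F (cl x)" for x
    have H: "0 \<le> H y - H x" "H y - H x \<le> 2 * variation f (cl x) (cl y)" if "x \<le> y" for x y
      using F[OF cl(1) clm(1)[OF that] cl(2)] by (simp_all add: H_def)
    have "mono H" using H(1) by (auto simp: mono_def)
    moreover have "continuous_on UNIV H"
      unfolding continuous_on_iff
    proof (intro ballI allI impI)
      fix x e :: real assume e: "0 < e"
      then obtain d where d: "0 < d" "\<And>D. D \<in> packing a b \<Longrightarrow> (\<Sum>(u, v)\<in>D. v - u) < d \<Longrightarrow> (\<Sum>(u, v)\<in>D. variation f u v) < e / 2"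
        using variation_abs_continuous[OF ac, of "e / 2"] by auto
      have small: "H v - H u < e" if "u \<le> v" "v - u < d" for u v
      proof (cases "cl u < cl v")
        case True
        have "(\<Sum>(u, v)\<in>{(cl u, cl v)}. variation f u v) < e / 2"
          using clm(2)[OF that(1)] that True by (intro d(2) packing_single cl) auto
        then show ?thesis using H(2)[OF that(1)] by simp
      next
        case False
        then have "cl v = cl u" using clm(1)[OF that(1)] by simp
        then show ?thesis using e by (simp add: H_def)
      qed
      show "\<exists>d>0. \<forall>x'\<in>UNIV. dist x' x < d \<longrightarrow> dist (H x') (H x) < e"
      proof (intro exI[of _ d] conjI ballI impI d(1))
        fix x' assume x': "dist x' x < d"
        show "dist (H x') (H x) < e"
          using small[of x x'] small[of x' x] H(1)[of x x'] H(1)[of x' x] x'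
          by (cases "x \<le> x'") (auto simp: dist_real_def abs_if split: if_splits)
      qed
    qed
    moreover have "H x = H a" if "x \<le> a" for x using that ab by (simp add: H_def cl_def)
    moreover have "H x = H b" if "b \<le> x" for x using that ab by (simp add: H_def cl_def)
    moreover have "\<exists>\<delta>>0. \<forall>D\<in>packing a b. (\<Sum>(u, v)\<in>D. v - u) < \<delta> \<longrightarrow> (\<Sum>(u, v)\<in>D. H v - H u) < \<epsilon>" if \<epsilon>: "0 < \<epsilon>" for \<epsilon>
    proof -
      obtain d where d: "0 < d" "\<And>D. D \<in> packing a b \<Longrightarrow> (\<Sum>(u, v)\<in>D. v - u) < d \<Longrightarrow> (\<Sum>(u, v)\<in>D. variation f u v) < \<epsilon> / 2"
        using variation_abs_continuous[OF ac, of "\<epsilon> / 2"] \<epsilon> by auto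
      show ?thesis
      proof (intro exI[of _ d] conjI ballI impI d(1))
        fix D assume D: "D \<in> packing a b" "(\<Sum>(u, v)\<in>D. v - u) < d"
        have "(\<Sum>(u, v)\<in>D. H v - H u) \<le> (\<Sum>(u, v)\<in>D. 2 * variation f u v)"
        proof (rule sum_mono, clarify)
          fix u v assume "(u, v) \<in> D"
          from packingD[OF D(1) this] show "H v - H u \<le> 2 * variation f u v" using H(2)[of u v] by (simp add: cl(3))
        qed
        also have "\<dots> = 2 * (\<Sum>(u, v)\<in>D. variation f u v)" by (simp add: sum_distrib_left case_prod_beta)
        also have "\<dots> < \<epsilon>" using d(2)[OF D] by simp
        finally show "(\<Sum>(u, v)\<in>D. H v - H u) < \<epsilon>" .
      qed
    qed
    ultimately obtain g where g: "integrable lborel g" "\<And>x y. x \<le> y \<Longrightarrow> H y - H x = (LINT t:{x..y}|lborel. g t)"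
      using mono_abs_continuous_density[OF ab] by blast
    have "F y - F x = (LINT t:{x..y}|lborel. g t)" if "a \<le> x" "x \<le> y" "y \<le> b" for x y
      using g(2)[of x y] cl(3)[of x] cl(3)[of y] that by (simp add: H_def)
    then show ?thesis using g(1) by blast
  qed
  define V where "V x = variation f a x" for x
  have V: "V y - V x = variation f x y" if "a \<le> x" "x \<le> y" "y \<le> b" for x y
    using var_add[of a x y] that by (simp add: V_def)
  have nv: "norm (f y - f x) \<le> variation f x y" if "a \<le> x" "x \<le> y" "y \<le> b" for x y
    using norm_le_variation[OF ac that] .
  obtain g1 where g1: "integrable lborel g1" "\<And>x y. a \<le> x \<Longrightarrow> x \<le> y \<Longrightarrow> y \<le> b \<Longrightarrow> V y - V x = (LINT t:{x..y}|lborel. g1 t)"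
    using ex[of V] V nv norm_ge_zero order.trans[OF norm_ge_zero nv] by fastforce
  have re: "0 \<le> (V y - Re (f y)) - (V x - Re (f x)) \<and> (V y - Re (f y)) - (V x - Re (f x)) \<le> 2 * variation f x y"
    and im: "0 \<le> (V y - Im (f y)) - (V x - Im (f x)) \<and> (V y - Im (f y)) - (V x - Im (f x)) \<le> 2 * variation f x y"
    if "a \<le> x" "x \<le> y" "y \<le> b" for x y
    using V[OF that] nv[OF that] abs_Re_le_cmod[of "f y - f x"] abs_Im_le_cmod[of "f y - f x"]
    unfolding minus_complex.simps by linarith+
  obtain g2 where g2: "integrable lborel g2" "\<And>x y. a \<le> x \<Longrightarrow> x \<le> y \<Longrightarrow> y \<le> b \<Longrightarrow> (V y - Re (f y)) - (V x - Re (f x)) = (LINT t:{x..y}|lborel. g2 t)"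
    using ex[of "\<lambda>x. V x - Re (f x)", OF re] by blast
  obtain g3 where g3: "integrable lborel g3" "\<And>x y. a \<le> x \<Longrightarrow> x \<le> y \<Longrightarrow> y \<le> b \<Longrightarrow> (V y - Im (f y)) - (V x - Im (f x)) = (LINT t:{x..y}|lborel. g3 t)"
    using ex[of "\<lambda>x. V x - Im (f x)", OF im] by blast
  define g where "g t = Complex (g1 t - g2 t) (g1 t - g3 t)" for t
  have ge: "g = (\<lambda>t. complex_of_real (g1 t - g2 t) + \<i> * complex_of_real (g1 t - g3 t))"
    by (auto simp: g_def fun_eq_iff complex_eq_iff)
  have ig: "integrable lborel g"
    unfolding ge using g1 g2 g3 by (intro Bochner_Integration.integrable_add integrable_mult_right integrable_of_real Bochner_Integration.integrable_diff)
  show thesis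
  proof (rule that[OF ig])
    fix x y assume xy: "a \<le> x" "x \<le> y" "y \<le> b"
    have si: "set_integrable lborel {x..y} h" if "integrable lborel h" for h :: "real \<Rightarrow> real"
      unfolding set_integrable_def using that by (intro integrable_mult_indicator) auto
    have sg: "integrable lborel (\<lambda>t. indicator {x..y} t *\<^sub>R g t)" using ig by (intro integrable_mult_indicator) auto
    have "Re (LINT t:{x..y}|lborel. g t) = (LINT t:{x..y}|lborel. g1 t - g2 t)"
      unfolding set_lebesgue_integral_def using sg by (simp add: integral_Re[symmetric] g_def)
    also have "\<dots> = Re (f y - f x)"
      using g1(2)[OF xy] g2(2)[OF xy] by (subst set_integral_diff[OF si[OF g1(1)] si[OF g2(1)]]) simp
    finally have R: "Re (f y - f x) = Re (LINT t:{x..y}|lborel. g t)" by simp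
    have "Im (LINT t:{x..y}|lborel. g t) = (LINT t:{x..y}|lborel. g1 t - g3 t)"
      unfolding set_lebesgue_integral_def using sg by (simp add: integral_Im[symmetric] g_def)
    also have "\<dots> = Im (f y - f x)"
      using g1(2)[OF xy] g3(2)[OF xy] by (subst set_integral_diff[OF si[OF g1(1)] si[OF g3(1)]]) simp
    finally show "f y - f x = (LINT t:{x..y}|lborel. g t)" using R by (simp add: complex_eq_iff)
  qed
qed

text \<open>The density of \<open>f\<close> agrees almost everywhere with its derivative by Lebesgue's differentiation theorem. The statement is about a Borel function \<open>G\<close> because \<open>vector_derivative\<close> has arbitrary values where no derivative exists.\<close>

theorem abs_continuous_FTC:
  assumes ac: "\<And>a b. abs_continuous_on {a..b} f"
    and G: "AE x in lborel. G x = vector_derivative f (at x)" and [measurable]: "G \<in> borel_measurable borel"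
    and xy: "x \<le> y"
  shows "set_integrable lborel {x..y} G" "f y - f x = (LINT t:{x..y}|lborel. G t)"
proof -
  define a b where "a = x - 1" and "b = y + 1"
  have ab: "a < b" "a < x" "y < b" using xy by (auto simp: a_def b_def)
  obtain g where g: "integrable lborel g" "\<And>x y. a \<le> x \<Longrightarrow> x \<le> y \<Longrightarrow> y \<le> b \<Longrightarrow> f y - f x = (LINT t:{x..y}|lborel. g t)"
    using abs_continuous_density[OF ab(1) ac] by blast
  have [measurable]: "g \<in> borel_measurable borel" using borel_measurable_integrable[OF g(1)] by simp
  have "AE t in lborel. t \<in> {x..y} \<longrightarrow> G t = g t"
    using Lebesgue_differentiation[OF g(1)] G
  proof eventually_elim
    case (elim t)
    show ?case
    proof
      assume t: "t \<in> {x..y}"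
      have si: "set_integrable lborel A g" if "A \<in> sets borel" for A
        unfolding set_integrable_def using that by (intro integrable_mult_indicator g) auto
      have fG: "f u = (LINT t:{..u}|lborel. g t) + (f a - (LINT t:{..a}|lborel. g t))" if u: "u \<in> {a<..<b}" for u
      proof -
        have "(LINT t:{..u}|lborel. g t) = (LINT t:{..a} \<union> {a<..u}|lborel. g t)"
          using u by (simp add: ivl_disj_un)
        also have "\<dots> = (LINT t:{..a}|lborel. g t) + (LINT t:{a<..u}|lborel. g t)"
          by (intro set_integral_Un si) auto
        also have "(LINT t:{a<..u}|lborel. g t) = (LINT t:{a..u}|lborel. g t)"
          unfolding set_lebesgue_integral_def using AE_lborel_singleton[of a]
          by (intro integral_cong_AE) (auto simp: indicator_def)
        finally show ?thesis using g(2)[of a u] u by (simp add: diff_eq_eq)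
      qed
      have "((\<lambda>u. (LINT t:{..u}|lborel. g t) + (f a - (LINT t:{..a}|lborel. g t))) has_vector_derivative g t) (at t)"
        using has_vector_derivative_add[OF elim(1) has_vector_derivative_const] by simp
      then have "(f has_vector_derivative g t) (at t)"
        by (rule has_vector_derivative_transform_within_open[where S="{a<..<b}"]) (use t ab fG in auto)
      then show "G t = g t" using elim(2) by (simp add: vector_derivative_at)
    qed
  qed
  then have AE: "AE t in lborel. indicator {x..y} t *\<^sub>R G t = indicator {x..y} t *\<^sub>R g t"
    by eventually_elim (auto simp: indicator_def)
  have i: "integrable lborel (\<lambda>t. indicator {x..y} t *\<^sub>R g t)" by (intro integrable_mult_indicator g) auto
  show "set_integrable lborel {x..y} G"
    unfolding set_integrable_def using integrable_cong_AE[OF _ _ AE] i by simp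
  show "f y - f x = (LINT t:{x..y}|lborel. G t)"
    using g(2)[of x y] ab xy integral_cong_AE[OF _ _ AE] by (simp add: set_lebesgue_integral_def)
qed

section \<open>The Jackson kernel and its entire extension\<close>

definition csinc :: "complex \<Rightarrow> complex" where
  "csinc z = (if z = 0 then 1 else sin z / z)"

definition jackson_mass :: real where
  "jackson_mass = (LINT t|lborel. (Re (csinc (complex_of_real t / 2))) ^ 4)"

text \<open>The fourth power serves two purposes: the kernel is nonnegative, and its tails, which occur as kernels themselves, still decay quadratically.\<close>

definition jackson :: "real \<Rightarrow> real" where
  "jackson t = (Re (csinc (complex_of_real t / 2))) ^ 4 / jackson_mass"

definition cjackson :: "complex \<Rightarrow> complex" where
  "cjackson z = csinc (z / 2) ^ 4 / complex_of_real jackson_mass"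

abbreviation cjackson_at :: "real \<Rightarrow> real \<Rightarrow> complex \<Rightarrow> complex" where
  "cjackson_at \<delta> y z \<equiv> cjackson ((complex_of_real y - z) / complex_of_real \<delta>)"

abbreviation cjackson_deriv_at :: "real \<Rightarrow> real \<Rightarrow> complex \<Rightarrow> complex" where
  "cjackson_deriv_at \<delta> y z \<equiv> deriv cjackson ((complex_of_real y - z) / complex_of_real \<delta>)"

abbreviation cjackson_growth :: "real \<Rightarrow> real \<Rightarrow> complex \<Rightarrow> real" where
  "cjackson_growth B \<delta> z \<equiv> B * exp (2 / \<delta> * norm z) * (1 + 2 * (norm z)\<^sup>2 + 2 * \<delta>\<^sup>2)"

text \<open>The convolution \<open>A g\<close> in the form in which the argument appears only in the kernel, so that it may be complex. On the real line it agrees with \<open>cconv\<close> (\<open>jext_of_real\<close>).\<close>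

definition jext :: "real \<Rightarrow> (real \<Rightarrow> complex) \<Rightarrow> complex \<Rightarrow> complex" where
  "jext \<delta> g z = (LINT y|lborel. cjackson_at \<delta> y z * (g y / complex_of_real \<delta>))"

lemma csinc_holomorphic: "csinc holomorphic_on UNIV"
proof -
  have "deriv sin (0::complex) = 1" using DERIV_imp_deriv[OF DERIV_sin, of "0::complex"] by simp
  show ?thesis
  proof (rule pole_theorem_0[where g=sin and a=0])
    show "csinc 0 = deriv sin 0" by (simp add: csinc_def \<open>deriv sin 0 = 1\<close>)
  qed (auto simp: csinc_def intro: holomorphic_on_sin)
qed

lemma csinc_of_real: "csinc (complex_of_real t) = complex_of_real (if t = 0 then 1 else sin t / t)"
  by (simp add: csinc_def sin_of_real[symmetric])

lemma norm_sin_le: "norm (sin z) \<le> exp \<bar>Im z\<bar>" for z :: complex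
proof -
  have "norm (sin z) = norm (exp (\<i> * z) - exp (- (\<i> * z))) / 2"
    by (simp add: sin_exp_eq norm_divide norm_mult)
  also have "\<dots> \<le> (norm (exp (\<i> * z)) + norm (exp (- (\<i> * z)))) / 2"
    by (intro divide_right_mono norm_triangle_ineq4) auto
  also have "\<dots> = (exp (- Im z) + exp (Im z)) / 2" by simp
  also have "\<dots> \<le> (exp \<bar>Im z\<bar> + exp \<bar>Im z\<bar>) / 2" by (intro divide_right_mono add_mono) auto
  finally show ?thesis by simp
qed

text \<open>For large arguments this is \<open>norm_sin_le\<close>; on the unit disc the function is bounded by compactness.\<close>

lemma csinc_bound: obtains B where "0 < B" "\<And>z. norm (csinc z) \<le> B * exp \<bar>Im z\<bar> / (1 + norm z)"
proof -
  have "continuous_on (cball 0 1) csinc"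
    using csinc_holomorphic holomorphic_on_imp_continuous_on continuous_on_subset by blast
  then have "bounded (csinc ` cball 0 1)"
    by (intro compact_imp_bounded compact_continuous_image) auto
  then obtain B where B: "0 < B" "\<And>z. norm z \<le> 1 \<Longrightarrow> norm (csinc z) \<le> B"
    unfolding bounded_pos by auto
  have "norm (csinc z) \<le> (2 * B + 2) * exp \<bar>Im z\<bar> / (1 + norm z)" for z
  proof (cases "norm z \<le> 1")
    case True
    have "norm (csinc z) * (1 + norm z) \<le> B * 2" using B(1) B(2)[OF True] True by (intro mult_mono) auto
    also have "\<dots> \<le> (2 * B + 2) * exp \<bar>Im z\<bar>"
      using B(1) mult_mono[of "B * 2" "2 * B + 2" 1 "exp \<bar>Im z\<bar>"] by simp
    finally show ?thesis by (simp add: pos_le_divide_eq add_pos_nonneg)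
  next
    case False
    then have z: "z \<noteq> 0" "1 < norm z" by auto
    have "norm (csinc z) * (1 + norm z) = norm (sin z) * ((1 + norm z) / norm z)"
      using z by (simp add: csinc_def norm_divide)
    also have "\<dots> \<le> exp \<bar>Im z\<bar> * 2"
      using z by (intro mult_mono norm_sin_le) (auto simp: divide_le_eq)
    also have "\<dots> \<le> (2 * B + 2) * exp \<bar>Im z\<bar>" using B(1) by (simp add: algebra_simps)
    finally show ?thesis by (simp add: pos_le_divide_eq add_pos_nonneg)
  qed
  then show thesis using B(1) by (intro that[of "2 * B + 2"]) auto
qed

lemma csinc4_bound: obtains B where "0 < B" "\<And>z. norm (csinc (z / 2) ^ 4) \<le> B * exp (2 * \<bar>Im z\<bar>) / (1 + norm z) ^ 4"
proof -
  obtain B where B: "0 < B" "\<And>z. norm (csinc z) \<le> B * exp \<bar>Im z\<bar> / (1 + norm z)" by (rule csinc_bound) (rule that)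
  have "norm (csinc (z / 2) ^ 4) \<le> (2 * B) ^ 4 * exp (2 * \<bar>Im z\<bar>) / (1 + norm z) ^ 4" for z
  proof -
    have "norm (csinc (z / 2)) \<le> B * exp \<bar>Im (z / 2)\<bar> / (1 + norm (z / 2))" by (rule B(2))
    also have "\<dots> \<le> B * exp \<bar>Im (z / 2)\<bar> / ((1 + norm z) / 2)"
      using B(1) by (intro divide_left_mono) (auto simp: norm_divide intro!: mult_pos_pos add_pos_nonneg)
    also have "\<dots> = 2 * B * exp (\<bar>Im z\<bar> / 2) / (1 + norm z)" by (simp add: field_simps)
    finally have "norm (csinc (z / 2)) ^ 4 \<le> (2 * B * exp (\<bar>Im z\<bar> / 2) / (1 + norm z)) ^ 4"
      by (intro power_mono) auto
    also have "(2 * B * exp (\<bar>Im z\<bar> / 2) / (1 + norm z)) ^ 4 = (2 * B) ^ 4 * exp (2 * \<bar>Im z\<bar>) / (1 + norm z) ^ 4"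
    proof -
      have "exp (\<bar>Im z\<bar> / 2) ^ 4 = exp (2 * \<bar>Im z\<bar>)" by (simp add: exp_of_nat_mult[symmetric])
      then show ?thesis by (simp add: power_divide power_mult_distrib)
    qed
    finally show ?thesis by (simp add: norm_power)
  qed
  then show thesis using B(1) by (intro that[of "(2 * B) ^ 4"]) auto
qed

lemma one_plus_square_le: "1 + (x::real)\<^sup>2 \<le> (1 + \<bar>x\<bar>)\<^sup>2"
  by (simp add: power2_sum)

lemma csinc4_real: "csinc (complex_of_real t / 2) ^ 4 = complex_of_real ((Re (csinc (complex_of_real t / 2))) ^ 4)"
proof -
  have "complex_of_real t / 2 = complex_of_real (t / 2)" by simp
  then show ?thesis by (simp only: csinc_of_real Re_complex_of_real of_real_power)
qed

lemma measurable_csinc_real [measurable]: "(\<lambda>t. Re (csinc (complex_of_real t / 2))) \<in> borel_measurable borel"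
proof -
  have "continuous_on UNIV (\<lambda>t::real. csinc (complex_of_real t / 2))"
    by (rule continuous_on_compose2[OF holomorphic_on_imp_continuous_on[OF csinc_holomorphic]])
       (auto intro!: continuous_intros)
  then show ?thesis by (intro borel_measurable_continuous_onI continuous_on_Re)
qed

lemma csinc4_kernel: "cauchy_kernel (\<lambda>t. (Re (csinc (complex_of_real t / 2))) ^ 4)"
proof -
  obtain B where B: "0 < B" "\<And>z. norm (csinc (z / 2) ^ 4) \<le> B * exp (2 * \<bar>Im z\<bar>) / (1 + norm z) ^ 4"
    by (rule csinc4_bound) (rule that)
  have "\<bar>(Re (csinc (complex_of_real t / 2))) ^ 4\<bar> \<le> B / (1 + t\<^sup>2)" for t
  proof -
    have "\<bar>(Re (csinc (complex_of_real t / 2))) ^ 4\<bar> = norm (csinc (complex_of_real t / 2) ^ 4)"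
      by (subst csinc4_real) (simp only: norm_of_real)
    also have "\<dots> \<le> B / (1 + \<bar>t\<bar>) ^ 4" using B(2)[of "complex_of_real t"] by simp
    also have "\<dots> \<le> B / (1 + t\<^sup>2)"
    proof (rule divide_left_mono)
      have "(1 + \<bar>t\<bar>) ^ 2 \<le> (1 + \<bar>t\<bar>) ^ 4" by (intro power_increasing) auto
      then show "1 + t\<^sup>2 \<le> (1 + \<bar>t\<bar>) ^ 4" using one_plus_square_le[of t] by linarith
    qed (use B in \<open>auto intro!: mult_pos_pos\<close>)
    finally show ?thesis .
  qed
  then show ?thesis unfolding cauchy_kernel_def by auto
qed

lemma jackson_mass_pos: "0 < jackson_mass"
proof -
  let ?f = "\<lambda>t. (Re (csinc (complex_of_real t / 2))) ^ 4"
  have i: "integrable lborel ?f" by (rule cauchy_kernel_integrable[OF csinc4_kernel])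
  have "jackson_mass \<noteq> 0"
  proof
    assume "jackson_mass = 0"
    then have "AE t in lborel. ?f t = 0"
      unfolding jackson_mass_def using integral_nonneg_eq_0_iff_AE[OF i] by simp
    then have "AE t in lborel. t \<notin> {0<..<1::real}"
    proof eventually_elim
      case (elim t)
      have e: "complex_of_real t / 2 = complex_of_real (t / 2)" by simp
      have "sin (t / 2) > 0" if "t \<in> {0<..<1}" using that pi_gt3 by (intro sin_gt_zero) auto
      then show ?case using elim unfolding e csinc_of_real by auto
    qed
    then have "emeasure lborel {0<..<1::real} = 0"
      by (subst (asm) AE_iff_measurable[of "{0<..<1}"]) auto
    moreover have "emeasure lborel {0<..<1::real} = 1" by simp
    ultimately show False by simp
  qed
  moreover have "0 \<le> jackson_mass" unfolding jackson_mass_def by (intro integral_nonneg_AE) auto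
  ultimately show ?thesis by simp
qed

lemma jackson_nonneg: "0 \<le> jackson t"
  using jackson_mass_pos by (simp add: jackson_def)

lemma cauchy_kernel_jackson: "cauchy_kernel jackson"
  using cauchy_kernel_cmult[OF csinc4_kernel, of "1 / jackson_mass"] by (simp add: jackson_def[abs_def])

lemma integral_jackson: "(LINT t|lborel. jackson t) = 1"
  unfolding jackson_def[abs_def] using jackson_mass_pos by (simp add: jackson_mass_def)

lemma cjackson_of_real: "cjackson (complex_of_real t) = complex_of_real (jackson t)"
  by (simp add: cjackson_def jackson_def csinc4_real)

lemma cjackson_holomorphic: "cjackson holomorphic_on UNIV"
proof -
  have "(csinc \<circ> (\<lambda>z. z / 2)) holomorphic_on UNIV"
    by (rule holomorphic_on_compose_gen[OF _ csinc_holomorphic]) (auto intro!: holomorphic_intros)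
  then show ?thesis unfolding cjackson_def[abs_def] o_def using jackson_mass_pos
    by (intro holomorphic_intros) auto
qed

lemma cjackson_bound: obtains B where "0 < B" "\<And>z. norm (cjackson z) \<le> B * exp (2 * \<bar>Im z\<bar>) / (1 + norm z) ^ 4"
proof -
  obtain B where B: "0 < B" "\<And>z. norm (csinc (z / 2) ^ 4) \<le> B * exp (2 * \<bar>Im z\<bar>) / (1 + norm z) ^ 4"
    by (rule csinc4_bound) (rule that)
  have "norm (cjackson z) \<le> (B / jackson_mass) * exp (2 * \<bar>Im z\<bar>) / (1 + norm z) ^ 4" for z
    using divide_right_mono[OF B(2)[of z], of jackson_mass] jackson_mass_pos
    by (simp add: cjackson_def norm_divide norm_power mult_ac)
  then show thesis using B(1) jackson_mass_pos by (intro that[of "B / jackson_mass"]) auto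
qed

lemma jackson_bound: obtains B where "0 < B" "\<And>t. jackson t \<le> B / (1 + \<bar>t\<bar>) ^ 4"
proof -
  obtain B where B: "0 < B" "\<And>z. norm (cjackson z) \<le> B * exp (2 * \<bar>Im z\<bar>) / (1 + norm z) ^ 4"
    by (rule cjackson_bound) (rule that)
  then show thesis using B(2)[of "complex_of_real _"] jackson_nonneg
    by (intro that[of B]) (auto simp: cjackson_of_real)
qed

text \<open>Cauchy's inequality on circles of radius \<open>1\<close> carries the bound of \<open>cjackson\<close> over to its derivative, because the bounding function changes at most by a constant factor on such a circle.\<close>

lemma cjackson_deriv_bound:
  obtains B where "0 < B" "\<And>z. norm (deriv cjackson z) \<le> B * exp (2 * \<bar>Im z\<bar>) / (1 + (norm z)\<^sup>2)"
    "\<And>z. norm (cjackson z) \<le> B * exp (2 * \<bar>Im z\<bar>) / (1 + (norm z)\<^sup>2)"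
proof -
  obtain B where B: "0 < B" "\<And>z. norm (cjackson z) \<le> B * exp (2 * \<bar>Im z\<bar>) / (1 + norm z) ^ 4"
    by (rule cjackson_bound) (rule that)
  have B2: "norm (cjackson z) \<le> B * exp (2 * \<bar>Im z\<bar>) / (1 + (norm z)\<^sup>2)" for z
  proof (rule order.trans[OF B(2)], rule divide_left_mono)
    have "(1 + norm z) ^ 2 \<le> (1 + norm z) ^ 4" by (intro power_increasing) auto
    then show "1 + (norm z)\<^sup>2 \<le> (1 + norm z) ^ 4" using one_plus_square_le[of "norm z"] by simp
  qed (use B in \<open>auto intro!: mult_pos_pos add_pos_nonneg zero_less_power\<close>)
  define B' where "B' = 3 * exp 2 * B"
  have BB: "B \<le> B'"
  proof -
    have "1 * 1 \<le> 3 * exp (2::real)" by (intro mult_mono) auto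
    then show ?thesis using B(1) by (simp add: B'_def)
  qed
  have D: "norm (deriv cjackson z) \<le> B' * exp (2 * \<bar>Im z\<bar>) / (1 + (norm z)\<^sup>2)" for z
  proof -
    have "norm ((deriv ^^ 1) cjackson z) \<le> fact 1 * (B' * exp (2 * \<bar>Im z\<bar>) / (1 + (norm z)\<^sup>2)) / 1 ^ 1"
    proof (rule Cauchy_inequality)
      show "cjackson holomorphic_on ball z 1" "continuous_on (cball z 1) cjackson"
        using cjackson_holomorphic holomorphic_on_imp_continuous_on
        by (meson holomorphic_on_subset subset_UNIV)+
      fix w assume w: "norm (z - w) = 1"
      have "norm z \<le> norm w + 1" using norm_triangle_ineq[of "z - w" w] w by simp
      then have "(norm z)\<^sup>2 \<le> (norm w + 1)\<^sup>2" by (intro power_mono) auto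
      also have "\<dots> \<le> 2 * (norm w)\<^sup>2 + 2"
      proof -
        have "0 \<le> (norm w - 1)\<^sup>2" by simp
        then show ?thesis by (simp add: power2_sum power2_diff)
      qed
      also have "\<dots> \<le> 3 * (norm w)\<^sup>2 + 2" by simp
      finally have zw: "1 + (norm z)\<^sup>2 \<le> 3 * (1 + (norm w)\<^sup>2)" by simp
      have "\<bar>Im w\<bar> \<le> \<bar>Im z\<bar> + 1" using abs_Im_le_cmod[of "z - w"] w by simp
      then have "exp (2 * \<bar>Im w\<bar>) \<le> exp (2 * \<bar>Im z\<bar> + 2)" by simp
      then have ee: "exp (2 * \<bar>Im w\<bar>) \<le> exp 2 * exp (2 * \<bar>Im z\<bar>)" by (simp add: exp_add mult.commute)
      have "norm (cjackson w) \<le> B * exp (2 * \<bar>Im w\<bar>) / (1 + (norm w)\<^sup>2)" by (rule B2)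
      also have "\<dots> \<le> B * (exp 2 * exp (2 * \<bar>Im z\<bar>)) / ((1 + (norm z)\<^sup>2) / 3)"
        using B zw ee by (intro frac_le mult_left_mono) (auto simp: add_pos_nonneg)
      also have "\<dots> = B' * exp (2 * \<bar>Im z\<bar>) / (1 + (norm z)\<^sup>2)" by (simp add: B'_def field_simps)
      finally show "norm (cjackson w) \<le> B' * exp (2 * \<bar>Im z\<bar>) / (1 + (norm z)\<^sup>2)" .
    qed simp
    then show ?thesis by simp
  qed
  have "norm (cjackson z) \<le> B' * exp (2 * \<bar>Im z\<bar>) / (1 + (norm z)\<^sup>2)" for z
    using B2[of z] BB by (auto intro!: order.trans[OF B2[of z]] divide_right_mono)
  then show thesis using D BB B(1) by (intro that[of B']) auto
qed

text \<open>The bound separates the variables: it is the integrable weight in \<open>y\<close> times a factor that is locally bounded in \<open>w\<close> and of exponential type \<open>2 / \<delta>\<close>. The first property gives holomorphy of \<open>jext\<close>, the second its type.\<close>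

lemma jext_integrand_bound:
  assumes \<delta>: "0 < \<delta>"
  obtains B where "0 < B"
    "\<And>y w. norm (cjackson_at \<delta> y w) \<le> cjackson_growth B \<delta> w / (1 + y\<^sup>2)"
    "\<And>y w. norm (cjackson_deriv_at \<delta> y w) \<le> cjackson_growth B \<delta> w / (1 + y\<^sup>2)"
proof -
  obtain B where B: "0 < B" "\<And>z. norm (deriv cjackson z) \<le> B * exp (2 * \<bar>Im z\<bar>) / (1 + (norm z)\<^sup>2)"
    "\<And>z. norm (cjackson z) \<le> B * exp (2 * \<bar>Im z\<bar>) / (1 + (norm z)\<^sup>2)"
    by (rule cjackson_deriv_bound) (rule that)
  have *: "B * exp (2 * \<bar>Im ((complex_of_real y - w) / complex_of_real \<delta>)\<bar>) / (1 + (norm ((complex_of_real y - w) / complex_of_real \<delta>))\<^sup>2)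
     \<le> cjackson_growth B \<delta> w / (1 + y\<^sup>2)" for y w
  proof -
    define u where "u = (complex_of_real y - w) / complex_of_real \<delta>"
    have "\<bar>Im u\<bar> = \<bar>Im w\<bar> / \<delta>" using \<delta> by (simp add: u_def)
    also have "\<dots> \<le> norm w / \<delta>" using \<delta> by (intro divide_right_mono abs_Im_le_cmod) auto
    finally have e: "exp (2 * \<bar>Im u\<bar>) \<le> exp (2 / \<delta> * norm w)" by simp
    have "complex_of_real y = w + complex_of_real \<delta> * u" using \<delta> by (simp add: u_def)
    then have "\<bar>y\<bar> \<le> norm w + \<delta> * norm u"
      using norm_triangle_ineq[of w "complex_of_real \<delta> * u"] \<delta> by (metis abs_of_pos norm_mult norm_of_real)
    then have "\<bar>y\<bar>\<^sup>2 \<le> (norm w + \<delta> * norm u)\<^sup>2" by (intro power_mono) auto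
    moreover have "0 \<le> (norm w - \<delta> * norm u)\<^sup>2" by simp
    ultimately have "1 + y\<^sup>2 \<le> 1 + 2 * (norm w)\<^sup>2 + 2 * (\<delta>\<^sup>2 * (norm u)\<^sup>2)"
      by (simp add: power2_sum power2_diff power_mult_distrib)
    also have "\<dots> \<le> (1 + 2 * (norm w)\<^sup>2 + 2 * \<delta>\<^sup>2) * (1 + (norm u)\<^sup>2)"
      by (simp add: algebra_simps)
    finally have "1 / (1 + (norm u)\<^sup>2) \<le> (1 + 2 * (norm w)\<^sup>2 + 2 * \<delta>\<^sup>2) / (1 + y\<^sup>2)"
      by (simp add: field_simps)
    then have "(B * exp (2 * \<bar>Im u\<bar>)) * (1 / (1 + (norm u)\<^sup>2)) \<le>
      (B * exp (2 / \<delta> * norm w)) * ((1 + 2 * (norm w)\<^sup>2 + 2 * \<delta>\<^sup>2) / (1 + y\<^sup>2))"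
      using B(1) e by (intro mult_mono) auto
    then show ?thesis by (simp add: u_def)
  qed
  show thesis
    by (rule that[OF B(1)]; rule order.trans[OF _ *]; rule B)
qed

lemma jext_integrable:
  assumes g: "cauchy_integrable g" and \<delta>: "0 < \<delta>"
  shows "integrable lborel (\<lambda>y. cjackson_at \<delta> y z * (g y / complex_of_real \<delta>))"
proof -
  note [measurable] = cauchy_integrable_measurable[OF g]
  have [measurable]: "(\<lambda>y::real. cjackson_at \<delta> y z) \<in> borel_measurable borel"
    by (intro borel_measurable_continuous_onI continuous_on_compose2[OF holomorphic_on_imp_continuous_on[OF cjackson_holomorphic]])
       (use \<delta> in \<open>auto intro!: continuous_intros\<close>)
  obtain B where B: "0 < B"
    "\<And>y w. norm (cjackson_at \<delta> y w) \<le> cjackson_growth B \<delta> w / (1 + y\<^sup>2)"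
    by (rule jext_integrand_bound[OF \<delta>]) (rule that)
  define M where "M = cjackson_growth B \<delta> z"
  have "integrable lborel (\<lambda>y. M / \<delta> * (norm (g y) / (1 + y\<^sup>2)))"
    using g by (intro integrable_mult_right) (simp add: cauchy_integrable_def)
  then show ?thesis
  proof (rule Bochner_Integration.integrable_bound)
    show "AE y in lborel. norm (cjackson_at \<delta> y z * (g y / complex_of_real \<delta>)) \<le> norm (M / \<delta> * (norm (g y) / (1 + y\<^sup>2)))"
    proof (rule AE_I2)
      fix y
      have "norm (cjackson_at \<delta> y z * (g y / complex_of_real \<delta>)) \<le> M / (1 + y\<^sup>2) * (norm (g y) / \<delta>)"
        unfolding norm_mult using B(2)[of y z] \<delta> by (intro mult_mono) (auto simp: M_def norm_divide B(1) less_imp_le)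
      then show "norm (cjackson_at \<delta> y z * (g y / complex_of_real \<delta>)) \<le> norm (M / \<delta> * (norm (g y) / (1 + y\<^sup>2)))"
        by (simp add: mult_ac abs_if)
    qed
  qed measurable
qed

lemma jext_of_real:
  assumes g: "cauchy_integrable g" and \<delta>: "0 < \<delta>"
  shows "jext \<delta> g (complex_of_real x) = cconv \<delta> jackson g x"
proof -
  have "jext \<delta> g (complex_of_real x) = \<bar>\<delta>\<bar> *\<^sub>R (LINT t|lborel.
     cjackson ((complex_of_real (x + \<delta> * t) - complex_of_real x) / complex_of_real \<delta>) * (g (x + \<delta> * t) / complex_of_real \<delta>))"
    unfolding jext_def using \<delta> by (intro lborel_integral_real_affine) auto
  also have "\<dots> = (LINT t|lborel. \<bar>\<delta>\<bar> *\<^sub>R (cjackson ((complex_of_real (x + \<delta> * t) - complex_of_real x) / complex_of_real \<delta>) * (g (x + \<delta> * t) / complex_of_real \<delta>)))"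
    using lborel_integrable_real_affine[OF jext_integrable[OF g \<delta>, of "complex_of_real x"], of \<delta> x] \<delta>
    by (intro Bochner_Integration.integral_scaleR_right[symmetric])
  also have "\<dots> = cconv \<delta> jackson g x"
    unfolding cconv_def
  proof (intro Bochner_Integration.integral_cong refl)
    fix t
    have "(complex_of_real (x + \<delta> * t) - complex_of_real x) / complex_of_real \<delta> = complex_of_real t"
      using \<delta> by simp
    then show "\<bar>\<delta>\<bar> *\<^sub>R (cjackson ((complex_of_real (x + \<delta> * t) - complex_of_real x) / complex_of_real \<delta>) * (g (x + \<delta> * t) / complex_of_real \<delta>)) =
      jackson t *\<^sub>R g (x + \<delta> * t)"
      using \<delta> by (simp add: cjackson_of_real scaleR_conv_of_real del: of_real_add of_real_mult)
  qed
  finally show ?thesis .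
qed

text \<open>Differentiation under the integral sign. The difference quotients at \<open>z\<close> are dominated, by the mean value inequality, by the supremum of the derivative of the integrand over \<open>ball z 1\<close>.\<close>

lemma jext_holomorphic:
  assumes g: "cauchy_integrable g" and \<delta>: "0 < \<delta>"
  shows "jext \<delta> g holomorphic_on UNIV"
proof -
  note [measurable] = cauchy_integrable_measurable[OF g]
  define h where "h y w = cjackson_at \<delta> y w * (g y / complex_of_real \<delta>)" for y w
  define h' where "h' y w = cjackson_deriv_at \<delta> y w * (- 1 / complex_of_real \<delta>) * (g y / complex_of_real \<delta>)" for y w
  have hi: "integrable lborel (\<lambda>y. h y w)" for w unfolding h_def by (rule jext_integrable[OF g \<delta>])
  have jh: "jext \<delta> g w = (LINT y|lborel. h y w)" for w by (simp add: jext_def h_def)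
  have dc: "(cjackson has_field_derivative deriv cjackson u) (at u)" for u
    using cjackson_holomorphic holomorphic_derivI[of cjackson UNIV u] by simp
  have hd: "(h y has_field_derivative h' y w) (at w)" for y w
    unfolding h_def h'_def using \<delta>
    by (intro DERIV_cmult_right DERIV_chain2[OF dc]) (auto intro!: derivative_eq_intros)
  have cd: "continuous_on UNIV (deriv cjackson)"
    by (intro holomorphic_on_imp_continuous_on holomorphic_deriv cjackson_holomorphic open_UNIV)
  have "(\<lambda>y::real. cjackson_deriv_at \<delta> y w) \<in> borel_measurable borel" for w
  proof (rule borel_measurable_continuous_onI)
    have "continuous_on UNIV (\<lambda>y::real. (complex_of_real y - w) / complex_of_real \<delta>)"
      using \<delta> by (intro continuous_intros) auto
    then show "continuous_on UNIV (\<lambda>y::real. cjackson_deriv_at \<delta> y w)"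
      by (rule continuous_on_compose2[OF cd]) simp
  qed
  then have mh': "(\<lambda>y. h' y w) \<in> borel_measurable borel" for w unfolding h'_def by measurable
  obtain B where B: "0 < B"
    "\<And>y w. norm (cjackson_at \<delta> y w) \<le> cjackson_growth B \<delta> w / (1 + y\<^sup>2)"
    "\<And>y w. norm (cjackson_deriv_at \<delta> y w) \<le> cjackson_growth B \<delta> w / (1 + y\<^sup>2)"
    by (rule jext_integrand_bound[OF \<delta>]) (rule that)
  have "(jext \<delta> g has_field_derivative (LINT y|lborel. h' y z)) (at z)" for z
  proof -
    define M where "M = B * exp (2 / \<delta> * (norm z + 1)) * (1 + 2 * (norm z + 1)\<^sup>2 + 2 * \<delta>\<^sup>2)"
    have M: "0 \<le> M" using B by (simp add: M_def)
    have bd: "norm (h' y w) \<le> M * norm (g y) / (1 + y\<^sup>2) / \<delta>\<^sup>2" if "w \<in> ball z 1" for y w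
    proof -
      have "norm w \<le> norm z + 1" using that norm_triangle_ineq[of z "w - z"] by (simp add: dist_norm norm_minus_commute)
      then have "cjackson_growth B \<delta> w \<le> M"
        unfolding M_def using B(1) \<delta> by (intro mult_mono) (auto intro!: power_mono mult_left_mono divide_right_mono)
      then have "norm (cjackson_deriv_at \<delta> y w) \<le> M / (1 + y\<^sup>2)"
        using B(3)[of y w] divide_right_mono[of _ M "1 + y\<^sup>2"] by (meson order.trans less_imp_le one_plus_square_pos)
      then have "norm (cjackson_deriv_at \<delta> y w) * (norm (g y) / \<delta>\<^sup>2) \<le> M / (1 + y\<^sup>2) * (norm (g y) / \<delta>\<^sup>2)"
        by (rule mult_right_mono) simp
      then show ?thesis using \<delta> by (simp add: h'_def norm_mult norm_divide power2_eq_square mult_ac)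
    qed
    show ?thesis
      unfolding has_field_derivative_iff tendsto_at_iff_sequentially
    proof (intro allI impI)
      fix X assume X: "\<forall>i. X i \<in> UNIV - {z}" "X \<longlonglongrightarrow> z"
      obtain N where N: "\<And>n. N \<le> n \<Longrightarrow> dist (X n) z < 1" using X(2) lim_sequentially[of X z] by (metis zero_less_one)
      define Y where "Y n = X (n + N)" for n
      have Y: "Y n \<noteq> z" "Y n \<in> ball z 1" "Y \<longlonglongrightarrow> z" for n
        using X N[of "n + N"] LIMSEQ_ignore_initial_segment[OF X(2), of N] by (auto simp: Y_def[abs_def] dist_commute)
      have "(\<lambda>n. LINT y|lborel. (h y (Y n) - h y z) / (Y n - z)) \<longlonglongrightarrow> (LINT y|lborel. h' y z)"
      proof (rule integral_dominated_convergence[where w="\<lambda>y. M * norm (g y) / (1 + y\<^sup>2) / \<delta>\<^sup>2"])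
        show "(\<lambda>y. h' y z) \<in> borel_measurable lborel" using mh' by simp
        show "(\<lambda>y. (h y (Y n) - h y z) / (Y n - z)) \<in> borel_measurable lborel" for n
          using borel_measurable_integrable[OF hi[of "Y n"]] borel_measurable_integrable[OF hi[of z]] by measurable
        show "integrable lborel (\<lambda>y. M * norm (g y) / (1 + y\<^sup>2) / \<delta>\<^sup>2)"
          using integrable_mult_right[where c="M / \<delta>\<^sup>2", of lborel "\<lambda>y. norm (g y) / (1 + y\<^sup>2)"] g by (simp add: cauchy_integrable_def mult_ac)
        show "AE y in lborel. (\<lambda>n. (h y (Y n) - h y z) / (Y n - z)) \<longlonglongrightarrow> h' y z"
        proof (rule AE_I2)
          fix y
          have "((\<lambda>w. (h y w - h y z) / (w - z)) \<longlongrightarrow> h' y z) (at z)"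
            using hd[of y z] by (simp add: has_field_derivative_iff)
          then have "((\<lambda>w. (h y w - h y z) / (w - z)) \<circ> Y) \<longlonglongrightarrow> h' y z"
            unfolding tendsto_at_iff_sequentially using Y by blast
          then show "(\<lambda>n. (h y (Y n) - h y z) / (Y n - z)) \<longlonglongrightarrow> h' y z" by (simp add: o_def)
        qed
        show "AE y in lborel. norm ((h y (Y n) - h y z) / (Y n - z)) \<le> M * norm (g y) / (1 + y\<^sup>2) / \<delta>\<^sup>2" for n
        proof (rule AE_I2)
          fix y
          have "norm (h y (Y n) - h y z) \<le> M * norm (g y) / (1 + y\<^sup>2) / \<delta>\<^sup>2 * norm (Y n - z)"
            by (rule field_differentiable_bound[of "ball z 1"])
               (use hd bd Y in \<open>auto intro: has_field_derivative_at_within\<close>)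
          then show "norm ((h y (Y n) - h y z) / (Y n - z)) \<le> M * norm (g y) / (1 + y\<^sup>2) / \<delta>\<^sup>2"
            using Y(1)[of n] by (simp add: norm_divide pos_divide_le_eq)
        qed
      qed
      moreover have "(LINT y|lborel. (h y (Y n) - h y z) / (Y n - z)) = (jext \<delta> g (Y n) - jext \<delta> g z) / (Y n - z)" for n
        unfolding jh by (simp add: Bochner_Integration.integral_diff[OF hi hi])
      ultimately have "(\<lambda>n. (jext \<delta> g (X (n + N)) - jext \<delta> g z) / (X (n + N) - z)) \<longlonglongrightarrow> (LINT y|lborel. h' y z)"
        by (simp only: Y_def)
      then show "((\<lambda>w. (jext \<delta> g w - jext \<delta> g z) / (w - z)) \<circ> X) \<longlonglongrightarrow> (LINT y|lborel. h' y z)"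
        unfolding o_def by (rule LIMSEQ_offset)
    qed
  qed
  then show ?thesis by (auto simp: holomorphic_on_def field_differentiable_def)
qed

text \<open>The polynomial factor of the bound is absorbed by \<open>exp (\<epsilon> * norm z)\<close>.\<close>

lemma jext_exp_type:
  assumes g: "cauchy_integrable g" and \<delta>: "0 < \<delta>"
  shows "exp_type_le (2 / \<delta>) (jext \<delta> g)"
  unfolding exp_type_le_def
proof (intro allI impI)
  fix \<epsilon> :: real assume \<epsilon>: "0 < \<epsilon>"
  obtain B where B: "0 < B"
    "\<And>y w. norm (cjackson_at \<delta> y w) \<le> cjackson_growth B \<delta> w / (1 + y\<^sup>2)"
    "\<And>y w. norm (cjackson_deriv_at \<delta> y w) \<le> cjackson_growth B \<delta> w / (1 + y\<^sup>2)"
    by (rule jext_integrand_bound[OF \<delta>]) (rule that)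
  define G where "G = (LINT y|lborel. norm (g y) / (1 + y\<^sup>2))"
  have G: "0 \<le> G" unfolding G_def by (intro integral_nonneg_AE) auto
  define c where "c = 1 + 2 * \<delta>\<^sup>2 + 4 / \<epsilon>\<^sup>2"
  have "norm (jext \<delta> g z) \<le> (B * c * G / \<delta>) * exp ((2 / \<delta> + \<epsilon>) * norm z)" for z
  proof -
    define M where "M = cjackson_growth B \<delta> z"
    have "norm (jext \<delta> g z) \<le> (LINT y|lborel. M / \<delta> * (norm (g y) / (1 + y\<^sup>2)))"
      unfolding jext_def
    proof (rule Bochner_Integration.integral_norm_bound_integral[OF jext_integrable[OF g \<delta>]])
      show "integrable lborel (\<lambda>y. M / \<delta> * (norm (g y) / (1 + y\<^sup>2)))"
        using g by (intro integrable_mult_right) (simp add: cauchy_integrable_def)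
      fix y
      have "norm (cjackson_at \<delta> y z * (g y / complex_of_real \<delta>)) \<le> M / (1 + y\<^sup>2) * (norm (g y) / \<delta>)"
        unfolding norm_mult using B(2)[of y z] \<delta> by (intro mult_mono) (auto simp: M_def norm_divide B(1) less_imp_le)
      then show "norm (cjackson_at \<delta> y z * (g y / complex_of_real \<delta>)) \<le> M / \<delta> * (norm (g y) / (1 + y\<^sup>2))"
        by (simp add: mult_ac)
    qed
    also have "\<dots> = M / \<delta> * G" by (simp only: G_def integral_mult_right_zero)
    finally have 1: "norm (jext \<delta> g z) \<le> M / \<delta> * G" .
    have "M \<le> B * exp (2 / \<delta> * norm z) * (c * exp (\<epsilon> * norm z))"
    proof -
      have e1: "1 + \<epsilon> * norm z + (\<epsilon> * norm z)\<^sup>2 / 2 \<le> exp (\<epsilon> * norm z)"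
        using \<epsilon> by (intro exp_lower_Taylor_quadratic) auto
      have e0: "0 \<le> \<epsilon> * norm z" using \<epsilon> by simp
      have "(\<epsilon> * norm z)\<^sup>2 \<le> 2 * exp (\<epsilon> * norm z)" using e1 e0 by linarith
      then have "2 * (norm z)\<^sup>2 \<le> 4 / \<epsilon>\<^sup>2 * exp (\<epsilon> * norm z)"
        using \<epsilon> by (simp add: field_simps power_mult_distrib)
      moreover have "(1 + 2 * \<delta>\<^sup>2) * 1 \<le> (1 + 2 * \<delta>\<^sup>2) * exp (\<epsilon> * norm z)"
        using e0 by (intro mult_left_mono) auto
      ultimately have "1 + 2 * (norm z)\<^sup>2 + 2 * \<delta>\<^sup>2 \<le> c * exp (\<epsilon> * norm z)"
        unfolding c_def distrib_right by linarith
      then show ?thesis unfolding M_def using B(1) by (intro mult_left_mono) auto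
    qed
    then have "M / \<delta> * G \<le> B * exp (2 / \<delta> * norm z) * (c * exp (\<epsilon> * norm z)) / \<delta> * G"
      using \<delta> G by (intro mult_right_mono divide_right_mono) auto
    with 1 have "norm (jext \<delta> g z) \<le> B * exp (2 / \<delta> * norm z) * (c * exp (\<epsilon> * norm z)) / \<delta> * G" by (rule order.trans)
    also have "\<dots> = (B * c * G / \<delta>) * exp ((2 / \<delta> + \<epsilon>) * norm z)"
      by (simp add: distrib_right exp_add)
    finally show ?thesis .
  qed
  then show "\<exists>A. \<forall>z. norm (jext \<delta> g z) \<le> A * exp ((2 / \<delta> + \<epsilon>) * norm z)" by blast
qed

lemma cauchy_kernel_indicator: "cauchy_kernel (indicator {a..b} :: real \<Rightarrow> real)"
proof -
  have "\<bar>indicator {a..b} t :: real\<bar> \<le> (1 + (\<bar>a\<bar> + \<bar>b\<bar>)\<^sup>2) / (1 + t\<^sup>2)" for t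
  proof (cases "t \<in> {a..b}")
    case True
    then have "\<bar>t\<bar>\<^sup>2 \<le> (\<bar>a\<bar> + \<bar>b\<bar>)\<^sup>2" by (intro power_mono) auto
    then show ?thesis using True by simp
  qed simp
  then show ?thesis unfolding cauchy_kernel_def by auto
qed

lemma cauchy_integrable_set_integrable: "cauchy_integrable g \<Longrightarrow> set_integrable lborel {a..b} g"
  unfolding set_integrable_def by (rule cauchy_integrable_mult_kernel[OF cauchy_kernel_indicator])

definition antiderivative :: "(real \<Rightarrow> complex) \<Rightarrow> (real \<Rightarrow> complex) \<Rightarrow> bool" where
  "antiderivative F f \<longleftrightarrow> (\<forall>a b. a \<le> b \<longrightarrow> F b - F a = (LINT t:{a..b}|lborel. f t))"

lemma antiderivative_diff:
  assumes "antiderivative F f" "antiderivative G g" "cauchy_integrable f" "cauchy_integrable g"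
  shows "antiderivative (\<lambda>x. F x - G x) (\<lambda>x. f x - g x)"
  unfolding antiderivative_def
proof (intro allI impI)
  fix a b :: real assume "a \<le> b"
  then show "(F b - G b) - (F a - G a) = (LINT t:{a..b}|lborel. f t - g t)"
    using assms by (simp add: antiderivative_def set_integral_diff[OF assms(3,4)[THEN cauchy_integrable_set_integrable]] algebra_simps)
qed

text \<open>By Fubini's theorem, as the operator commutes with translations.\<close>

lemma antiderivative_cconv:
  assumes k: "cauchy_kernel k" and F: "cauchy_integrable F" and f: "cauchy_integrable f"
    and ad: "antiderivative F f" and \<delta>: "\<delta> \<noteq> 0"
  shows "antiderivative (cconv \<delta> k F) (cconv \<delta> k f)"
  unfolding antiderivative_def
proof (intro allI impI)
  fix a b :: real assume ab: "a \<le> b"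
  note [measurable] = cauchy_kernel_measurable[OF k] cauchy_integrable_measurable[OF F] cauchy_integrable_measurable[OF f]
  let ?h = "\<lambda>t u. (indicator {a..b} u * k t) *\<^sub>R f (u + \<delta> * t)"
  define G where "G y = complex_of_real (norm (f y))" for y
  have G: "cauchy_integrable G" unfolding G_def by (rule cauchy_integrable_norm[OF f])
  have i: "integrable (lborel \<Otimes>\<^sub>M lborel) (\<lambda>(u, t). ?h t u)"
  proof (rule lborel_pair.Fubini_integrable)
    have "integrable lborel (\<lambda>u. indicator {a..b} u *\<^sub>R cconv \<delta> (\<lambda>t. \<bar>k t\<bar>) G u)"
      by (intro cauchy_integrable_mult_kernel cauchy_kernel_indicator cauchy_integrable_cconv cauchy_kernel_abs k G \<delta>)
    then have "integrable lborel (\<lambda>u. Re (indicator {a..b} u *\<^sub>R cconv \<delta> (\<lambda>t. \<bar>k t\<bar>) G u))" by (rule integrable_Re)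
    also have "(\<lambda>u. Re (indicator {a..b} u *\<^sub>R cconv \<delta> (\<lambda>t. \<bar>k t\<bar>) G u)) =
        (\<lambda>u. LINT t|lborel. norm (case (u, t) of (u, t) \<Rightarrow> ?h t u))"
    proof
      fix u
      have "cconv \<delta> (\<lambda>t. \<bar>k t\<bar>) G u = (LINT t|lborel. complex_of_real (\<bar>k t\<bar> * norm (f (u + \<delta> * t))))"
        unfolding cconv_def G_def by (simp add: scaleR_conv_of_real)
      also have "\<dots> = complex_of_real (LINT t|lborel. \<bar>k t\<bar> * norm (f (u + \<delta> * t)))"
        by (rule integral_complex_of_real)
      finally show "Re (indicator {a..b} u *\<^sub>R cconv \<delta> (\<lambda>t. \<bar>k t\<bar>) G u) = (LINT t|lborel. norm (case (u, t) of (u, t) \<Rightarrow> ?h t u))"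
        by (simp add: abs_mult mult.assoc)
    qed
    finally show "integrable lborel (\<lambda>u. LINT t|lborel. norm (case (u, t) of (u, t) \<Rightarrow> ?h t u))" .
    show "AE u in lborel. integrable lborel (\<lambda>t. case (u, t) of (u, t) \<Rightarrow> ?h t u)"
    proof (rule AE_I2)
      fix u
      have "integrable lborel (\<lambda>t. indicator {a..b} u *\<^sub>R (k t *\<^sub>R f (u + \<delta> * t)))"
        by (intro integrable_scaleR_right integrable_cconv k f \<delta>)
      then show "integrable lborel (\<lambda>t. case (u, t) of (u, t) \<Rightarrow> ?h t u)" by simp
    qed
  qed measurable
  have "cconv \<delta> k F b - cconv \<delta> k F a = (LINT t|lborel. k t *\<^sub>R F (b + \<delta> * t) - k t *\<^sub>R F (a + \<delta> * t))"
    unfolding cconv_def by (intro Bochner_Integration.integral_diff[symmetric] integrable_cconv k F \<delta>)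
  also have "\<dots> = (LINT t|lborel. LINT u|lborel. ?h t u)"
  proof (intro Bochner_Integration.integral_cong refl)
    fix t
    have "F (b + \<delta> * t) - F (a + \<delta> * t) = (LINT v|lborel. indicator {a + \<delta> * t..b + \<delta> * t} v *\<^sub>R f v)"
      using ad ab by (simp add: antiderivative_def set_lebesgue_integral_def)
    also have "\<dots> = (LINT u|lborel. indicator {a..b} u *\<^sub>R f (u + \<delta> * t))"
      by (subst lborel_integral_real_affine[where c=1 and t="\<delta> * t"]) (auto simp: add.commute indicator_def intro!: Bochner_Integration.integral_cong)
    finally have "k t *\<^sub>R (F (b + \<delta> * t) - F (a + \<delta> * t)) = k t *\<^sub>R (LINT u|lborel. indicator {a..b} u *\<^sub>R f (u + \<delta> * t))" by simp
    also have "\<dots> = (LINT u|lborel. ?h t u)"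
      by (simp only: scaleR_scaleR[symmetric] mult.commute[of _ "k t"] Bochner_Integration.integral_scaleR_right)
    finally show "k t *\<^sub>R F (b + \<delta> * t) - k t *\<^sub>R F (a + \<delta> * t) = (LINT u|lborel. ?h t u)"
      by (simp add: scaleR_diff_right)
  qed
  also have "\<dots> = (LINT u|lborel. LINT t|lborel. ?h t u)"
    using lborel_pair.Fubini_integral[of "\<lambda>u t. ?h t u"] i by simp
  also have "\<dots> = (LINT u:{a..b}|lborel. cconv \<delta> k f u)"
    unfolding set_lebesgue_integral_def cconv_def
    by (intro Bochner_Integration.integral_cong refl) (simp flip: scaleR_scaleR)
  finally show "cconv \<delta> k F b - cconv \<delta> k F a = (LINT u:{a..b}|lborel. cconv \<delta> k f u)" .
qed

text \<open>On the real line \<open>jext \<delta> F\<close> is an antiderivative of the continuous function \<open>jext \<delta> f\<close>, so that both sides agree there, and hence everywhere by analytic continuation.\<close>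

lemma deriv_jext:
  assumes F: "cauchy_integrable F" and f: "cauchy_integrable f" and ad: "antiderivative F f" and \<delta>: "0 < \<delta>"
  shows "deriv (jext \<delta> F) = jext \<delta> f"
proof -
  note hol = jext_holomorphic[OF F \<delta>] jext_holomorphic[OF f \<delta>]
  have hol': "deriv (jext \<delta> F) holomorphic_on UNIV" using hol(1) by (rule holomorphic_deriv) simp
  define \<phi> where "\<phi> x = jext \<delta> f (complex_of_real x)" for x
  have cont: "continuous_on UNIV \<phi>"
    unfolding \<phi>_def by (rule continuous_on_compose2[OF holomorphic_on_imp_continuous_on[OF hol(2)]]) (auto intro: continuous_on_of_real_id)
  have real: "deriv (jext \<delta> F) (complex_of_real x) = jext \<delta> f (complex_of_real x)" for x
  proof -
    have FI: "jext \<delta> F (complex_of_real u) = jext \<delta> F (complex_of_real (x - 1)) + integral {x - 1..u} \<phi>" if "x - 1 \<le> u" for u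
    proof -
      have "cconv \<delta> jackson F u - cconv \<delta> jackson F (x - 1) = (LINT t:{x - 1..u}|lborel. cconv \<delta> jackson f t)"
        using antiderivative_cconv[OF cauchy_kernel_jackson F f ad, of \<delta>] \<delta> that by (simp add: antiderivative_def)
      also have "(\<lambda>t. cconv \<delta> jackson f t) = \<phi>" using jext_of_real[OF f \<delta>] by (simp add: \<phi>_def fun_eq_iff)
      also have "(LINT t:{x - 1..u}|lborel. \<phi> t) = integral {x - 1..u} \<phi>"
        by (intro set_borel_integral_eq_integral borel_integrable_atLeastAtMost')
           (auto intro: continuous_on_subset[OF cont])
      finally show ?thesis using jext_of_real[OF F \<delta>] by (simp add: diff_eq_eq add.commute del: of_real_diff)
    qed
    have "((\<lambda>u. integral {x - 1..u} \<phi>) has_vector_derivative \<phi> x) (at x within {x - 1..x + 1})"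
      by (rule integral_has_vector_derivative) (auto intro: continuous_on_subset[OF cont])
    then have "((\<lambda>u. integral {x - 1..u} \<phi>) has_vector_derivative \<phi> x) (at x)"
      by (subst (asm) at_within_interior) auto
    then have "((\<lambda>u. jext \<delta> F (complex_of_real (x - 1)) + integral {x - 1..u} \<phi>) has_vector_derivative \<phi> x) (at x)"
      using has_vector_derivative_add[OF has_vector_derivative_const] by fastforce
    then have 1: "((\<lambda>u. jext \<delta> F (complex_of_real u)) has_vector_derivative \<phi> x) (at x)"
      by (rule has_vector_derivative_transform_within_open[where S="{x - 1<..}"]) (auto simp: FI)
    have "(jext \<delta> F has_field_derivative deriv (jext \<delta> F) (complex_of_real x)) (at (complex_of_real x))"
      using holomorphic_derivI[OF hol(1), of "complex_of_real x" UNIV] by simp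
    then have "((\<lambda>u. jext \<delta> F (complex_of_real u)) has_vector_derivative deriv (jext \<delta> F) (complex_of_real x)) (at x)"
      by (rule has_vector_derivative_real_field)
    with 1 show ?thesis unfolding \<phi>_def by (rule vector_derivative_unique_at[symmetric])
  qed
  show ?thesis
  proof
    fix z
    have "deriv (jext \<delta> F) z - jext \<delta> f z = 0"
    proof (rule analytic_continuation[of "\<lambda>z. deriv (jext \<delta> F) z - jext \<delta> f z" UNIV "range complex_of_real" 0])
      show "(0::complex) islimpt range complex_of_real"
        unfolding islimpt_approachable
      proof (intro allI impI)
        fix e :: real assume "0 < e"
        then show "\<exists>x'\<in>range complex_of_real. x' \<noteq> 0 \<and> dist x' 0 < e"
          by (intro bexI[of _ "complex_of_real (e / 2)"] rangeI) (auto simp del: of_real_divide)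
      qed
    qed (use real hol(2) hol' in \<open>auto intro: holomorphic_on_diff\<close>)
    then show "deriv (jext \<delta> F) z = jext \<delta> f z" by simp
  qed
qed

text \<open>Where \<open>\<bar>s\<bar> \<le> \<bar>t\<bar>\<close>, the quartic decay of the kernel in \<open>t\<close> splits into quadratic decay in \<open>s\<close> and in \<open>t\<close>.\<close>

lemma jackson_tail_bound:
  obtains B where "0 < B"
    "\<And>s. (\<integral>\<^sup>+t. ennreal (jackson t) * indicator {t. \<bar>s\<bar> \<le> \<bar>t\<bar>} t \<partial>lborel) \<le> ennreal (B / (1 + s\<^sup>2))"
proof -
  obtain B where B: "0 < B" "\<And>t. jackson t \<le> B / (1 + \<bar>t\<bar>) ^ 4" by (rule jackson_bound) (rule that)
  have "(\<integral>\<^sup>+t. ennreal (jackson t) * indicator {t. \<bar>s\<bar> \<le> \<bar>t\<bar>} t \<partial>lborel) \<le> ennreal (B * pi / (1 + s\<^sup>2))" for s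
  proof -
    have "(\<integral>\<^sup>+t. ennreal (jackson t) * indicator {t. \<bar>s\<bar> \<le> \<bar>t\<bar>} t \<partial>lborel) \<le>
        (\<integral>\<^sup>+t. ennreal (B / (1 + s\<^sup>2)) * ennreal (1 / (1 + t\<^sup>2)) \<partial>lborel)"
    proof (rule nn_integral_mono)
      fix t
      have "jackson t \<le> B / (1 + s\<^sup>2) * (1 / (1 + t\<^sup>2))" if st: "\<bar>s\<bar> \<le> \<bar>t\<bar>"
      proof -
        have "\<bar>s\<bar>\<^sup>2 \<le> \<bar>t\<bar>\<^sup>2" using st by (intro power_mono) auto
        then have "(1 + s\<^sup>2) * (1 + t\<^sup>2) \<le> (1 + \<bar>t\<bar>)\<^sup>2 * (1 + \<bar>t\<bar>)\<^sup>2"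
          using one_plus_square_le[of t] by (intro mult_mono) auto
        also have "\<dots> = (1 + \<bar>t\<bar>) ^ 4" by (simp flip: power_add)
        finally have "B / (1 + \<bar>t\<bar>) ^ 4 \<le> B / ((1 + s\<^sup>2) * (1 + t\<^sup>2))"
          using B(1) by (intro divide_left_mono) (auto intro!: mult_pos_pos)
        then show ?thesis using B(2)[of t] by simp
      qed
      then show "ennreal (jackson t) * indicator {t. \<bar>s\<bar> \<le> \<bar>t\<bar>} t \<le> ennreal (B / (1 + s\<^sup>2)) * ennreal (1 / (1 + t\<^sup>2))"
        using B(1) by (auto simp: indicator_def ennreal_mult[symmetric] intro!: ennreal_leI)
    qed
    also have "\<dots> = ennreal (B / (1 + s\<^sup>2)) * ennreal pi"
      by (subst nn_integral_cmult) (auto simp: nn_integral_cauchy)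
    also have "\<dots> = ennreal (B * pi / (1 + s\<^sup>2))" using B(1) by (simp add: ennreal_mult[symmetric])
    finally show ?thesis .
  qed
  then show thesis using B(1) by (intro that[of "B * pi"]) auto
qed

definition jackson_diff :: "real \<Rightarrow> (real \<Rightarrow> complex) \<Rightarrow> real \<Rightarrow> complex" where
  "jackson_diff \<delta> g x = g x - cconv \<delta> jackson g x"

text \<open>As the kernel has integral \<open>1\<close>, \<open>F - A F\<close> is an average of differences \<open>F x - F (x + \<delta> * t)\<close>, that is, of integrals of \<open>f\<close>. Exchanging the integrals leaves \<open>f\<close> integrated against the tails of the Jackson kernel.\<close>

lemma jackson_diff_le_derivative:
  obtains B where "0 < B" "\<And>\<delta> F f x. 0 < \<delta> \<Longrightarrow> cauchy_integrable F \<Longrightarrow> cauchy_integrable f \<Longrightarrow> antiderivative F f \<Longrightarrow>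
    ennreal (norm (jackson_diff \<delta> F x)) \<le> cauchy_avg \<delta> (\<lambda>y. (\<delta> * B) *\<^sub>R f y) x"
proof -
  obtain B where B: "0 < B"
    "\<And>s. (\<integral>\<^sup>+t. ennreal (jackson t) * indicator {t. \<bar>s\<bar> \<le> \<bar>t\<bar>} t \<partial>lborel) \<le> ennreal (B / (1 + s\<^sup>2))"
    by (rule jackson_tail_bound) (rule that)
  note [measurable] = cauchy_kernel_measurable[OF cauchy_kernel_jackson]
  have "ennreal (norm (jackson_diff \<delta> F x)) \<le> cauchy_avg \<delta> (\<lambda>y. (\<delta> * B) *\<^sub>R f y) x"
    if \<delta>: "0 < \<delta>" and F: "cauchy_integrable F" and f: "cauchy_integrable f" and ad: "antiderivative F f" for \<delta> F f x
  proof -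
    note [measurable] = cauchy_integrable_measurable[OF F] cauchy_integrable_measurable[OF f]
    let ?f = "\<lambda>u. ennreal (norm (f u))" and ?F = "\<lambda>s. ennreal (\<delta> * norm (f (x + \<delta> * s)))"
    let ?in = "\<lambda>t s. indicator {s. \<bar>s\<bar> \<le> \<bar>t\<bar>} s" and ?B = "\<lambda>t. {x - \<delta> * \<bar>t\<bar>..x + \<delta> * \<bar>t\<bar>}"
    let ?J = "\<lambda>t. jackson t *\<^sub>R F x - jackson t *\<^sub>R F (x + \<delta> * t)"
    have i1: "integrable lborel (\<lambda>t. jackson t *\<^sub>R F x)"
      by (intro integrable_scaleR_left cauchy_kernel_integrable cauchy_kernel_jackson)
    have i2: "integrable lborel (\<lambda>t. jackson t *\<^sub>R F (x + \<delta> * t))"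
      by (rule integrable_cconv[OF cauchy_kernel_jackson F]) (use \<delta> in simp)
    have "F x = (LINT t|lborel. jackson t *\<^sub>R F x)"
      using cauchy_kernel_integrable[OF cauchy_kernel_jackson]
      by (subst Bochner_Integration.integral_scaleR_left) (simp_all add: integral_jackson)
    then have "jackson_diff \<delta> F x = (LINT t|lborel. ?J t)"
      unfolding jackson_diff_def cconv_def using Bochner_Integration.integral_diff[OF i1 i2] by simp
    then have "ennreal (norm (jackson_diff \<delta> F x)) \<le> (\<integral>\<^sup>+t. norm (?J t) \<partial>lborel)"
      using integral_norm_bound_ennreal[OF Bochner_Integration.integrable_diff[OF i1 i2]] by simp
    also have "\<dots> \<le> (\<integral>\<^sup>+t. (\<integral>\<^sup>+s. ennreal (jackson t) * (?F s * ?in t s) \<partial>lborel) \<partial>lborel)"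
    proof (rule nn_integral_mono)
      fix t
      have loc: "ennreal (norm (F b - F a)) \<le> (\<integral>\<^sup>+u. ?f u * indicator {a..b} u \<partial>lborel)" if "a \<le> b" for a b
      proof -
        have "ennreal (norm (LINT u|lborel. indicator {a..b} u *\<^sub>R f u)) \<le> (\<integral>\<^sup>+u. norm (indicator {a..b} u *\<^sub>R f u) \<partial>lborel)"
          using cauchy_integrable_set_integrable[OF f] unfolding set_integrable_def by (rule integral_norm_bound_ennreal)
        also have "\<dots> = (\<integral>\<^sup>+u. ?f u * indicator {a..b} u \<partial>lborel)"
          by (intro nn_integral_cong) (auto simp: indicator_def)
        finally show ?thesis using ad that by (simp add: antiderivative_def set_lebesgue_integral_def)
      qed
      have "ennreal (norm (F x - F (x + \<delta> * t))) \<le> (\<integral>\<^sup>+u. ?f u * indicator (?B t) u \<partial>lborel)"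
      proof (cases "0 \<le> t")
        case True
        then have "ennreal (norm (F x - F (x + \<delta> * t))) \<le> (\<integral>\<^sup>+u. ?f u * indicator {x..x + \<delta> * t} u \<partial>lborel)"
          using loc[of x "x + \<delta> * t"] \<delta> by (simp add: norm_minus_commute)
        also have "\<dots> \<le> (\<integral>\<^sup>+u. ?f u * indicator (?B t) u \<partial>lborel)"
          using True \<delta> by (intro nn_integral_mono mult_left_mono) (auto simp: indicator_def intro: order.trans[of _ x])
        finally show ?thesis .
      next
        case False
        then have "t \<le> 0" by simp
        then have dt: "\<delta> * t \<le> 0" using \<delta> by (intro mult_nonneg_nonpos) auto
        then have "x + \<delta> * t \<le> x" by simp
        then have "ennreal (norm (F x - F (x + \<delta> * t))) \<le> (\<integral>\<^sup>+u. ?f u * indicator {x + \<delta> * t..x} u \<partial>lborel)"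
          by (rule loc)
        also have "\<dots> \<le> (\<integral>\<^sup>+u. ?f u * indicator (?B t) u \<partial>lborel)"
        proof (intro nn_integral_mono mult_left_mono)
          fix u
          have "x \<le> x + \<delta> * \<bar>t\<bar>" "x - \<delta> * \<bar>t\<bar> = x + \<delta> * t" using False \<delta> dt by auto
          then show "(indicator {x + \<delta> * t..x} u :: ennreal) \<le> indicator (?B t) u"
            by (auto simp: indicator_def)
        qed simp
        finally show ?thesis .
      qed
      also have "\<dots> = ennreal \<delta> * (\<integral>\<^sup>+s. ?f (x + \<delta> * s) * indicator (?B t) (x + \<delta> * s) \<partial>lborel)"
        using \<delta> by (subst nn_integral_real_affine[where c=\<delta> and t=x]) auto
      also have "\<dots> = (\<integral>\<^sup>+s. ennreal \<delta> * (?f (x + \<delta> * s) * indicator (?B t) (x + \<delta> * s)) \<partial>lborel)"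
        by (subst nn_integral_cmult) auto
      also have "\<dots> = (\<integral>\<^sup>+s. ?F s * ?in t s \<partial>lborel)"
      proof (rule nn_integral_cong)
        fix s
        have "x + \<delta> * s \<in> (?B t) \<longleftrightarrow> \<delta> * - \<bar>t\<bar> \<le> \<delta> * s \<and> \<delta> * s \<le> \<delta> * \<bar>t\<bar>" by auto
        also have "\<dots> \<longleftrightarrow> \<bar>s\<bar> \<le> \<bar>t\<bar>" using \<delta> by (simp only: mult_le_cancel_left_pos) auto
        finally show "ennreal \<delta> * (?f (x + \<delta> * s) * indicator (?B t) (x + \<delta> * s)) =
           ?F s * ?in t s"
          using \<delta> by (simp add: indicator_def ennreal_mult)
      qed
      finally have le: "ennreal (norm (F x - F (x + \<delta> * t))) \<le> (\<integral>\<^sup>+s. ?F s * ?in t s \<partial>lborel)" .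
      have "ennreal (norm (?J t)) = ennreal (jackson t) * ennreal (norm (F x - F (x + \<delta> * t)))"
        using jackson_nonneg[of t] by (simp add: ennreal_mult[symmetric] flip: scaleR_diff_right)
      also have "\<dots> \<le> ennreal (jackson t) * (\<integral>\<^sup>+s. ?F s * ?in t s \<partial>lborel)"
        by (rule mult_left_mono[OF le]) simp
      also have "\<dots> = (\<integral>\<^sup>+s. ennreal (jackson t) * (?F s * ?in t s) \<partial>lborel)"
        by (rule nn_integral_cmult[symmetric]) measurable
      finally show "ennreal (norm (?J t)) \<le>
         (\<integral>\<^sup>+s. ennreal (jackson t) * (?F s * ?in t s) \<partial>lborel)" .
    qed
    also have "\<dots> = (\<integral>\<^sup>+s. (\<integral>\<^sup>+t. ennreal (jackson t) * (?F s * ?in t s) \<partial>lborel) \<partial>lborel)"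
      by (rule lborel_pair.Fubini') measurable
    also have "\<dots> \<le> (\<integral>\<^sup>+s. ennreal (norm ((\<delta> * B) *\<^sub>R f (x + \<delta> * s)) / (1 + s\<^sup>2)) \<partial>lborel)"
    proof (rule nn_integral_mono)
      fix s
      have "(\<integral>\<^sup>+t. ennreal (jackson t) * (?F s * ?in t s) \<partial>lborel) =
        (\<integral>\<^sup>+t. ?F s * (ennreal (jackson t) * indicator {t. \<bar>s\<bar> \<le> \<bar>t\<bar>} t) \<partial>lborel)"
        by (intro nn_integral_cong) (simp add: indicator_def mult_ac)
      also have "\<dots> = ?F s * (\<integral>\<^sup>+t. ennreal (jackson t) * indicator {t. \<bar>s\<bar> \<le> \<bar>t\<bar>} t \<partial>lborel)"
        by (rule nn_integral_cmult) measurable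
      also have "\<dots> \<le> ?F s * ennreal (B / (1 + s\<^sup>2))"
        by (rule mult_left_mono[OF B(2)]) simp
      also have "\<dots> = ennreal (norm ((\<delta> * B) *\<^sub>R f (x + \<delta> * s)) / (1 + s\<^sup>2))"
        using \<delta> B(1) by (simp add: ennreal_mult[symmetric] mult_ac)
      finally show "(\<integral>\<^sup>+t. ennreal (jackson t) * (?F s * ?in t s) \<partial>lborel) \<le>
         ennreal (norm ((\<delta> * B) *\<^sub>R f (x + \<delta> * s)) / (1 + s\<^sup>2))" .
    qed
    also have "\<dots> = cauchy_avg \<delta> (\<lambda>y. (\<delta> * B) *\<^sub>R f y) x" by (simp add: cauchy_avg_def)
    finally show ?thesis .
  qed
  then show thesis using B(1) by (intro that[of B]) auto
qed

text \<open>The convolution of the Jackson kernel with the Heaviside function, subtracted from the Heaviside function: what \<open>I - A\<close> makes of a jump.\<close>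

definition jackson_tail :: "real \<Rightarrow> real" where
  "jackson_tail v = indicator {0..} v - (LINT t|lborel. jackson t * indicator {..v} t)"

lemma cauchy_kernel_jackson_tail: "cauchy_kernel jackson_tail"
proof -
  obtain B where B: "0 < B"
    "\<And>s. (\<integral>\<^sup>+t. ennreal (jackson t) * indicator {t. \<bar>s\<bar> \<le> \<bar>t\<bar>} t \<partial>lborel) \<le> ennreal (B / (1 + s\<^sup>2))"
    by (rule jackson_tail_bound) (rule that)
  note ij = cauchy_kernel_integrable[OF cauchy_kernel_jackson]
  note [measurable] = cauchy_kernel_measurable[OF cauchy_kernel_jackson]
  have iA: "integrable lborel (\<lambda>t. jackson t * indicator A t)" if "A \<in> sets borel" for A
    using integrable_mult_indicator[OF _ ij, of A] that by (simp add: mult.commute)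
  have small: "(LINT t|lborel. jackson t * indicator A t) \<le> B / (1 + v\<^sup>2)" if A: "A \<in> sets borel" "\<And>t. t \<in> A \<Longrightarrow> \<bar>v\<bar> \<le> \<bar>t\<bar>" for A v
  proof -
    have "ennreal (LINT t|lborel. jackson t * indicator A t) = (\<integral>\<^sup>+t. ennreal (jackson t * indicator A t) \<partial>lborel)"
      by (rule nn_integral_eq_integral[OF iA[OF A(1)], symmetric]) (simp add: jackson_nonneg)
    also have "\<dots> \<le> (\<integral>\<^sup>+t. ennreal (jackson t) * indicator {t. \<bar>v\<bar> \<le> \<bar>t\<bar>} t \<partial>lborel)"
      using A(2) by (intro nn_integral_mono) (auto simp: indicator_def)
    also note B(2)[of v]
    finally show ?thesis using B(1) by (subst (asm) ennreal_le_iff) auto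
  qed
  have nn: "0 \<le> (LINT t|lborel. jackson t * indicator A t)" for A
    by (intro integral_nonneg_AE) (simp add: jackson_nonneg)
  have "\<bar>jackson_tail v\<bar> \<le> B / (1 + v\<^sup>2)" for v
  proof (cases "0 \<le> v")
    case True
    have "1 = (LINT t|lborel. jackson t * indicator {..v} t + jackson t * indicator {v<..} t)"
      unfolding integral_jackson[symmetric] by (intro Bochner_Integration.integral_cong refl) (auto simp: indicator_def)
    also have "\<dots> = (LINT t|lborel. jackson t * indicator {..v} t) + (LINT t|lborel. jackson t * indicator {v<..} t)"
      by (intro Bochner_Integration.integral_add iA) auto
    finally have "jackson_tail v = (LINT t|lborel. jackson t * indicator {v<..} t)" using True by (simp add: jackson_tail_def)
    then show ?thesis using small[of "{v<..}" v] nn[of "{v<..}"] True by auto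
  next
    case False
    then show ?thesis using small[of "{..v}" v] nn[of "{..v}"] by (auto simp: jackson_tail_def)
  qed
  moreover have "jackson_tail \<in> borel_measurable borel"
  proof -
    have "jackson_tail = (\<lambda>v. indicator {0..} v - (LINT t|lborel. jackson t * (if t \<le> v then 1 else 0)))"
      by (simp add: jackson_tail_def indicator_def of_bool_def fun_eq_iff)
    also have "\<dots> \<in> borel_measurable borel" by measurable
    finally show ?thesis .
  qed
  ultimately show ?thesis unfolding cauchy_kernel_def by auto
qed

section \<open>The renewal function of uniform steps\<close>

abbreviation unit_box :: "real \<Rightarrow> real" where "unit_box \<equiv> indicator {0..1}"

text \<open>The densities of the sums of \<open>n + 1\<close> independent uniformly distributed variables, i.e. the kernels of the powers \<open>T ^ (n + 1)\<close>.\<close>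

primrec bspline :: "nat \<Rightarrow> real \<Rightarrow> real" where
  "bspline 0 = unit_box"
| "bspline (Suc n) = kconv unit_box (bspline n)"

definition renewal :: "real \<Rightarrow> real" where
  "renewal v = (\<Sum>n. bspline n v)"

lemma measurable_bspline [measurable]: "bspline n \<in> borel_measurable borel"
  by (induction n) auto

lemma integrable_unit_box_mult:
  fixes h :: "real \<Rightarrow> real"
  assumes [measurable]: "h \<in> borel_measurable borel" and b: "\<And>t. 0 \<le> t \<Longrightarrow> t \<le> 1 \<Longrightarrow> \<bar>h t\<bar> \<le> B"
  shows "integrable lborel (\<lambda>t. unit_box t * h t)"
proof (rule Bochner_Integration.integrable_bound)
  show "integrable lborel (\<lambda>t. B * unit_box t)" by (intro integrable_mult_right integrable_real_indicator) auto
  show "AE t in lborel. norm (unit_box t * h t) \<le> norm (B * unit_box t)"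
  proof (rule AE_I2)
    fix t show "norm (unit_box t * h t) \<le> norm (B * unit_box t)" using b[of t] by (auto simp: indicator_def)
  qed
qed measurable

lemma bspline_bounds: "0 \<le> bspline n v" "bspline n v \<le> 1" "v < 0 \<Longrightarrow> bspline n v = 0"
proof (induction n arbitrary: v)
  case (Suc n)
  have i: "integrable lborel (\<lambda>t. unit_box t * bspline n (v - t))" for v
    by (rule integrable_unit_box_mult[where B=1]) (use Suc in auto)
  {
    case 1 show ?case unfolding bspline.simps kconv_def by (intro integral_nonneg_AE) (use Suc in auto)
  next
    case 2
    have "(LINT t|lborel. unit_box t * bspline n (v - t)) \<le> (LINT t|lborel. unit_box t)"
    proof (rule integral_mono[OF i])
      fix t show "unit_box t * bspline n (v - t) \<le> unit_box t" using Suc(2) by (simp add: indicator_def)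
    qed simp
    then show ?case by (simp add: kconv_def)
  next
    case 3
    then have "(\<lambda>t. unit_box t * bspline n (v - t)) = (\<lambda>t. 0)" using Suc(3) by (auto simp: indicator_def fun_eq_iff)
    then show ?case by (simp add: kconv_def)
  }
qed (auto simp: indicator_def)

text \<open>The crude factorial bound makes the series for \<open>renewal\<close> converge locally uniformly; it says nothing about the behaviour at infinity.\<close>

lemma bspline_le: "bspline n v \<le> \<bar>v\<bar> ^ n / fact n"
proof (cases "v < 0")
  case False
  then have "0 \<le> v" by simp
  then show ?thesis
  proof (induction n arbitrary: v)
    case (Suc n)
    have "bspline (Suc n) v = (LINT s|lborel. unit_box (v - s) * bspline n s)"
      unfolding bspline.simps kconv_def by (subst lborel_integral_real_affine[where c="-1" and t=v]) auto
    also have "\<dots> \<le> (LINT s|lborel. s ^ n * indicator {0..v} s / fact n)"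
    proof (rule integral_mono)
      have "integrable lborel (\<lambda>t. unit_box t * bspline n (v - t))"
        by (rule integrable_unit_box_mult[where B=1]) (use bspline_bounds in auto)
      then show "integrable lborel (\<lambda>s. unit_box (v - s) * bspline n s)"
        by (subst lborel_integrable_real_affine_iff[where c="-1" and t=v, symmetric]) auto
      show "integrable lborel (\<lambda>s. s ^ n * indicator {0..v} s / fact n)"
        by (intro integrable_divide_zero borel_integrable_atLeastAtMost) auto
      fix s
      show "unit_box (v - s) * bspline n s \<le> s ^ n * indicator {0..v} s / fact n"
        using Suc.IH[of s] bspline_bounds(3)[of s n] bspline_bounds(1)[of n s]
        by (cases "s < 0") (auto simp: indicator_def)
    qed
    also have "\<dots> = v ^ Suc n / fact (Suc n)"
      using Suc.prems by (simp add: integral_power field_simps)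
    finally show ?case using Suc.prems by simp
  qed (simp add: indicator_def)
qed (simp add: bspline_bounds)

lemma bspline_summable: "summable (\<lambda>n. bspline n v)"
proof (rule summable_comparison_test')
  show "summable (\<lambda>n. \<bar>v\<bar> ^ n / fact n)" using summable_exp[of "\<bar>v\<bar>"] by (simp add: divide_inverse mult.commute)
  show "norm (bspline n v) \<le> \<bar>v\<bar> ^ n / fact n" if "0 \<le> n" for n
    using bspline_le[of n v] bspline_bounds(1)[of n v] by simp
qed

lemma measurable_renewal [measurable]: "renewal \<in> borel_measurable borel"
  unfolding renewal_def[abs_def] by measurable

lemma renewal_nonneg: "0 \<le> renewal v"
  unfolding renewal_def by (intro suminf_nonneg bspline_summable bspline_bounds)

lemma renewal_neg: "v < 0 \<Longrightarrow> renewal v = 0"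
  unfolding renewal_def by (simp add: bspline_bounds)

lemma renewal_le_exp: "renewal v \<le> exp \<bar>v\<bar>"
proof -
  have "renewal v \<le> (\<Sum>n. \<bar>v\<bar> ^ n / fact n)"
    unfolding renewal_def using summable_exp[of "\<bar>v\<bar>"] bspline_le
    by (intro suminf_le bspline_summable) (auto simp: divide_inverse mult.commute)
  then show ?thesis by (simp add: exp_def divide_inverse mult.commute)
qed

lemma renewal_equation: "renewal v = unit_box v + kconv unit_box renewal v"
proof -
  define c :: "nat \<Rightarrow> real" where "c = (\<lambda>n. (\<bar>v\<bar> + 1) ^ n / fact n)"
  have sc: "summable c" using summable_exp[of "\<bar>v\<bar> + 1"] by (simp add: c_def divide_inverse mult.commute)
  have bc: "bspline n (v - t) \<le> c n" if "0 \<le> t" "t \<le> 1" for n t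
  proof -
    have "\<bar>v - t\<bar> ^ n \<le> (\<bar>v\<bar> + 1) ^ n" using that by (intro power_mono) auto
    then show ?thesis using bspline_le[of n "v - t"] divide_right_mono[of "\<bar>v - t\<bar> ^ n" "(\<bar>v\<bar> + 1) ^ n" "fact n"]
      unfolding c_def by (meson fact_ge_zero order.trans)
  qed
  have i: "integrable lborel (\<lambda>t. unit_box t * bspline n (v - t))" for n
    by (rule integrable_unit_box_mult[where B=1]) (use bspline_bounds in auto)
  have n: "norm (unit_box t * bspline n (v - t)) \<le> c n * unit_box t" for n t
    using bc[of t n] bspline_bounds(1)[of n "v - t"] by (auto simp: indicator_def)
  have "kconv unit_box renewal v = (LINT t|lborel. (\<Sum>n. unit_box t * bspline n (v - t)))"
    unfolding kconv_def renewal_def by (simp add: suminf_mult bspline_summable)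
  also have "\<dots> = (\<Sum>n. LINT t|lborel. unit_box t * bspline n (v - t))"
  proof (rule integral_suminf[OF i])
    show "AE t in lborel. summable (\<lambda>n. norm (unit_box t * bspline n (v - t)))"
      using n by (intro AE_I2 summable_comparison_test'[OF summable_mult2[OF sc]]) auto
    show "summable (\<lambda>n. LINT t|lborel. norm (unit_box t * bspline n (v - t)))"
    proof (rule summable_comparison_test'[OF sc])
      fix m :: nat
      have "(LINT t|lborel. norm (unit_box t * bspline m (v - t))) \<le> (LINT t|lborel. c m * unit_box t)"
        using n by (intro integral_mono integrable_norm i integrable_mult_right integrable_real_indicator) auto
      then show "norm (LINT t|lborel. norm (unit_box t * bspline m (v - t))) \<le> c m"
        by (subst real_norm_def, subst abs_of_nonneg) (auto intro!: integral_nonneg_AE)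
    qed
  qed
  also have "\<dots> = (\<Sum>n. bspline (Suc n) v)" by (simp add: kconv_def)
  finally show ?thesis
    unfolding renewal_def using suminf_split_head[OF bspline_summable[of v]] by simp
qed

text \<open>The threshold \<open>1\<close> is where the inhomogeneous term \<open>unit_box\<close> of the renewal equation vanishes.\<close>

definition moving_average :: "(real \<Rightarrow> real) \<Rightarrow> bool" where
  "moving_average h \<longleftrightarrow> h \<in> borel_measurable borel \<and> (\<forall>c. \<exists>B. \<forall>v. \<bar>v\<bar> \<le> c \<longrightarrow> \<bar>h v\<bar> \<le> B) \<and>
     (\<forall>v>1. h v = (LINT t|lborel. unit_box t * h (v - t)))"

lemma moving_average_uminus: "moving_average h \<Longrightarrow> moving_average (\<lambda>v. - h v)"
  by (auto simp: moving_average_def)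

lemma moving_average_integrable:
  assumes "moving_average h"
  shows "integrable lborel (\<lambda>t. unit_box t * h (v - t))"
proof -
  have [measurable]: "h \<in> borel_measurable borel" using assms by (simp add: moving_average_def)
  obtain B where B: "\<And>x. \<bar>x\<bar> \<le> \<bar>v\<bar> + 1 \<Longrightarrow> \<bar>h x\<bar> \<le> B" using assms unfolding moving_average_def by blast
  show ?thesis by (rule integrable_unit_box_mult[where B=B]) (use B in auto)
qed

lemma moving_average_le:
  assumes h: "moving_average h" and v: "1 < v" and "A \<in> sets borel" "A \<subseteq> {0..1}"
    and le: "\<And>t. 0 \<le> t \<Longrightarrow> t \<le> 1 \<Longrightarrow> h (v - t) \<le> c + d * indicator A t"
  shows "h v \<le> c + d * measure lborel A"
proof -
  have fA: "emeasure lborel A < \<infinity>"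
    using emeasure_mono[OF assms(4), of lborel] by (auto simp: le_less_trans)
  have iA: "integrable lborel (indicator A :: real \<Rightarrow> real)" using assms(3) fA by simp
  have "h v = (LINT t|lborel. unit_box t * h (v - t))" using h v by (simp add: moving_average_def)
  also have "\<dots> \<le> (LINT t|lborel. c * unit_box t + d * indicator A t)"
  proof (rule integral_mono[OF moving_average_integrable[OF h]])
    show "integrable lborel (\<lambda>t. c * unit_box t + d * indicator A t)" using iA by simp
    fix t show "unit_box t * h (v - t) \<le> c * unit_box t + d * indicator A t"
      using le[of t] assms(4) by (auto simp: indicator_def split: if_splits)
  qed
  also have "\<dots> = c + d * measure lborel A" using iA by (subst Bochner_Integration.integral_add) auto
  finally show ?thesis .
qed

text \<open>A window of length \<open>1\<close> that ends at most \<open>1/2\<close> beyond \<open>x + 1\<close> has at least half of its mass where \<open>h \<le> b\<close>. Hence the supremum \<open>S\<close> of \<open>h\<close> over \<open>{x + 1..x + 3/2}\<close> satisfies \<open>S \<le> (b + S) / 2\<close> if it exceeds \<open>b\<close>, which is impossible.\<close>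

lemma moving_average_half_step:
  assumes h: "moving_average h" and x: "0 < x" and le: "\<And>v. x \<le> v \<Longrightarrow> v \<le> x + 1 \<Longrightarrow> h v \<le> b"
    and v: "x + 1 \<le> v" "v \<le> x + 3 / 2"
  shows "h v \<le> b"
proof (rule ccontr)
  assume "\<not> h v \<le> b"
  then have vb: "b < h v" by simp
  define S where "S = Sup (h ` {x + 1..x + 3 / 2})"
  obtain B where B: "\<And>y. \<bar>y\<bar> \<le> x + 2 \<Longrightarrow> \<bar>h y\<bar> \<le> B" using h unfolding moving_average_def by blast
  have bdd: "bdd_above (h ` {x + 1..x + 3 / 2})"
    by (rule bdd_aboveI2[where M=B]) (use B x abs_le_D1 in force)
  have S: "h y \<le> S" if "x + 1 \<le> y" "y \<le> x + 3 / 2" for y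
    unfolding S_def using that by (intro cSUP_upper bdd) auto
  have bS: "b < S" using vb S[OF v] by simp
  have "h y \<le> b + (S - b) * (1 / 2)" if y: "x + 1 \<le> y" "y \<le> x + 3 / 2" for y
  proof -
    have "h y \<le> b + (S - b) * measure lborel {0..y - x - 1}"
    proof (rule moving_average_le[OF h])
      fix t :: real assume t: "0 \<le> t" "t \<le> 1"
      show "h (y - t) \<le> b + (S - b) * indicator {0..y - x - 1} t"
        using S[of "y - t"] le[of "y - t"] t y by (cases "t \<le> y - x - 1") (auto simp: indicator_def)
    qed (use x y in auto)
    also have "\<dots> \<le> b + (S - b) * (1 / 2)" using y bS by (intro add_left_mono mult_left_mono) auto
    finally show ?thesis .
  qed
  then have "S \<le> b + (S - b) * (1 / 2)" unfolding S_def by (intro cSUP_least) auto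
  then show False using bS by (simp add: field_simps)
qed

lemma moving_average_step:
  assumes h: "moving_average h" and x: "0 < x" and le: "\<And>v. x \<le> v \<Longrightarrow> v \<le> x + 1 \<Longrightarrow> h v \<le> b"
    and v: "x + 1 \<le> v" "v \<le> x + 2"
  shows "h v \<le> b"
proof (cases "v \<le> x + 3 / 2")
  case True then show ?thesis using moving_average_half_step[OF h x le] v by simp
next
  case False
  have "h y \<le> b" if "x + 1 / 2 \<le> y" "y \<le> x + 1 / 2 + 1" for y
    using moving_average_half_step[OF h x le, of y] le[of y] that by (cases "y \<le> x + 1") auto
  then show ?thesis using moving_average_half_step[OF h, of "x + 1 / 2" b v] x v False by simp
qed

text \<open>If the mean over \<open>{x..x + 1}\<close> is in the lower half of \<open>{a..b}\<close>, then by continuity \<open>h\<close> stays a quarter of the way below \<open>b\<close> on \<open>{x + 1..x + 5/4}\<close>. Every later window up to \<open>x + 2\<close> contains that interval of length \<open>1/4\<close>, which lowers its mean by \<open>(b - a) / 16\<close>.\<close>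

lemma moving_average_contract:
  assumes h: "moving_average h" and x: "0 < x" and le: "\<And>v. x \<le> v \<Longrightarrow> v \<le> x + 1 \<Longrightarrow> a \<le> h v \<and> h v \<le> b"
    and mean: "h (x + 1) \<le> (a + b) / 2" and v: "x + 1 \<le> v" "v \<le> x + 2"
  shows "h v \<le> b - (b - a) / 16"
proof -
  have ab: "a \<le> b" using le[of x] by simp
  have hb: "h y \<le> b" if "x \<le> y" "y \<le> x + 2" for y
    using moving_average_step[OF h x, of b y] le that by (cases "y \<le> x + 1") auto
  have quarter: "h y \<le> b - (b - a) / 4" if y: "x + 1 \<le> y" "y \<le> x + 5 / 4" for y
  proof -
    define \<theta> where "\<theta> = y - x - 1"
    have \<theta>: "0 \<le> \<theta>" "\<theta> \<le> 1 / 4" using y by (auto simp: \<theta>_def)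
    note i = moving_average_integrable[OF h]
    have shift1: "(LINT t|lborel. unit_box t * h (y' - t)) = (LINT s|lborel. indicator {y' - 1..y'} s * h s)"
      and shift2: "integrable lborel (\<lambda>s. indicator {y' - 1..y'} s * h s)" for y'
    proof -
      have e: "(\<lambda>t. unit_box t * h (y' - t)) = (\<lambda>t. indicator {y' - 1..y'} (y' + (-1) * t) * h (y' + (-1) * t))"
        by (auto simp: indicator_def fun_eq_iff)
      show "(LINT t|lborel. unit_box t * h (y' - t)) = (LINT s|lborel. indicator {y' - 1..y'} s * h s)"
        unfolding e by (subst lborel_integral_real_affine[where c="-1" and t=y']) auto
      show "integrable lborel (\<lambda>s. indicator {y' - 1..y'} s * h s)"
        using i[of y'] unfolding e by (subst (asm) lborel_integrable_real_affine_iff) auto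
    qed
    have win: "h y' = (LINT s|lborel. indicator {y' - 1..y'} s * h s)" if "1 < y'" for y'
      using h that shift1[of y'] by (simp add: moving_average_def)
    have "h y - h (x + 1) = (LINT s|lborel. indicator {y - 1..y} s * h s) - (LINT s|lborel. indicator {x + 1 - 1..x + 1} s * h s)"
      by (rule arg_cong2[where f="(-)", OF win win]) (use x y in auto)
    also have "\<dots> = (LINT s|lborel. indicator {y - 1..y} s * h s - indicator {x + 1 - 1..x + 1} s * h s)"
      by (rule Bochner_Integration.integral_diff[OF shift2 shift2, symmetric])
    also have "\<dots> \<le> (LINT s|lborel. b * indicator {x + 1<..y} s - a * indicator {x..<y - 1} s)"
    proof (rule integral_mono)
      show "integrable lborel (\<lambda>s. indicator {y - 1..y} s * h s - indicator {x + 1 - 1..x + 1} s * h s)"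
        by (intro Bochner_Integration.integrable_diff shift2)
      show "integrable lborel (\<lambda>s. b * indicator {x + 1<..y} s - a * indicator {x..<y - 1} s)"
        using y by (intro Bochner_Integration.integrable_diff integrable_mult_right integrable_real_indicator) auto
      fix s
      show "indicator {y - 1..y} s * h s - indicator {x + 1 - 1..x + 1} s * h s \<le> b * indicator {x + 1<..y} s - a * indicator {x..<y - 1} s"
        using le[of s] hb[of s] y by (auto simp: indicator_def)
    qed
    also have "\<dots> = b * \<theta> - a * \<theta>"
    proof -
      have "integrable lborel (\<lambda>s. b * indicator {x + 1<..y} s)" "integrable lborel (\<lambda>s. a * indicator {x..<y - 1} s)"
        using y by (intro integrable_mult_right integrable_real_indicator; simp)+
      from Bochner_Integration.integral_diff[OF this] show ?thesis using y by (simp add: \<theta>_def algebra_simps)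
    qed
    also have "\<dots> = (b - a) * \<theta>" by (simp add: algebra_simps)
    also have "\<dots> \<le> (b - a) * (1 / 4)" using \<theta> ab by (intro mult_left_mono) auto
    finally show ?thesis using mean by (simp add: field_simps)
  qed
  show ?thesis
  proof (cases "v \<le> x + 5 / 4")
    case True then show ?thesis using quarter[of v] v ab by (simp add: field_simps)
  next
    case False
    have "h v \<le> b + - ((b - a) / 4) * measure lborel {v - x - 5 / 4..v - x - 1}"
    proof (rule moving_average_le[OF h])
      fix t :: real assume t: "0 \<le> t" "t \<le> 1"
      show "h (v - t) \<le> b + - ((b - a) / 4) * indicator {v - x - 5 / 4..v - x - 1} t"
        using quarter[of "v - t"] hb[of "v - t"] t v by (auto simp: indicator_def)
    qed (use x v False in auto)
    then show ?thesis by simp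
  qed
qed

text \<open>Either \<open>h\<close> or \<open>-h\<close> satisfies the hypothesis on the mean in \<open>moving_average_contract\<close>.\<close>

lemma moving_average_oscillation:
  assumes h: "moving_average h" and x: "0 < x" and le: "\<And>v. x \<le> v \<Longrightarrow> v \<le> x + 1 \<Longrightarrow> a \<le> h v \<and> h v \<le> b"
  obtains a' b' where "a \<le> a'" "b' \<le> b" "b' - a' = 15 / 16 * (b - a)"
    "\<And>v. x + 1 \<le> v \<Longrightarrow> v \<le> x + 2 \<Longrightarrow> a' \<le> h v \<and> h v \<le> b'"
proof (cases "h (x + 1) \<le> (a + b) / 2")
  case True
  have "a \<le> h v" if "x + 1 \<le> v" "v \<le> x + 2" for v
    using moving_average_step[OF moving_average_uminus[OF h] x, of "-a" v] le that by simp
  then show thesis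
    using that[of a "b - (b - a) / 16"] moving_average_contract[OF h x le True] le[of x] by (simp add: field_simps)
next
  case False
  have "h v \<le> b" if "x + 1 \<le> v" "v \<le> x + 2" for v
    using moving_average_step[OF h x, of b v] le that by simp
  moreover have "- h v \<le> - a - (- a - - b) / 16" if "x + 1 \<le> v" "v \<le> x + 2" for v
    by (rule moving_average_contract[OF moving_average_uminus[OF h] x]) (use le False that in auto)
  ultimately show thesis
    using that[of "a + (b - a) / 16" b] le[of x] by (force simp: field_simps)
qed

theorem moving_average_converges:
  assumes h: "moving_average h"
  obtains L D where "0 \<le> D" "\<And>n v. real n + 1 \<le> v \<Longrightarrow> v \<le> real n + 2 \<Longrightarrow> \<bar>h v - L\<bar> \<le> D * (15 / 16) ^ n"
proof -
  obtain B where B: "\<And>y. \<bar>y\<bar> \<le> 2 \<Longrightarrow> \<bar>h y\<bar> \<le> B" using h unfolding moving_average_def by blast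
  define P where "P n ab \<longleftrightarrow> snd ab - fst ab = 2 * B * (15 / 16) ^ n \<and>
     (\<forall>v. real n + 1 \<le> v \<longrightarrow> v \<le> real n + 2 \<longrightarrow> fst ab \<le> h v \<and> h v \<le> snd ab)" for n and ab :: "real \<times> real"
  have "\<exists>s. \<forall>n. P n (s n) \<and> (fst (s n) \<le> fst (s (Suc n)) \<and> snd (s (Suc n)) \<le> snd (s n))"
  proof (rule dependent_nat_choice)
    have "- B \<le> h v \<and> h v \<le> B" if "1 \<le> v" "v \<le> 2" for v using B[of v] that by auto
    then show "\<exists>ab. P 0 ab" by (intro exI[of _ "(- B, B)"]) (simp add: P_def)
    fix ab n assume P: "P n ab"
    have hP: "fst ab \<le> h v \<and> h v \<le> snd ab" if "real n + 1 \<le> v" "v \<le> (real n + 1) + 1" for v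
      using P that by (simp add: P_def)
    obtain a' b' where "fst ab \<le> a'" "b' \<le> snd ab" "b' - a' = 15 / 16 * (snd ab - fst ab)"
      "\<And>v. (real n + 1) + 1 \<le> v \<Longrightarrow> v \<le> (real n + 1) + 2 \<Longrightarrow> a' \<le> h v \<and> h v \<le> b'"
      by (rule moving_average_oscillation[OF h, of "real n + 1" "fst ab" "snd ab"]) (simp, erule (1) hP, rule that)
    then show "\<exists>ab'. P (Suc n) ab' \<and> fst ab \<le> fst ab' \<and> snd ab' \<le> snd ab"
      using P by (intro exI[of _ "(a', b')"]) (simp add: P_def algebra_simps)
  qed
  then obtain s where s: "\<And>n. P n (s n)" "\<And>n. fst (s n) \<le> fst (s (Suc n))" "\<And>n. snd (s (Suc n)) \<le> snd (s n)" by blast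
  have inc: "fst (s m) \<le> fst (s n)" "snd (s n) \<le> snd (s m)" if "m \<le> n" for m n
    using lift_Suc_mono_le[of "\<lambda>n. fst (s n)", OF s(2) that] lift_Suc_antimono_le[of "\<lambda>n. snd (s n)", OF s(3) that] by auto
  have fs: "fst (s n) \<le> snd (s n)" for n
    using s(1)[of n] unfolding P_def by (auto dest!: spec[of _ "real n + 1"])
  have cross: "fst (s m) \<le> snd (s n)" for m n
    using inc(1)[of m "max m n"] inc(2)[of n "max m n"] fs[of "max m n"] by simp
  \<comment> \<open>The nested intervals from \<open>fst (s n)\<close> to \<open>snd (s n)\<close> shrink to the point \<open>L\<close>.\<close>
  define L where "L = (SUP n. fst (s n))"
  have bdd: "bdd_above (range (\<lambda>n. fst (s n)))" by (rule bdd_aboveI2[where M="snd (s 0)"]) (rule cross)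
  have L: "fst (s n) \<le> L" "L \<le> snd (s n)" for n
    unfolding L_def by (intro cSUP_upper bdd) (auto intro: cSUP_least cross)
  show thesis
  proof (rule that[of "2 * B" L])
    show "0 \<le> 2 * B" using B[of 0] by simp
    fix n :: nat and v :: real assume "real n + 1 \<le> v" "v \<le> real n + 2"
    then have "fst (s n) \<le> h v \<and> h v \<le> snd (s n)" "snd (s n) - fst (s n) = 2 * B * (15 / 16) ^ n"
      using s(1)[of n] unfolding P_def by blast+
    then show "\<bar>h v - L\<bar> \<le> 2 * B * (15 / 16) ^ n" using L[of n] by linarith
  qed
qed

lemma kconv_bounded_pair:
  assumes k: "cauchy_kernel k" and l: "cauchy_kernel l"
    and [measurable]: "\<phi> \<in> borel_measurable borel" and M: "\<And>v. \<bar>\<phi> v\<bar> \<le> M"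
  shows "integrable (lborel \<Otimes>\<^sub>M lborel) (\<lambda>(t, s). k t * (l s * \<phi> (v - t - s)))"
proof -
  note [measurable] = cauchy_kernel_measurable[OF k] cauchy_kernel_measurable[OF l]
  note ik = cauchy_kernel_integrable[OF k] and il = cauchy_kernel_integrable[OF l]
  have "integrable (lborel \<Otimes>\<^sub>M lborel) (\<lambda>(t, s). k t * l s)"
  proof (rule lborel_pair.Fubini_integrable)
    have "integrable lborel (\<lambda>t. \<bar>k t\<bar> * (LINT s|lborel. \<bar>l s\<bar>))"
      by (intro integrable_mult_left integrable_abs ik)
    then show "integrable lborel (\<lambda>t. LINT s|lborel. norm (case (t, s) of (t, s) \<Rightarrow> k t * l s))"
      by (simp add: abs_mult)
    show "AE t in lborel. integrable lborel (\<lambda>s. case (t, s) of (t, s) \<Rightarrow> k t * l s)"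
      using il by simp
  qed measurable
  then have "integrable (lborel \<Otimes>\<^sub>M lborel) (\<lambda>z. M * (case z of (t, s) \<Rightarrow> k t * l s))"
    by (rule integrable_mult_right)
  then show ?thesis
  proof (rule Bochner_Integration.integrable_bound)
    have "\<bar>k t * (l s * \<phi> (v - t - s))\<bar> \<le> \<bar>M * (k t * l s)\<bar>" for t s
    proof -
      have "0 \<le> M" using M[of 0] by simp
      then show ?thesis using mult_left_mono[OF M[of "v - t - s"], of "\<bar>k t\<bar> * \<bar>l s\<bar>"] by (simp add: abs_mult mult_ac)
    qed
    then show "AE z in lborel \<Otimes>\<^sub>M lborel. norm (case z of (t, s) \<Rightarrow> k t * (l s * \<phi> (v - t - s))) \<le> norm (M * (case z of (t, s) \<Rightarrow> k t * l s))"
      by (intro AE_I2) auto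
  qed measurable
qed

text \<open>The bounded function stands for the renewal function, which is not integrable, so that the composition law for kernels does not apply to it.\<close>

lemma kconv_bounded_commute:
  assumes k: "cauchy_kernel k" and l: "cauchy_kernel l"
    and \<phi>: "\<phi> \<in> borel_measurable borel" and M: "\<And>v. \<bar>\<phi> v\<bar> \<le> M"
  shows "kconv k (kconv l \<phi>) v = kconv l (kconv k \<phi>) v"
proof -
  have "kconv k (kconv l \<phi>) v = (LINT t|lborel. LINT s|lborel. k t * (l s * \<phi> (v - t - s)))"
    by (simp add: kconv_def)
  also have "\<dots> = (LINT s|lborel. LINT t|lborel. k t * (l s * \<phi> (v - t - s)))"
    using lborel_pair.Fubini_integral[of "\<lambda>t s. k t * (l s * \<phi> (v - t - s))"] kconv_bounded_pair[OF assms, of v] by simp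
  also have "\<dots> = (LINT s|lborel. l s * (LINT t|lborel. k t * \<phi> (v - s - t)))"
    by (intro Bochner_Integration.integral_cong refl, subst integral_mult_right_zero[symmetric])
       (auto intro!: Bochner_Integration.integral_cong simp: mult_ac diff_diff_eq add.commute)
  finally show ?thesis by (simp add: kconv_def)
qed

lemma integrable_kernel_bounded:
  fixes \<phi> :: "real \<Rightarrow> real"
  assumes k: "cauchy_kernel k" and [measurable]: "\<phi> \<in> borel_measurable borel" and M: "\<And>v. \<bar>\<phi> v\<bar> \<le> M"
  shows "integrable lborel (\<lambda>t. k t * \<phi> (v - t))"
proof (rule Bochner_Integration.integrable_bound)
  note [measurable] = cauchy_kernel_measurable[OF k]
  show "integrable lborel (\<lambda>t. M * k t)" by (intro integrable_mult_right cauchy_kernel_integrable k)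
  have "0 \<le> M" using M[of 0] by simp
  show "AE t in lborel. norm (k t * \<phi> (v - t)) \<le> norm (M * k t)"
  proof (intro AE_I2)
    fix t
    show "norm (k t * \<phi> (v - t)) \<le> norm (M * k t)"
      using mult_right_mono[OF M[of "v - t"], of "\<bar>k t\<bar>"] \<open>0 \<le> M\<close> by (simp add: abs_mult mult.commute)
  qed
qed (use cauchy_kernel_measurable[OF k] in measurable)

lemma kconv_bounded:
  assumes k: "cauchy_kernel k" and \<phi>: "\<phi> \<in> borel_measurable borel" and M: "\<And>v. \<bar>\<phi> v\<bar> \<le> M"
  shows "\<bar>kconv k \<phi> v\<bar> \<le> M * (LINT t|lborel. \<bar>k t\<bar>)"
proof -
  have "\<bar>kconv k \<phi> v\<bar> \<le> (LINT t|lborel. M * \<bar>k t\<bar>)"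
    unfolding kconv_def real_norm_def[symmetric]
  proof (rule Bochner_Integration.integral_norm_bound_integral[OF integrable_kernel_bounded[OF assms]])
    show "integrable lborel (\<lambda>t. M * norm (k t))" using cauchy_kernel_integrable[OF k] by simp
    fix t show "norm (k t * \<phi> (v - t)) \<le> M * norm (k t)"
      using mult_right_mono[OF M[of "v - t"], of "\<bar>k t\<bar>"] by (simp add: abs_mult mult.commute)
  qed
  then show ?thesis by simp
qed

lemma moving_average_renewal: "moving_average renewal"
  unfolding moving_average_def
proof (intro conjI allI impI)
  fix c :: real
  show "\<exists>B. \<forall>v. \<bar>v\<bar> \<le> c \<longrightarrow> \<bar>renewal v\<bar> \<le> B"
  proof (intro exI[of _ "exp c"] allI impI)
    fix v assume "\<bar>v\<bar> \<le> c"
    then show "\<bar>renewal v\<bar> \<le> exp c"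
      using renewal_le_exp[of v] renewal_nonneg[of v] order.trans[of "renewal v" "exp \<bar>v\<bar>" "exp c"] by simp
  qed
  fix v :: real assume "1 < v"
  then show "renewal v = (LINT t|lborel. unit_box t * renewal (v - t))"
    using renewal_equation[of v] by (simp add: kconv_def)
qed simp

text \<open>The exponential rate of \<open>moving_average_converges\<close> is stated as quadratic decay, which is all that the convolution operators need. On the negative axis the renewal function vanishes, which explains the Heaviside function.\<close>

theorem renewal_decay:
  obtains L where "cauchy_kernel (\<lambda>v. renewal v - L * indicator {0..} v)"
proof -
  obtain L D where D: "0 \<le> D" "\<And>n v. real n + 1 \<le> v \<Longrightarrow> v \<le> real n + 2 \<Longrightarrow> \<bar>renewal v - L\<bar> \<le> D * (15 / 16) ^ n"
    by (rule moving_average_converges[OF moving_average_renewal]) (rule that)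
  have "(\<lambda>n. (1 + (real n + 2)\<^sup>2) * (15 / 16) ^ n) \<longlonglongrightarrow> 0" by real_asymp
  then have "Bseq (\<lambda>n. (1 + (real n + 2)\<^sup>2) * (15 / 16) ^ n)" by (intro convergent_imp_Bseq) (auto simp: convergent_def)
  then obtain K where K: "0 < K" "\<And>n. \<bar>(1 + (real n + 2)\<^sup>2) * (15 / 16) ^ n\<bar> \<le> K" by (auto simp: Bseq_def)
  define C where "C = D * K + (exp 1 + \<bar>L\<bar>) * 2"
  have "\<bar>renewal v - L * indicator {0..} v\<bar> * (1 + v\<^sup>2) \<le> C" for v
  proof -
    consider "v < 0" | "0 \<le> v" "v < 1" | "1 \<le> v" by linarith
    then show ?thesis
    proof cases
      case 1
      then show ?thesis using D(1) K(1) by (simp add: renewal_neg C_def)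
    next
      case 2
      have "exp \<bar>v\<bar> \<le> exp 1" using 2 by simp
      then have "\<bar>renewal v - L\<bar> \<le> exp 1 + \<bar>L\<bar>"
        using renewal_le_exp[of v] renewal_nonneg[of v] by linarith
      moreover have "v\<^sup>2 \<le> 1" using 2 by (simp add: abs_square_le_1)
      ultimately have "\<bar>renewal v - L\<bar> * (1 + v\<^sup>2) \<le> (exp 1 + \<bar>L\<bar>) * 2"
        by (intro mult_mono) auto
      then have "\<bar>renewal v - L\<bar> * (1 + v\<^sup>2) \<le> C"
        unfolding C_def by (rule add_increasing[OF mult_nonneg_nonneg[OF D(1) less_imp_le[OF K(1)]]])
      then show ?thesis using 2 by simp
    next
      case 3
      \<comment> \<open>The unit window with number \<open>n\<close> starts at \<open>n + 1\<close>.\<close>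
      define n where "n = nat \<lfloor>v\<rfloor> - 1"
      have "1 \<le> nat \<lfloor>v\<rfloor>" using 3 by (simp add: le_nat_floor)
      then have "real n + 1 = of_int \<lfloor>v\<rfloor>" using 3 by (simp add: n_def of_nat_diff)
      then have n: "real n + 1 \<le> v" "v \<le> real n + 2" by linarith+
      have "v\<^sup>2 \<le> (real n + 2)\<^sup>2" using n 3 by (intro power_mono) auto
      then have "\<bar>renewal v - L\<bar> * (1 + v\<^sup>2) \<le> (D * (15 / 16) ^ n) * (1 + (real n + 2)\<^sup>2)"
        using D(1) by (intro mult_mono D(2) n) auto
      also have "\<dots> = D * ((1 + (real n + 2)\<^sup>2) * (15 / 16) ^ n)" by (simp only: mult_ac)
      also have "\<dots> \<le> D * K" using K(2)[of n] D(1) by (intro mult_left_mono) auto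
      also have "\<dots> \<le> C" by (simp add: C_def)
      finally show ?thesis using 3 by simp
    qed
  qed
  then have "cauchy_kernel (\<lambda>v. renewal v - L * indicator {0..} v)"
    unfolding cauchy_kernel_def by (auto simp: pos_le_divide_eq intro!: exI[of _ C])
  then show thesis by (rule that)
qed

lemma renewal_bounded: obtains M where "\<And>v. \<bar>renewal v\<bar> \<le> M"
proof -
  obtain L where L: "cauchy_kernel (\<lambda>v. renewal v - L * indicator {0..} v)" by (rule renewal_decay) (rule that)
  obtain B where B: "0 < B" "\<And>t. \<bar>renewal t - L * indicator {0..} t\<bar> \<le> B / (1 + t\<^sup>2)"
    using cauchy_kernelE[OF L] by blast
  have "\<bar>renewal v\<bar> \<le> B + \<bar>L\<bar>" for v
  proof -
    have "B / (1 + v\<^sup>2) \<le> B / 1" using B(1) by (intro divide_left_mono) auto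
    moreover have "\<bar>L * indicator {0..} v\<bar> \<le> \<bar>L\<bar>" by (auto simp: indicator_def)
    ultimately show ?thesis using B(2)[of v] by linarith
  qed
  then show thesis by (rule that)
qed

section \<open>Dividing by the Steklov difference\<close>

text \<open>The kernel of \<open>(I - A) (\<Sum>n. T ^ (n + 1))\<close>, a function that decays although the renewal function does not.\<close>

definition parametrix :: "real \<Rightarrow> real" where
  "parametrix v = renewal v - kconv jackson renewal v"

lemma measurable_jackson [measurable]: "jackson \<in> borel_measurable borel"
  by (rule cauchy_kernel_measurable[OF cauchy_kernel_jackson])

text \<open>Write the renewal function as \<open>L\<close> times the Heaviside function plus a decaying remainder \<open>e\<close>. Then \<open>I - A\<close> turns the first part into \<open>L\<close> times the tail of the Jackson kernel, and \<open>e\<close> into \<open>e - J * e\<close>.\<close>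

theorem cauchy_kernel_parametrix: "cauchy_kernel parametrix"
proof -
  obtain L where L: "cauchy_kernel (\<lambda>v. renewal v - L * indicator {0..} v)" by (rule renewal_decay) (rule that)
  define e where "e v = renewal v - L * indicator {0..} v" for v
  have e: "cauchy_kernel e" using L by (simp add: e_def[abs_def])
  have J: "cauchy_kernel jackson" by (rule cauchy_kernel_jackson)
  have "parametrix v = (e v + (- 1) * kconv jackson e v) + L * jackson_tail v" for v
  proof -
    have i: "integrable lborel (\<lambda>t. jackson t * indicator {0..} (v - t))"
      by (rule integrable_kernel_bounded[OF J, where M=1]) (auto simp: indicator_def)
    have "kconv jackson renewal v = (LINT t|lborel. jackson t * e (v - t) + L * (jackson t * indicator {0..} (v - t)))"
      unfolding kconv_def by (intro Bochner_Integration.integral_cong refl) (simp add: e_def algebra_simps)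
    also have "\<dots> = kconv jackson e v + L * (LINT t|lborel. jackson t * indicator {0..} (v - t))"
      unfolding kconv_def using cauchy_kernel_kconv(2)[OF J e, of v] i by simp
    also have "(\<lambda>t. jackson t * indicator {0..} (v - t)) = (\<lambda>t. jackson t * indicator {..v} t)"
      by (auto simp: indicator_def)
    finally show ?thesis by (simp add: parametrix_def jackson_tail_def e_def[of v] algebra_simps)
  qed
  then have eq: "parametrix = (\<lambda>v. (e v + (- 1) * kconv jackson e v) + L * jackson_tail v)" by blast
  show ?thesis
    unfolding eq
    by (rule cauchy_kernel_add[OF cauchy_kernel_add[OF e cauchy_kernel_cmult[OF cauchy_kernel_kconv(1)[OF J e]]]
          cauchy_kernel_cmult[OF cauchy_kernel_jackson_tail]])
qed

lemma cauchy_kernel_unit_box: "cauchy_kernel unit_box"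
  by (rule cauchy_kernel_indicator)

text \<open>Apply \<open>I - A\<close> to the renewal equation; the two convolutions commute.\<close>

theorem parametrix_equation: "kconv unit_box parametrix v = parametrix v - unit_box v + kconv jackson unit_box v"
proof -
  obtain M where M: "\<And>v. \<bar>renewal v\<bar> \<le> M" by (rule renewal_bounded) (rule that)
  note J = cauchy_kernel_jackson and b = cauchy_kernel_unit_box
  have Ju: "\<bar>kconv jackson renewal w\<bar> \<le> M * (LINT t|lborel. \<bar>jackson t\<bar>)" for w
    by (rule kconv_bounded[OF J _ M]) simp
  have "kconv unit_box parametrix v = (LINT t|lborel. unit_box t * renewal (v - t) - unit_box t * kconv jackson renewal (v - t))"
    unfolding kconv_def[of unit_box] parametrix_def by (simp add: right_diff_distrib)
  also have "\<dots> = kconv unit_box renewal v - kconv unit_box (kconv jackson renewal) v"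
    unfolding kconv_def[of unit_box]
    by (intro Bochner_Integration.integral_diff integrable_kernel_bounded[OF b _ M] integrable_kernel_bounded[OF b _ Ju]) auto
  also have "kconv unit_box (kconv jackson renewal) v = kconv jackson (kconv unit_box renewal) v"
    by (rule kconv_bounded_commute[OF b J _ M]) simp
  also have "kconv unit_box renewal = (\<lambda>v. renewal v - unit_box v)" using renewal_equation by (auto simp: fun_eq_iff)
  also have "kconv jackson (\<lambda>v. renewal v - unit_box v) v = kconv jackson renewal v - kconv jackson unit_box v"
    unfolding kconv_def right_diff_distrib
    by (intro Bochner_Integration.integral_diff integrable_kernel_bounded[OF J _ M] integrable_kernel_bounded[OF J, where M=1]) (auto simp: indicator_def)
  finally show ?thesis by (simp add: parametrix_def[of v])
qed

definition steklov_diff :: "real \<Rightarrow> (real \<Rightarrow> complex) \<Rightarrow> real \<Rightarrow> complex" where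
  "steklov_diff \<delta> g x = g x - cconv \<delta> unit_box g x"

lemma cauchy_integrable_jackson_diff:
  "cauchy_integrable g \<Longrightarrow> \<delta> \<noteq> 0 \<Longrightarrow> cauchy_integrable (jackson_diff \<delta> g)"
  unfolding jackson_diff_def[abs_def] by (intro cauchy_integrable_diff cauchy_integrable_cconv cauchy_kernel_jackson)

lemma cauchy_integrable_steklov_diff:
  "cauchy_integrable g \<Longrightarrow> \<delta> \<noteq> 0 \<Longrightarrow> cauchy_integrable (steklov_diff \<delta> g)"
  unfolding steklov_diff_def[abs_def] by (intro cauchy_integrable_diff cauchy_integrable_cconv cauchy_kernel_unit_box)

lemma jackson_steklov_commute:
  assumes g: "cauchy_integrable g" and \<delta>: "\<delta> \<noteq> 0"
  shows "jackson_diff \<delta> (steklov_diff \<delta> g) = steklov_diff \<delta> (jackson_diff \<delta> g)"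
proof
  fix x
  note J = cauchy_kernel_jackson and b = cauchy_kernel_unit_box
  have 1: "cconv \<delta> jackson (\<lambda>x. g x - cconv \<delta> unit_box g x) x = cconv \<delta> jackson g x - cconv \<delta> jackson (cconv \<delta> unit_box g) x"
    by (rule cconv_diff[OF J g cauchy_integrable_cconv[OF b g \<delta>] \<delta>])
  have 2: "cconv \<delta> unit_box (\<lambda>x. g x - cconv \<delta> jackson g x) x = cconv \<delta> unit_box g x - cconv \<delta> unit_box (cconv \<delta> jackson g) x"
    by (rule cconv_diff[OF b g cauchy_integrable_cconv[OF J g \<delta>] \<delta>])
  show "jackson_diff \<delta> (steklov_diff \<delta> g) x = steklov_diff \<delta> (jackson_diff \<delta> g) x"
    unfolding jackson_diff_def[abs_def] steklov_diff_def[abs_def] 1 2 cconv_commute[OF J b g \<delta>] by simp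
qed

text \<open>Convolving \<open>(I - T) g\<close> with the parametrix gives \<open>T g - A (T g)\<close> by \<open>parametrix_equation\<close>, and \<open>g - A g\<close> differs from this by \<open>(I - A) (g - T g)\<close>.\<close>

theorem jackson_diff_parametrix:
  assumes g: "cauchy_integrable g" and \<delta>: "\<delta> \<noteq> 0"
  shows "jackson_diff \<delta> g x = jackson_diff \<delta> (steklov_diff \<delta> g) x + cconv \<delta> parametrix (steklov_diff \<delta> g) x"
proof -
  note J = cauchy_kernel_jackson and b = cauchy_kernel_unit_box and m = cauchy_kernel_parametrix
  note Tg = cauchy_integrable_cconv[OF b g \<delta>]
  have "cconv \<delta> parametrix (cconv \<delta> unit_box g) x = cconv \<delta> (kconv unit_box parametrix) g x"
    unfolding cconv_commute[OF m b g \<delta>] cconv_kconv[OF b m g \<delta>] ..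
  also have "\<dots> = (LINT t|lborel. (parametrix t *\<^sub>R g (x + \<delta> * t) - unit_box t *\<^sub>R g (x + \<delta> * t)) + kconv jackson unit_box t *\<^sub>R g (x + \<delta> * t))"
    unfolding cconv_def parametrix_equation scaleR_add_left scaleR_diff_left ..
  also have "\<dots> = (cconv \<delta> parametrix g x - cconv \<delta> unit_box g x) + cconv \<delta> (kconv jackson unit_box) g x"
    unfolding cconv_def using integrable_cconv[OF m g \<delta>, of x] integrable_cconv[OF b g \<delta>, of x]
      integrable_cconv[OF cauchy_kernel_kconv(1)[OF J b] g \<delta>, of x]
    by (simp only: Bochner_Integration.integral_add Bochner_Integration.integral_diff Bochner_Integration.integrable_diff)
  also have "cconv \<delta> (kconv jackson unit_box) g x = cconv \<delta> jackson (cconv \<delta> unit_box g) x"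
    unfolding cconv_kconv[OF J b g \<delta>] ..
  finally have e: "cconv \<delta> parametrix (cconv \<delta> unit_box g) x =
    cconv \<delta> parametrix g x - cconv \<delta> unit_box g x + cconv \<delta> jackson (cconv \<delta> unit_box g) x" .
  show ?thesis
    unfolding jackson_diff_def steklov_diff_def[abs_def] cconv_diff[OF m g Tg \<delta>] cconv_diff[OF J g Tg \<delta>] e by simp
qed

section \<open>Norm estimates for Jackson differences\<close>

lemma norm_var_scale_le:
  assumes "p \<in> exponents" "0 < c"
  shows "norm_var p (\<lambda>x. c *\<^sub>R g x) \<le> ennreal c * norm_var p g"
  using assms by (intro norm_var_mono_AE) auto

lemma norm_var_diff_le:
  assumes p: "p \<in> exponents" and f: "f \<in> borel_measurable lebesgue" and g: "g \<in> borel_measurable lebesgue"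
  shows "norm_var p (\<lambda>x. f x - g x) \<le> norm_var p f + norm_var p g"
proof -
  have "norm_var p (\<lambda>x. f x - g x) = norm_var p (\<lambda>x. f x + (- g x))" by simp
  also have "\<dots> \<le> norm_var p f + norm_var p (\<lambda>x. - g x)"
    by (intro norm_var_add_le p f borel_measurable_uminus g)
  also have "norm_var p (\<lambda>x. - g x) \<le> ennreal 1 * norm_var p g"
    using p by (intro norm_var_mono_AE) auto
  finally show ?thesis by simp
qed

lemma borel_lebesgue: "f \<in> borel_measurable borel \<Longrightarrow> f \<in> borel_measurable lebesgue"
  by (rule measurable_completion) simp

lemma cauchy_integrable_lebesgue: "cauchy_integrable g \<Longrightarrow> g \<in> borel_measurable lebesgue"
  by (intro borel_lebesgue cauchy_integrable_measurable)

lemma norm_cconv_bound: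
  assumes p: "p \<in> log_exponents" and k: "cauchy_kernel k"
  obtains C where "0 < C" "\<And>\<delta> g. 0 < \<delta> \<Longrightarrow> cauchy_integrable g \<Longrightarrow> norm_var p (cconv \<delta> k g) \<le> ennreal C * norm_var p g"
proof -
  have pe: "p \<in> exponents" using p by (simp add: log_exponents_def)
  obtain B where B: "0 < B" "\<And>t. \<bar>k t\<bar> \<le> B / (1 + t\<^sup>2)" "k \<in> borel_measurable borel"
    by (rule cauchy_kernelE[OF k]) (rule that)
  obtain K where K: "0 < K" "\<forall>\<delta>>0. \<forall>g f. g \<in> borel_measurable borel \<longrightarrow>
     (\<forall>x. ennreal (norm (f x)) \<le> cauchy_avg \<delta> g x) \<longrightarrow> norm_var p f \<le> ennreal K * norm_var p g"
    using cauchy_avg_bounded[OF p] by (elim exE conjE)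
  have "norm_var p (cconv \<delta> k g) \<le> ennreal (K * B) * norm_var p g"
    if \<delta>: "0 < \<delta>" and g: "cauchy_integrable g" for \<delta> g
  proof -
    note [measurable] = cauchy_integrable_measurable[OF g]
    have "norm_var p (cconv \<delta> k g) \<le> ennreal K * norm_var p (\<lambda>y. B *\<^sub>R g y)"
      by (rule K(2)[rule_format, OF \<delta>]) (measurable, rule norm_cconv_le[OF k B(2) _ g], use B \<delta> in auto)
    also have "\<dots> \<le> ennreal K * (ennreal B * norm_var p g)"
      by (intro mult_left_mono norm_var_scale_le pe B) simp
    finally show ?thesis using K(1) B(1) by (simp add: ennreal_mult mult.assoc)
  qed
  then show thesis using K(1) B(1) by (intro that[of "K * B"]) auto
qed

lemma norm_jackson_diff_le:
  assumes p: "p \<in> log_exponents"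
  obtains C where "1 \<le> C" "\<And>\<delta> g. 0 < \<delta> \<Longrightarrow> cauchy_integrable g \<Longrightarrow> norm_var p (jackson_diff \<delta> g) \<le> ennreal C * norm_var p g"
proof -
  have pe: "p \<in> exponents" using p by (simp add: log_exponents_def)
  obtain C where C: "0 < C" "\<And>\<delta> g. 0 < \<delta> \<Longrightarrow> cauchy_integrable g \<Longrightarrow> norm_var p (cconv \<delta> jackson g) \<le> ennreal C * norm_var p g"
    by (rule norm_cconv_bound[OF p cauchy_kernel_jackson]) (rule that)
  have "norm_var p (jackson_diff \<delta> g) \<le> ennreal (1 + C) * norm_var p g"
    if \<delta>: "0 < \<delta>" and g: "cauchy_integrable g" for \<delta> g
  proof -
    have "cauchy_integrable (cconv \<delta> jackson g)"
      by (rule cauchy_integrable_cconv[OF cauchy_kernel_jackson g]) (use \<delta> in simp)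
    then have "norm_var p (jackson_diff \<delta> g) \<le> norm_var p g + norm_var p (cconv \<delta> jackson g)"
      unfolding jackson_diff_def[abs_def] using g by (intro norm_var_diff_le pe cauchy_integrable_lebesgue)
    also have "\<dots> \<le> 1 * norm_var p g + ennreal C * norm_var p g" using C(2)[OF \<delta> g] by (simp add: add_left_mono)
    also have "\<dots> = ennreal (1 + C) * norm_var p g"
      using C(1) by (subst distrib_right[symmetric]) simp
    finally show ?thesis .
  qed
  then show thesis using C(1) by (intro that[of "1 + C"]) auto
qed

theorem norm_jackson_diff_le_derivative:
  assumes p: "p \<in> log_exponents"
  obtains C where "0 < C" "\<And>\<delta> F f. 0 < \<delta> \<Longrightarrow> cauchy_integrable F \<Longrightarrow> cauchy_integrable f \<Longrightarrow> antiderivative F f \<Longrightarrow>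
     norm_var p (jackson_diff \<delta> F) \<le> ennreal (C * \<delta>) * norm_var p f"
proof -
  have pe: "p \<in> exponents" using p by (simp add: log_exponents_def)
  obtain B where B: "0 < B" "\<And>\<delta> F f x. 0 < \<delta> \<Longrightarrow> cauchy_integrable F \<Longrightarrow> cauchy_integrable f \<Longrightarrow> antiderivative F f \<Longrightarrow>
    ennreal (norm (jackson_diff \<delta> F x)) \<le> cauchy_avg \<delta> (\<lambda>y. (\<delta> * B) *\<^sub>R f y) x"
    by (rule jackson_diff_le_derivative) (rule that)
  obtain K where K: "0 < K" "\<forall>\<delta>>0. \<forall>g f. g \<in> borel_measurable borel \<longrightarrow>
     (\<forall>x. ennreal (norm (f x)) \<le> cauchy_avg \<delta> g x) \<longrightarrow> norm_var p f \<le> ennreal K * norm_var p g"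
    using cauchy_avg_bounded[OF p] by (elim exE conjE)
  have "norm_var p (jackson_diff \<delta> F) \<le> ennreal (K * B * \<delta>) * norm_var p f"
    if \<delta>: "0 < \<delta>" and F: "cauchy_integrable F" and f: "cauchy_integrable f" and ad: "antiderivative F f" for \<delta> F f
  proof -
    note [measurable] = cauchy_integrable_measurable[OF f]
    have "norm_var p (jackson_diff \<delta> F) \<le> ennreal K * norm_var p (\<lambda>y. (\<delta> * B) *\<^sub>R f y)"
      by (rule K(2)[rule_format, OF \<delta>]) (measurable, rule B(2)[OF that])
    also have "\<dots> \<le> ennreal K * (ennreal (\<delta> * B) * norm_var p f)"
      using \<delta> B(1) by (intro mult_left_mono norm_var_scale_le pe) auto
    also have "\<dots> = ennreal (K * B * \<delta>) * norm_var p f"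
    proof -
      have "ennreal (K * B * \<delta>) = ennreal K * ennreal (\<delta> * B)"
        using K(1) B(1) \<delta> by (subst ennreal_mult[symmetric]) (auto simp: mult.assoc mult.commute[of \<delta>])
      then show ?thesis by (simp only: mult.assoc)
    qed
    finally show ?thesis .
  qed
  then show thesis using K(1) B(1) by (intro that[of "K * B"]) auto
qed

theorem norm_jackson_diff_le_steklov_diff:
  assumes p: "p \<in> log_exponents"
  obtains C where "0 < C" "\<And>\<delta> g. 0 < \<delta> \<Longrightarrow> cauchy_integrable g \<Longrightarrow>
     norm_var p (jackson_diff \<delta> g) \<le> ennreal C * norm_var p (steklov_diff \<delta> g)"
proof -
  have pe: "p \<in> exponents" using p by (simp add: log_exponents_def)
  obtain C where C: "1 \<le> C" "\<And>\<delta> g. 0 < \<delta> \<Longrightarrow> cauchy_integrable g \<Longrightarrow> norm_var p (jackson_diff \<delta> g) \<le> ennreal C * norm_var p g"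
    by (rule norm_jackson_diff_le[OF p]) (rule that)
  obtain D where D: "0 < D" "\<And>\<delta> g. 0 < \<delta> \<Longrightarrow> cauchy_integrable g \<Longrightarrow> norm_var p (cconv \<delta> parametrix g) \<le> ennreal D * norm_var p g"
    by (rule norm_cconv_bound[OF p cauchy_kernel_parametrix]) (rule that)
  have "norm_var p (jackson_diff \<delta> g) \<le> ennreal (C + D) * norm_var p (steklov_diff \<delta> g)"
    if \<delta>: "0 < \<delta>" and g: "cauchy_integrable g" for \<delta> g
  proof -
    have d0: "\<delta> \<noteq> 0" using \<delta> by simp
    note S = cauchy_integrable_steklov_diff[OF g d0]
    have "jackson_diff \<delta> g = (\<lambda>x. jackson_diff \<delta> (steklov_diff \<delta> g) x + cconv \<delta> parametrix (steklov_diff \<delta> g) x)"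
      by (rule ext) (rule jackson_diff_parametrix[OF g d0])
    then have "norm_var p (jackson_diff \<delta> g) = norm_var p (\<lambda>x. jackson_diff \<delta> (steklov_diff \<delta> g) x + cconv \<delta> parametrix (steklov_diff \<delta> g) x)"
      by (rule arg_cong)
    also have "\<dots> \<le> norm_var p (jackson_diff \<delta> (steklov_diff \<delta> g)) + norm_var p (cconv \<delta> parametrix (steklov_diff \<delta> g))"
      by (intro norm_var_add_le pe cauchy_integrable_lebesgue cauchy_integrable_jackson_diff cauchy_integrable_cconv cauchy_kernel_parametrix S d0)
    also have "\<dots> \<le> ennreal C * norm_var p (steklov_diff \<delta> g) + ennreal D * norm_var p (steklov_diff \<delta> g)"
      by (intro add_mono C(2) D(2) \<delta> S)
    also have "\<dots> = ennreal (C + D) * norm_var p (steklov_diff \<delta> g)"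
      using C(1) D(1) by (subst distrib_right[symmetric]) simp
    finally show ?thesis .
  qed
  then show thesis using C(1) D(1) by (intro that[of "C + D"]) auto
qed

lemma cauchy_integrable_jackson_diff_funpow:
  assumes "cauchy_integrable g" "\<delta> \<noteq> 0"
  shows "cauchy_integrable ((jackson_diff \<delta> ^^ n) g)"
  by (induction n) (use assms in \<open>auto intro: cauchy_integrable_jackson_diff\<close>)

lemma cauchy_integrable_steklov_diff_funpow:
  assumes "cauchy_integrable g" "\<delta> \<noteq> 0"
  shows "cauchy_integrable ((steklov_diff \<delta> ^^ n) g)"
  by (induction n) (use assms in \<open>auto intro: cauchy_integrable_steklov_diff\<close>)

lemma jackson_steklov_funpow_commute:
  assumes g: "cauchy_integrable g" and \<delta>: "\<delta> \<noteq> 0"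
  shows "(steklov_diff \<delta> ^^ n) (jackson_diff \<delta> g) = jackson_diff \<delta> ((steklov_diff \<delta> ^^ n) g)"
proof (induction n)
  case (Suc n)
  then show ?case
    using jackson_steklov_commute[OF cauchy_integrable_steklov_diff_funpow[OF g \<delta>, of n] \<delta>] by simp
qed simp

lemma norm_jackson_diff_funpow_le:
  assumes C: "0 < C" "\<And>g. cauchy_integrable g \<Longrightarrow> norm_var p (jackson_diff \<delta> g) \<le> ennreal C * norm_var p g"
    and g: "cauchy_integrable g" and \<delta>: "\<delta> \<noteq> 0"
  shows "norm_var p ((jackson_diff \<delta> ^^ n) g) \<le> ennreal (C ^ n) * norm_var p g"
proof (induction n)
  case (Suc n)
  have "norm_var p ((jackson_diff \<delta> ^^ Suc n) g) \<le> ennreal C * norm_var p ((jackson_diff \<delta> ^^ n) g)"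
    using C(2)[OF cauchy_integrable_jackson_diff_funpow[OF g \<delta>, of n]] by simp
  also have "\<dots> \<le> ennreal C * (ennreal (C ^ n) * norm_var p g)" by (intro mult_left_mono Suc) simp
  also have "\<dots> = ennreal (C ^ Suc n) * norm_var p g" using C(1) by (simp add: ennreal_mult mult.assoc)
  finally show ?case .
qed simp

lemma norm_jackson_diff_funpow_le_steklov:
  assumes C: "0 < C" "\<And>g. cauchy_integrable g \<Longrightarrow> norm_var p (jackson_diff \<delta> g) \<le> ennreal C * norm_var p (steklov_diff \<delta> g)"
    and g: "cauchy_integrable g" and \<delta>: "\<delta> \<noteq> 0"
  shows "norm_var p ((jackson_diff \<delta> ^^ n) g) \<le> ennreal (C ^ n) * norm_var p ((steklov_diff \<delta> ^^ n) g)"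
  using g
proof (induction n arbitrary: g)
  case (Suc n)
  have "norm_var p ((jackson_diff \<delta> ^^ Suc n) g) = norm_var p ((jackson_diff \<delta> ^^ n) (jackson_diff \<delta> g))"
    by (simp only: funpow_Suc_right o_apply)
  also have "\<dots> \<le> ennreal (C ^ n) * norm_var p ((steklov_diff \<delta> ^^ n) (jackson_diff \<delta> g))"
    by (rule Suc.IH[OF cauchy_integrable_jackson_diff[OF Suc.prems \<delta>]])
  also have "\<dots> = ennreal (C ^ n) * norm_var p (jackson_diff \<delta> ((steklov_diff \<delta> ^^ n) g))"
    by (simp only: jackson_steklov_funpow_commute[OF Suc.prems \<delta>])
  also have "\<dots> \<le> ennreal (C ^ n) * (ennreal C * norm_var p (steklov_diff \<delta> ((steklov_diff \<delta> ^^ n) g)))"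
    by (intro mult_left_mono C(2) cauchy_integrable_steklov_diff_funpow Suc.prems \<delta>) simp
  also have "\<dots> = ennreal (C ^ Suc n) * norm_var p ((steklov_diff \<delta> ^^ Suc n) g)"
    using C(1) by (simp add: ennreal_mult mult_ac)
  finally show ?case .
qed simp

lemma antiderivative_jackson_diff_funpow:
  assumes F: "cauchy_integrable F" and f: "cauchy_integrable f" and ad: "antiderivative F f" and \<delta>: "\<delta> \<noteq> 0"
  shows "antiderivative ((jackson_diff \<delta> ^^ n) F) ((jackson_diff \<delta> ^^ n) f)"
proof (induction n)
  case (Suc n)
  note Fn = cauchy_integrable_jackson_diff_funpow[OF F \<delta>, of n] and fn = cauchy_integrable_jackson_diff_funpow[OF f \<delta>, of n]
  show ?case
    using antiderivative_diff[OF Suc antiderivative_cconv[OF cauchy_kernel_jackson Fn fn Suc \<delta>] fn cauchy_integrable_cconv[OF cauchy_kernel_jackson fn \<delta>]]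
    by (simp add: jackson_diff_def[abs_def])
qed (use ad in simp)

text \<open>Each application of the hypothesis trades one factor \<open>I - A\<close> for one derivative.\<close>

lemma norm_jackson_diff_funpow_le_derivative:
  assumes C: "0 < C" "\<And>F f. cauchy_integrable F \<Longrightarrow> cauchy_integrable f \<Longrightarrow> antiderivative F f \<Longrightarrow>
      norm_var p (jackson_diff \<delta> F) \<le> ennreal C * norm_var p f"
    and h: "\<And>j. j \<le> r \<Longrightarrow> cauchy_integrable (h j)" "\<And>j. j < r \<Longrightarrow> antiderivative (h j) (h (Suc j))" and \<delta>: "\<delta> \<noteq> 0"
  shows "k + m = r \<Longrightarrow> norm_var p ((jackson_diff \<delta> ^^ (n + m)) (h k)) \<le> ennreal (C ^ m) * norm_var p ((jackson_diff \<delta> ^^ n) (h r))"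
proof (induction m arbitrary: k)
  case (Suc m)
  have "norm_var p ((jackson_diff \<delta> ^^ (n + Suc m)) (h k)) = norm_var p (jackson_diff \<delta> ((jackson_diff \<delta> ^^ (n + m)) (h k)))" by simp
  also have "\<dots> \<le> ennreal C * norm_var p ((jackson_diff \<delta> ^^ (n + m)) (h (Suc k)))"
    using Suc.prems by (intro C(2) cauchy_integrable_jackson_diff_funpow antiderivative_jackson_diff_funpow h \<delta>) auto
  also have "\<dots> \<le> ennreal C * (ennreal (C ^ m) * norm_var p ((jackson_diff \<delta> ^^ n) (h r)))"
    using Suc.prems by (intro mult_left_mono Suc.IH) auto
  also have "\<dots> = ennreal (C ^ Suc m) * norm_var p ((jackson_diff \<delta> ^^ n) (h r))"
    using C(1) by (simp add: ennreal_mult mult.assoc)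
  finally show ?case .
qed simp

text \<open>The double negation makes each summand a difference, the form in which linearity of \<open>cconv\<close> and of \<open>antiderivative\<close> is stated.\<close>

primrec jackson_sum :: "real \<Rightarrow> nat \<Rightarrow> (real \<Rightarrow> complex) \<Rightarrow> real \<Rightarrow> complex" where
  "jackson_sum \<delta> 0 g x = 0"
| "jackson_sum \<delta> (Suc n) g x = jackson_sum \<delta> n g x - (- ((jackson_diff \<delta> ^^ n) g x))"

lemma cauchy_integrable_jackson_sum:
  assumes "cauchy_integrable g" "\<delta> \<noteq> 0"
  shows "cauchy_integrable (jackson_sum \<delta> n g)"
proof (induction n)
  case 0 show ?case by (simp add: cauchy_integrable_def jackson_sum.simps(1)[abs_def])
next
  case (Suc n)
  show ?case unfolding jackson_sum.simps(2)[abs_def]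
    by (intro cauchy_integrable_diff Suc cauchy_integrable_uminus cauchy_integrable_jackson_diff_funpow assms)
qed

lemma antiderivative_uminus: "antiderivative F f \<Longrightarrow> antiderivative (\<lambda>x. - F x) (\<lambda>x. - f x)"
  unfolding antiderivative_def
proof (intro allI impI)
  fix a b :: real assume "\<forall>a b. a \<le> b \<longrightarrow> F b - F a = (LINT t:{a..b}|lborel. f t)" "a \<le> b"
  then have "F b - F a = (LINT t:{a..b}|lborel. f t)" by blast
  then have "- F b - - F a = - (LINT t:{a..b}|lborel. f t)" by (metis minus_diff_eq minus_diff_minus)
  then show "- F b - - F a = (LINT t:{a..b}|lborel. - f t)" by (simp add: set_lebesgue_integral_def)
qed

lemma antiderivative_jackson_sum:
  assumes F: "cauchy_integrable F" and f: "cauchy_integrable f" and ad: "antiderivative F f" and \<delta>: "\<delta> \<noteq> 0"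
  shows "antiderivative (jackson_sum \<delta> n F) (jackson_sum \<delta> n f)"
proof (induction n)
  case 0 show ?case by (simp add: antiderivative_def set_lebesgue_integral_def)
next
  case (Suc n)
  show ?case unfolding jackson_sum.simps(2)[abs_def]
    by (intro antiderivative_diff antiderivative_uminus Suc antiderivative_jackson_diff_funpow
        cauchy_integrable_uminus cauchy_integrable_jackson_sum cauchy_integrable_jackson_diff_funpow assms)
qed

text \<open>The sum telescopes, since \<open>A = I - (I - A)\<close>.\<close>

lemma cconv_jackson_sum:
  assumes g: "cauchy_integrable g" and \<delta>: "\<delta> \<noteq> 0"
  shows "cconv \<delta> jackson (jackson_sum \<delta> n g) x = g x - (jackson_diff \<delta> ^^ n) g x"
proof (induction n)
  case 0 show ?case by (simp add: cconv_def)
next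
  case (Suc n)
  note J = cauchy_kernel_jackson
  have u: "cconv \<delta> jackson (\<lambda>x. - ((jackson_diff \<delta> ^^ n) g x)) x = - cconv \<delta> jackson ((jackson_diff \<delta> ^^ n) g) x"
    by (simp add: cconv_def)
  have "cconv \<delta> jackson (jackson_sum \<delta> (Suc n) g) x = cconv \<delta> jackson (jackson_sum \<delta> n g) x - cconv \<delta> jackson (\<lambda>x. - ((jackson_diff \<delta> ^^ n) g x)) x"
    unfolding jackson_sum.simps(2)[abs_def]
    by (intro cconv_diff J cauchy_integrable_uminus cauchy_integrable_jackson_sum cauchy_integrable_jackson_diff_funpow g \<delta>)
  also have "\<dots> = g x - (jackson_diff \<delta> ^^ n) g x + cconv \<delta> jackson ((jackson_diff \<delta> ^^ n) g) x"
    unfolding u Suc by simp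
  finally show ?case
    unfolding funpow.simps o_apply jackson_diff_def[of \<delta> "(jackson_diff \<delta> ^^ n) g" x] by (simp only: diff_diff_eq2 diff_add_eq add.commute)
qed

section \<open>Intermediate derivatives\<close>

text \<open>The intermediate derivatives are not yet known to be integrable against any weight, so that unit means of them are formed on the strength of local boundedness.\<close>

definition locally_bounded :: "(real \<Rightarrow> complex) \<Rightarrow> bool" where
  "locally_bounded g \<longleftrightarrow> g \<in> borel_measurable borel \<and> (\<forall>c. \<exists>B. \<forall>v. \<bar>v\<bar> \<le> c \<longrightarrow> norm (g v) \<le> B)"

lemma locally_bounded_continuous:
  assumes "continuous_on UNIV g"
  shows "locally_bounded g"
  unfolding locally_bounded_def
proof (intro conjI allI)
  show "g \<in> borel_measurable borel" by (rule borel_measurable_continuous_onI[OF assms])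
  fix c :: real
  have "bounded (g ` {-c..c})"
    by (intro compact_imp_bounded compact_continuous_image continuous_on_subset[OF assms]) auto
  then obtain B where "\<And>v. v \<in> {-c..c} \<Longrightarrow> norm (g v) \<le> B" unfolding bounded_iff by blast
  then show "\<exists>B. \<forall>v. \<bar>v\<bar> \<le> c \<longrightarrow> norm (g v) \<le> B" by (intro exI[of _ B]) (auto simp: abs_le_iff)
qed

lemma locally_bounded_integrable:
  assumes "locally_bounded g"
  shows "integrable lborel (\<lambda>t. unit_box t *\<^sub>R g (x + 1 * t))"
proof -
  have [measurable]: "g \<in> borel_measurable borel" using assms by (simp add: locally_bounded_def)
  obtain B where B: "\<And>v. \<bar>v\<bar> \<le> \<bar>x\<bar> + 1 \<Longrightarrow> norm (g v) \<le> B" using assms unfolding locally_bounded_def by blast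
  show ?thesis
  proof (rule Bochner_Integration.integrable_bound)
    show "integrable lborel (\<lambda>t. B * unit_box t)" by (intro integrable_mult_right integrable_real_indicator) auto
    show "AE t in lborel. norm (unit_box t *\<^sub>R g (x + 1 * t)) \<le> norm (B * unit_box t)"
    proof (rule AE_I2)
      fix t
      have "norm (g (x + t)) \<le> \<bar>B\<bar>" if "0 \<le> t" "t \<le> 1"
        using B[of "x + t"] that abs_triangle_ineq[of x t] abs_ge_self[of B] by linarith
      then show "norm (unit_box t *\<^sub>R g (x + 1 * t)) \<le> norm (B * unit_box t)" by (auto simp: indicator_def)
    qed
  qed measurable
qed

abbreviation mean1 :: "(real \<Rightarrow> complex) \<Rightarrow> real \<Rightarrow> complex" where "mean1 \<equiv> cconv 1 unit_box"

definition step1 :: "(real \<Rightarrow> complex) \<Rightarrow> real \<Rightarrow> complex" where "step1 g x = g (x + 1) - g x"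

lemma locally_bounded_mean1:
  assumes "locally_bounded g"
  shows "locally_bounded (mean1 g)"
  unfolding locally_bounded_def
proof (intro conjI allI)
  have [measurable]: "g \<in> borel_measurable borel" using assms by (simp add: locally_bounded_def)
  show "mean1 g \<in> borel_measurable borel" by measurable
  fix c :: real
  obtain B where B: "\<And>v. \<bar>v\<bar> \<le> \<bar>c\<bar> + 1 \<Longrightarrow> norm (g v) \<le> B" using assms unfolding locally_bounded_def by blast
  have "norm (mean1 g v) \<le> B" if "\<bar>v\<bar> \<le> c" for v
  proof -
    have "norm (mean1 g v) \<le> (LINT t|lborel. B * unit_box t)"
      unfolding cconv_def
    proof (rule Bochner_Integration.integral_norm_bound_integral[OF locally_bounded_integrable[OF assms]])
      show "integrable lborel (\<lambda>t. B * unit_box t)" by (intro integrable_mult_right integrable_real_indicator) auto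
      fix t show "norm (unit_box t *\<^sub>R g (v + 1 * t)) \<le> B * unit_box t"
        using B[of "v + t"] that by (auto simp: indicator_def)
    qed
    then show ?thesis by simp
  qed
  then show "\<exists>B. \<forall>v. \<bar>v\<bar> \<le> c \<longrightarrow> norm (mean1 g v) \<le> B" by blast
qed

lemma mean1_diff:
  assumes "locally_bounded f" "locally_bounded g"
  shows "mean1 (\<lambda>x. f x - g x) = (\<lambda>x. mean1 f x - mean1 g x)"
  unfolding cconv_def scaleR_diff_right
  by (intro ext Bochner_Integration.integral_diff locally_bounded_integrable assms)

lemma locally_bounded_mean1_funpow: "locally_bounded g \<Longrightarrow> locally_bounded ((mean1 ^^ n) g)"
  by (induction n) (auto intro: locally_bounded_mean1)

lemma mean1_funpow_diff:
  assumes "locally_bounded f" "locally_bounded g"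
  shows "(mean1 ^^ n) (\<lambda>x. f x - g x) = (\<lambda>x. (mean1 ^^ n) f x - (mean1 ^^ n) g x)"
proof (induction n)
  case (Suc n)
  then show ?case
    using mean1_diff[OF locally_bounded_mean1_funpow[OF assms(1)] locally_bounded_mean1_funpow[OF assms(2)], of n n]
    by (simp only: funpow.simps o_apply)
qed simp

lemma mean1_step1:
  assumes "locally_bounded g"
  shows "mean1 (step1 g) = step1 (mean1 g)"
proof
  fix x
  have "mean1 (step1 g) x = (LINT t|lborel. unit_box t *\<^sub>R g ((x + 1) + 1 * t) - unit_box t *\<^sub>R g (x + 1 * t))"
    unfolding cconv_def step1_def by (intro Bochner_Integration.integral_cong refl) (simp add: algebra_simps)
  also have "\<dots> = step1 (mean1 g) x"
    unfolding cconv_def step1_def by (intro Bochner_Integration.integral_diff locally_bounded_integrable assms)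
  finally show "mean1 (step1 g) x = step1 (mean1 g) x" .
qed

lemma mean1_funpow_step1:
  assumes "locally_bounded g"
  shows "(mean1 ^^ n) (step1 g) = step1 ((mean1 ^^ n) g)"
proof (induction n)
  case (Suc n)
  then show ?case using mean1_step1[OF locally_bounded_mean1_funpow[OF assms], of n] by simp
qed simp

lemma mean1_antiderivative:
  assumes "antiderivative F f"
  shows "mean1 f = step1 F"
proof
  fix x
  have "step1 F x = (LINT u|lborel. indicator {x..x + 1} u *\<^sub>R f u)"
    using assms by (simp add: antiderivative_def step1_def set_lebesgue_integral_def)
  also have "\<dots> = (LINT t|lborel. indicator {x..x + 1} (x + 1 * t) *\<^sub>R f (x + 1 * t))"
    by (subst lborel_integral_real_affine[where c=1 and t=x]) auto
  also have "\<dots> = mean1 f x"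
    unfolding cconv_def by (intro Bochner_Integration.integral_cong refl) (auto simp: indicator_def)
  finally show "mean1 f x = step1 F x" ..
qed

lemma cauchy_integrable_dominated:
  assumes "cauchy_integrable g" and [measurable]: "f \<in> borel_measurable borel" and le: "\<And>x. norm (f x) \<le> norm (g x)"
  shows "cauchy_integrable f"
proof -
  have "integrable lborel (\<lambda>t. norm (f t) / (1 + t\<^sup>2))"
    by (rule Bochner_Integration.integrable_bound[of _ "\<lambda>t. norm (g t) / (1 + t\<^sup>2)"])
       (use assms in \<open>auto simp: cauchy_integrable_def intro!: divide_right_mono\<close>)
  then show ?thesis by (simp add: cauchy_integrable_def)
qed

text \<open>The difference between \<open>F\<close> and its mean over the next unit interval is at most the integral of \<open>norm f\<close> over that interval.\<close>

lemma cauchy_integrable_minus_mean1: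
  assumes F: "locally_bounded F" and f: "cauchy_integrable f" and ad: "antiderivative F f"
  shows "cauchy_integrable (\<lambda>x. F x - mean1 F x)"
proof -
  define G where "G y = complex_of_real (norm (f y))" for y
  have G: "cauchy_integrable G" unfolding G_def by (rule cauchy_integrable_norm[OF f])
  have [measurable]: "F \<in> borel_measurable borel" using F by (simp add: locally_bounded_def)
  show ?thesis
  proof (rule cauchy_integrable_dominated)
    show "cauchy_integrable (mean1 G)" by (rule cauchy_integrable_cconv[OF cauchy_kernel_unit_box G]) simp
    show "(\<lambda>x. F x - mean1 F x) \<in> borel_measurable borel" by measurable
    fix x
    define I where "I = (LINT u|lborel. unit_box u * norm (f (x + u)))"
    have iG: "integrable lborel (\<lambda>u. unit_box u * norm (f (x + u)))"
      using integrable_norm[OF integrable_cconv[OF cauchy_kernel_unit_box f, of 1 x]] by (simp add: abs_mult)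
    have I: "mean1 G x = complex_of_real I"
      unfolding cconv_def G_def I_def by (subst integral_complex_of_real[symmetric]) (simp add: scaleR_conv_of_real)
    have le: "norm (F x - F (x + t)) \<le> I" if t: "0 \<le> t" "t \<le> 1" for t
    proof -
      have "F (x + t) - F x = (LINT u|lborel. indicator {x..x + t} u *\<^sub>R f u)"
        using ad t by (simp add: antiderivative_def set_lebesgue_integral_def)
      also have "\<dots> = (LINT u|lborel. indicator {x..x + t} (x + 1 * u) *\<^sub>R f (x + 1 * u))"
        by (subst lborel_integral_real_affine[where c=1 and t=x]) auto
      also have "norm \<dots> \<le> I"
        unfolding I_def
      proof (rule Bochner_Integration.integral_norm_bound_integral[OF _ iG])
        have "integrable lborel (\<lambda>u. indicator {x..x + t} u *\<^sub>R f u)"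
          using cauchy_integrable_set_integrable[OF f] by (simp add: set_integrable_def)
        from lborel_integrable_real_affine[OF this, of 1 x]
        show "integrable lborel (\<lambda>u. indicator {x..x + t} (x + 1 * u) *\<^sub>R f (x + 1 * u))" by simp
        fix u show "norm (indicator {x..x + t} (x + 1 * u) *\<^sub>R f (x + 1 * u)) \<le> unit_box u * norm (f (x + u))"
          using t by (auto simp: indicator_def)
      qed
      finally show ?thesis by (simp add: norm_minus_commute)
    qed
    have i1: "integrable lborel (\<lambda>t. unit_box t *\<^sub>R F x)" by (intro integrable_scaleR_left integrable_real_indicator) auto
    have "F x - mean1 F x = (LINT t|lborel. unit_box t *\<^sub>R F x) - mean1 F x"
      by (subst Bochner_Integration.integral_scaleR_left) auto
    also have "\<dots> = (LINT t|lborel. unit_box t *\<^sub>R F x - unit_box t *\<^sub>R F (x + 1 * t))"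
      unfolding cconv_def by (rule Bochner_Integration.integral_diff[OF i1 locally_bounded_integrable[OF F], symmetric])
    also have "norm \<dots> \<le> (LINT t|lborel. I * unit_box t)"
    proof (rule Bochner_Integration.integral_norm_bound_integral)
      show "integrable lborel (\<lambda>t. unit_box t *\<^sub>R F x - unit_box t *\<^sub>R F (x + 1 * t))"
        by (rule Bochner_Integration.integrable_diff[OF i1 locally_bounded_integrable[OF F]])
      show "integrable lborel (\<lambda>t. I * unit_box t)" by (intro integrable_mult_right integrable_real_indicator) auto
      fix t show "norm (unit_box t *\<^sub>R F x - unit_box t *\<^sub>R F (x + 1 * t)) \<le> I * unit_box t"
        using le[of t] by (auto simp: indicator_def)
    qed
    also have "\<dots> = I" by simp
    also have "I \<le> norm (mean1 G x)" unfolding I by simp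
    finally show "norm (F x - mean1 F x) \<le> norm (mean1 G x)" .
  qed
qed

lemma cauchy_integrable_mean1_funpow: "cauchy_integrable g \<Longrightarrow> cauchy_integrable ((mean1 ^^ n) g)"
  by (induction n) (auto intro: cauchy_integrable_cconv cauchy_kernel_unit_box)

lemma cauchy_integrable_step1:
  assumes "cauchy_integrable g"
  shows "cauchy_integrable (step1 g)"
  unfolding step1_def[abs_def]
  using cauchy_integrable_diff[OF cauchy_integrable_affine[OF assms, of 1 1] assms] by (simp add: add.commute)

text \<open>Taking the unit mean of a derivative gives a difference of the function, so that the \<open>k\<close>-fold mean of \<open>h k\<close> is the \<open>k\<close>-th difference of \<open>h 0\<close> and inherits its integrability. By \<open>cauchy_integrable_minus_mean1\<close> the function \<open>h k\<close> differs from its \<open>k\<close>-fold mean by a function with the same property.\<close>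

theorem cauchy_integrable_previous:
  assumes lb: "\<And>j. j \<le> k \<Longrightarrow> locally_bounded (h j)"
    and ad: "\<And>j. j < k \<Longrightarrow> antiderivative (h j) (h (Suc j))" "antiderivative (h k) f"
    and h0: "cauchy_integrable (h 0)" and f: "cauchy_integrable f"
  shows "cauchy_integrable (h k)"
proof -
  have A: "(mean1 ^^ j) (h j) = (step1 ^^ j) (h 0)" if "j \<le> k" for j
    using that
  proof (induction j)
    case (Suc j)
    have "(mean1 ^^ Suc j) (h (Suc j)) = (mean1 ^^ j) (mean1 (h (Suc j)))" by (simp only: funpow_Suc_right o_apply)
    also have "\<dots> = (mean1 ^^ j) (step1 (h j))" using Suc.prems by (simp add: mean1_antiderivative[OF ad(1)])
    also have "\<dots> = step1 ((mean1 ^^ j) (h j))" using Suc.prems by (intro mean1_funpow_step1 lb) simp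
    finally show ?case using Suc by simp
  qed simp
  have S: "cauchy_integrable ((step1 ^^ j) (h 0))" for j
    by (induction j) (auto intro: h0 cauchy_integrable_step1)
  have d: "cauchy_integrable (\<lambda>x. h k x - (mean1 ^^ j) (h k) x)" for j
  proof (induction j)
    case 0 show ?case by (simp add: cauchy_integrable_def)
  next
    case (Suc j)
    have lk: "locally_bounded (h k)" by (rule lb) simp
    have e: "(mean1 ^^ j) (\<lambda>x. h k x - mean1 (h k) x) = (\<lambda>x. (mean1 ^^ j) (h k) x - (mean1 ^^ Suc j) (h k) x)"
      unfolding mean1_funpow_diff[OF lk locally_bounded_mean1[OF lk]] by (simp only: funpow_Suc_right o_apply)
    have "cauchy_integrable ((mean1 ^^ j) (\<lambda>x. h k x - mean1 (h k) x))"
      by (intro cauchy_integrable_mean1_funpow cauchy_integrable_minus_mean1[OF lk f ad(2)])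
    from cauchy_integrable_add[OF Suc this[unfolded e]] show ?case by simp
  qed
  show ?thesis using cauchy_integrable_add[OF d[of k] S[of k]] A[of k] by simp
qed

section \<open>Sobolev functions and Steklov means\<close>

text \<open>For \<open>a \<ge> 0\<close> either \<open>a \<le> 1\<close> or \<open>a \<le> a powr p y\<close>.\<close>

lemma Lp_var_cauchy_integrable:
  assumes p: "p \<in> exponents" and [measurable]: "f \<in> borel_measurable borel" and f: "f \<in> Lp_var p"
  shows "cauchy_integrable f"
proof -
  note [measurable] = exponents_measurable[OF p]
  obtain l where l: "0 < l" "modular p (\<lambda>y. f y / complex_of_real l) < \<infinity>"
    using f by (auto simp: Lp_var_def)
  have fl[measurable]: "f \<in> borel_measurable lebesgue" using f by (simp add: Lp_var_def)
  have "(\<integral>\<^sup>+y. ennreal (norm (f y) / (1 + y\<^sup>2)) \<partial>lborel) = (\<integral>\<^sup>+y. ennreal (norm (f y) / (1 + y\<^sup>2)) \<partial>lebesgue)"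
    by (rule nn_integral_completion[symmetric])
  also have "\<dots> \<le> (\<integral>\<^sup>+y. ennreal l * (ennreal (1 / (1 + y\<^sup>2)) + ennreal (norm (f y / complex_of_real l) powr p y)) \<partial>lebesgue)"
  proof (rule nn_integral_mono)
    fix y
    define a where "a = norm (f y) / l"
    have a: "0 \<le> a" using l by (simp add: a_def)
    have "a / (1 + y\<^sup>2) \<le> 1 / (1 + y\<^sup>2) + a powr p y"
    proof (cases "a \<le> 1")
      case True
      then have "a / (1 + y\<^sup>2) \<le> 1 / (1 + y\<^sup>2)" by (intro divide_right_mono) auto
      then show ?thesis by (intro add_increasing2) auto
    next
      case False
      have "a / (1 + y\<^sup>2) \<le> a / 1" using a by (intro divide_left_mono) auto
      also have "\<dots> \<le> a powr p y" using powr_mono[of 1 "p y" a] exponents_ge_1[OF p, of y] False by simp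
      finally show ?thesis by (intro add_increasing) auto
    qed
    then have "l * (a / (1 + y\<^sup>2)) \<le> l * (1 / (1 + y\<^sup>2) + a powr p y)" using l by (intro mult_left_mono) auto
    then have "ennreal (norm (f y) / (1 + y\<^sup>2)) \<le> ennreal (l * (1 / (1 + y\<^sup>2) + a powr p y))"
      using l by (intro ennreal_leI) (simp add: a_def)
    also have "\<dots> = ennreal l * (ennreal (1 / (1 + y\<^sup>2)) + ennreal (a powr p y))"
      using l by (subst ennreal_mult) (auto simp: add_nonneg_nonneg)
    finally show "ennreal (norm (f y) / (1 + y\<^sup>2)) \<le> ennreal l * (ennreal (1 / (1 + y\<^sup>2)) + ennreal (norm (f y / complex_of_real l) powr p y))"
      using l by (simp add: a_def norm_divide)
  qed
  also have "\<dots> = ennreal l * ((\<integral>\<^sup>+y. ennreal (1 / (1 + y\<^sup>2)) \<partial>lebesgue) + modular p (\<lambda>y. f y / complex_of_real l))"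
  proof -
    have m: "(\<lambda>y::real. ennreal (1 / (1 + y\<^sup>2))) \<in> borel_measurable lebesgue"
      by (rule measurable_completion) simp
    have m': "(\<lambda>y. ennreal (norm (f y / complex_of_real l) powr p y)) \<in> borel_measurable lebesgue" by measurable
    show ?thesis unfolding modular_def nn_integral_add[OF m m', symmetric] using m m' by (intro nn_integral_cmult) simp
  qed
  also have "\<dots> < \<infinity>"
    using l by (simp add: nn_integral_completion nn_integral_cauchy ennreal_mult_less_top)
  finally have "integrable lborel (\<lambda>y. norm (f y) / (1 + y\<^sup>2))" by (intro integrableI_nonneg) auto
  then show ?thesis by (simp add: cauchy_integrable_def)
qed

lemma AE_lborel_shift:
  assumes "AE y in lborel. P y"
  shows "AE t in lborel. P (x + t :: real)"
proof -
  obtain N where N: "{y. \<not> P y} \<subseteq> N" "N \<in> null_sets lborel" using assms by (auto elim: AE_E2 simp: eventually_ae_filter)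
  then have [measurable]: "N \<in> sets borel" by (auto simp: null_sets_def)
  define M where "M = (\<lambda>t. x + t) -` N"
  have "(\<lambda>t. x + t) \<in> borel_measurable borel" by measurable
  from measurable_sets[OF this \<open>N \<in> sets borel\<close>] have M: "M \<in> sets lborel"
    unfolding M_def by (simp only: space_borel Int_UNIV_right sets_lborel)
  have "emeasure lborel M = (\<integral>\<^sup>+t. indicator M t \<partial>lborel)" by (rule nn_integral_indicator[OF M, symmetric])
  also have "\<dots> = (\<integral>\<^sup>+t. indicator N (x + 1 * t) \<partial>lborel)"
    by (intro nn_integral_cong) (simp add: M_def indicator_def)
  also have "\<dots> = (\<integral>\<^sup>+t. indicator N t \<partial>lborel)"
    by (subst (2) nn_integral_real_affine[where c=1 and t=x]) auto
  also have "\<dots> = 0" using N by (simp add: null_sets_def)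
  finally have "M \<in> null_sets lborel" using M by (rule null_setsI)
  then show ?thesis by (rule AE_I') (use N(1) in \<open>auto simp: M_def\<close>)
qed

text \<open>Steklov means are defined by Lebesgue integrals of Lebesgue measurable functions, and take the same values at every point on any Borel function that agrees with the given one almost everywhere.\<close>

lemma steklov_eq_cconv:
  assumes g0: "g0 \<in> borel_measurable lebesgue" and eq: "AE y in lborel. g0 y = g y"
    and g: "cauchy_integrable g" and \<delta>: "0 < \<delta>"
  shows "steklov \<delta> g0 x = cconv \<delta> unit_box g x"
proof -
  have [measurable]: "g \<in> borel_measurable borel" using g by (rule cauchy_integrable_measurable)
  have shift: "(\<lambda>t. x + t) \<in> lebesgue \<rightarrow>\<^sub>M lebesgue"
    using lebesgue_affine_measurable[of "\<lambda>_. 1" x] by simp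
  have m0: "(\<lambda>t. g0 (x + t)) \<in> borel_measurable lebesgue" by (rule measurable_compose[OF shift g0])
  have m1: "(\<lambda>t. indicator {0..\<delta>} t *\<^sub>R g (x + t)) \<in> borel_measurable lborel" by measurable
  have ae: "AE t in lebesgue. g0 (x + t) = g (x + t)"
    by (rule AE_completion[OF AE_lborel_shift[OF eq]])
  have "(LINT t:{0..\<delta>}|lebesgue. g0 (x + t)) = (LINT t:{0..\<delta>}|lebesgue. g (x + t))"
    unfolding set_lebesgue_integral_def
  proof (rule integral_cong_AE)
    show "(\<lambda>t. indicator {0..\<delta>} t *\<^sub>R g0 (x + t)) \<in> borel_measurable lebesgue"
      by (intro borel_measurable_scaleR m0 borel_measurable_indicator) simp
    show "(\<lambda>t. indicator {0..\<delta>} t *\<^sub>R g (x + t)) \<in> borel_measurable lebesgue"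
      using m1 by (rule measurable_completion)
    show "AE t in lebesgue. indicator {0..\<delta>} t *\<^sub>R g0 (x + t) = indicator {0..\<delta>} t *\<^sub>R g (x + t)"
      using ae by eventually_elim simp
  qed
  also have "\<dots> = (LINT t|lborel. indicator {0..\<delta>} t *\<^sub>R g (x + t))"
    unfolding set_lebesgue_integral_def by (rule integral_completion[OF m1])
  also have "\<dots> = \<delta> *\<^sub>R (LINT s|lborel. indicator {0..\<delta>} (0 + \<delta> * s) *\<^sub>R g (x + (0 + \<delta> * s)))"
    using \<delta> by (subst lborel_integral_real_affine[where c=\<delta> and t=0]) auto
  also have "(LINT s|lborel. indicator {0..\<delta>} (0 + \<delta> * s) *\<^sub>R g (x + (0 + \<delta> * s))) = cconv \<delta> unit_box g x"
    unfolding cconv_def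
  proof (intro Bochner_Integration.integral_cong refl)
    fix s
    have "\<delta> * s \<in> {0..\<delta>} \<longleftrightarrow> s \<in> {0..1}" using \<delta> by (auto simp: zero_le_mult_iff mult_le_cancel_left2)
    then show "indicator {0..\<delta>} (0 + \<delta> * s) *\<^sub>R g (x + (0 + \<delta> * s)) = unit_box s *\<^sub>R g (x + \<delta> * s)"
      by (simp add: indicator_def)
  qed
  finally show ?thesis unfolding steklov_def using \<delta> by (simp add: scaleR_conv_of_real)
qed

lemma steklov_diff_funpow_AE:
  assumes g0: "g0 \<in> borel_measurable lebesgue" and eq: "AE y in lborel. g0 y = g y"
    and g: "cauchy_integrable g" and \<delta>: "0 < \<delta>"
  shows "((\<lambda>g x. g x - steklov \<delta> g x) ^^ n) g0 \<in> borel_measurable lebesgue \<and>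
    (AE y in lborel. ((\<lambda>g x. g x - steklov \<delta> g x) ^^ n) g0 y = (steklov_diff \<delta> ^^ n) g y)"
proof (induction n)
  case 0 show ?case using g0 eq by simp
next
  case (Suc n)
  define u where "u = ((\<lambda>g x. g x - steklov \<delta> g x) ^^ n) g0"
  define v where "v = (steklov_diff \<delta> ^^ n) g"
  have u: "u \<in> borel_measurable lebesgue" "AE y in lborel. u y = v y" using Suc by (simp_all add: u_def v_def)
  have v: "cauchy_integrable v" unfolding v_def by (rule cauchy_integrable_steklov_diff_funpow[OF g]) (use \<delta> in simp)
  have s: "steklov \<delta> u = cconv \<delta> unit_box v" by (rule ext) (rule steklov_eq_cconv[OF u v \<delta>])
  have "cauchy_integrable (cconv \<delta> unit_box v)" by (rule cauchy_integrable_cconv[OF cauchy_kernel_unit_box v]) (use \<delta> in simp)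
  then have "(\<lambda>x. u x - cconv \<delta> unit_box v x) \<in> borel_measurable lebesgue"
    by (intro borel_measurable_diff u cauchy_integrable_lebesgue)
  moreover have "AE y in lborel. u y - cconv \<delta> unit_box v y = steklov_diff \<delta> v y"
    using u(2) by eventually_elim (simp add: steklov_diff_def)
  ultimately show ?case by (simp add: u_def[symmetric] v_def[symmetric] s)
qed

lemma abs_continuous_imp_continuous:
  assumes ac: "\<And>a b. abs_continuous_on {a..b} f"
  shows "continuous_on UNIV f"
  unfolding continuous_on_iff
proof (intro ballI allI impI)
  fix x e :: real assume e: "0 < e"
  obtain d where d: "0 < d" "\<And>D. D \<in> packing (x - 1) (x + 1) \<Longrightarrow> (\<Sum>(u, v)\<in>D. v - u) < d \<Longrightarrow> vsum f D < e"
    by (rule abs_continuous_packing[OF ac e]) (rule that)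
  have *: "norm (f v - f u) < e" if "x - 1 \<le> u" "u < v" "v \<le> x + 1" "v - u < d" for u v
    using d(2)[OF packing_single[OF that(1-3)]] that(4) by (simp add: vsum_def)
  show "\<exists>d>0. \<forall>x'\<in>UNIV. dist x' x < d \<longrightarrow> dist (f x') (f x) < e"
  proof (intro exI[of _ "min d 1"] conjI ballI impI)
    show "0 < min d 1" using d(1) by simp
    fix y assume y: "dist y x < min d 1"
    consider "y = x" | "y < x" | "x < y" by linarith
    then show "dist (f y) (f x) < e"
    proof cases
      case 1 then show ?thesis using e by simp
    next
      case 2 then show ?thesis using *[of y x] y by (simp add: dist_norm dist_real_def norm_minus_commute)
    next
      case 3 then show ?thesis using *[of x y] y by (simp add: dist_norm dist_real_def)
    qed
  qed
qed

lemma nth_deriv_Suc: "nth_deriv (Suc j) f x = vector_derivative (nth_deriv j f) (at x)"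
  by (simp add: nth_deriv_def)

text \<open>The derivatives below order \<open>r\<close> are taken as they are, the one of order \<open>r\<close> is replaced by a Borel function. Integrability against \<open>1 / (1 + t^2)\<close> is known for the two ends of the chain and passes downwards from order \<open>r\<close> by \<open>cauchy_integrable_previous\<close>.\<close>

lemma sobolev_var_chain:
  assumes f: "f \<in> sobolev_var r p" and r: "1 \<le> r" and p: "p \<in> exponents"
  obtains h where "\<And>j. j < r \<Longrightarrow> h j = nth_deriv j f" "AE x in lborel. h r x = nth_deriv r f x"
    "\<And>j. j \<le> r \<Longrightarrow> cauchy_integrable (h j)" "\<And>j. j < r \<Longrightarrow> antiderivative (h j) (h (Suc j))"
proof -
  have fL: "f \<in> Lp_var p" and frL: "nth_deriv r f \<in> Lp_var p"
    and df: "\<And>j x. j < r - 1 \<Longrightarrow> nth_deriv j f differentiable (at x)"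
    and ac: "\<And>a b. abs_continuous_on {a..b} (nth_deriv (r - 1) f)"
    using f by (auto simp: sobolev_var_def)
  have r1: "Suc (r - 1) = r" using r by simp
  have frm: "nth_deriv r f \<in> borel_measurable lebesgue" using frL by (simp add: Lp_var_def)
  obtain u where u: "u \<in> borel_measurable lborel" "AE x in lborel. Re (nth_deriv r f x) = u x"
    using completion_ex_borel_measurable_real[OF measurable_compose[OF frm borel_measurable_Re]] by auto
  obtain v where v: "v \<in> borel_measurable lborel" "AE x in lborel. Im (nth_deriv r f x) = v x"
    using completion_ex_borel_measurable_real[OF measurable_compose[OF frm borel_measurable_Im]] by auto
  define G where "G x = complex_of_real (u x) + \<i> * complex_of_real (v x)" for x
  have Gb: "G \<in> borel_measurable borel" unfolding G_def[abs_def] using u(1) v(1) by simp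
  have Geq: "AE x in lborel. G x = nth_deriv r f x"
    using u(2) v(2) by eventually_elim (simp add: G_def complex_eq_iff)
  define h where "h j = (if j < r then nth_deriv j f else G)" for j
  have hd: "h j = nth_deriv j f" if "j < r" for j using that by (simp add: h_def)
  have hr: "h r = G" by (simp add: h_def)
  have cont: "continuous_on UNIV (nth_deriv j f)" if "j < r" for j
  proof (cases "j < r - 1")
    case True
    then show ?thesis using df[of j]
      by (intro continuous_at_imp_continuous_on ballI differentiable_imp_continuous_within) auto
  next
    case False
    then have "j = r - 1" using that by simp
    then show ?thesis using abs_continuous_imp_continuous[OF ac] by simp
  qed
  have ad: "antiderivative (h j) (h (Suc j))" if "j < r" for j
  proof (cases "j < r - 1")
    case True
    then have j: "Suc j < r" by simp
    have "(nth_deriv j f has_vector_derivative nth_deriv (Suc j) f x) (at x)" for x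
      unfolding nth_deriv_Suc using df[OF True] by (simp add: vector_derivative_works[symmetric])
    then have "(LINT t|lborel. indicator {a..b} t *\<^sub>R nth_deriv (Suc j) f t) = nth_deriv j f b - nth_deriv j f a" if "a \<le> b" for a b
      using that by (intro integral_FTC_Icc continuous_on_subset[OF cont[OF j]]) (auto intro: has_vector_derivative_at_within)
    then show ?thesis using hd[OF that] hd[OF j] by (simp add: antiderivative_def set_lebesgue_integral_def)
  next
    case False
    then have j: "j = r - 1" using that by simp
    have "AE x in lborel. G x = vector_derivative (nth_deriv (r - 1) f) (at x)"
      using Geq by (simp only: nth_deriv_Suc[symmetric] r1)
    from abs_continuous_FTC(2)[OF ac this Gb]
    have "antiderivative (nth_deriv (r - 1) f) G" by (simp add: antiderivative_def)
    then show ?thesis using hd[OF that] hr j r1 by simp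
  qed
  have ci0: "cauchy_integrable (h 0)"
  proof -
    have "f = nth_deriv 0 f" by (simp add: nth_deriv_def)
    then have "cauchy_integrable f"
      using cont[of 0] r fL p by (intro Lp_var_cauchy_integrable[OF p]) (auto intro: borel_measurable_continuous_onI)
    then show ?thesis using hd[of 0] r by (simp add: nth_deriv_def)
  qed
  have cir: "cauchy_integrable (h r)"
  proof -
    have "G \<in> Lp_var p"
      using Lp_var_iff_norm_var_finite[OF p, of G] Lp_var_iff_norm_var_finite[OF p, of "nth_deriv r f"] frL
        norm_var_cong_AE[OF p Geq] borel_lebesgue[OF Gb] by simp
    then show ?thesis unfolding hr by (rule Lp_var_cauchy_integrable[OF p Gb])
  qed
  have ci: "cauchy_integrable (h j)" if "j \<le> r" for j
    using that
  proof (induction rule: inc_induct)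
    case (step k)
    show ?case
    proof (rule cauchy_integrable_previous[where h=h and k=k, OF _ _ _ ci0 step.IH])
      show "locally_bounded (h i)" if "i \<le> k" for i
        using that step.hyps hd[of i] cont[of i] by (simp add: locally_bounded_continuous)
    qed (use ad step.hyps in auto)
  qed (rule cir)
  show thesis by (rule that[of h]) (use hd ci ad Geq hr in auto)
qed

section \<open>The approximation theorem\<close>

theorem theorem5p13:
  fixes r s :: nat and p :: "real \<Rightarrow> real"
  assumes "1 \<le> r" and "1 \<le> s" and "p \<in> log_exponents"
  shows "\<exists>C :: nat \<Rightarrow> real. (\<forall>k\<le>r. 0 < C k) \<and>
    (\<forall>\<sigma>>0. \<forall>f\<in>sobolev_var r p. \<exists>\<Phi>\<in>entire_var (2 * \<sigma>) p. \<forall>k\<le>r.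
       norm_var p (\<lambda>x. nth_deriv k f x - (deriv ^^ k) \<Phi> (complex_of_real x))
         \<le> ennreal (C k / \<sigma> ^ (r - k)) * smoothness_modulus s p (nth_deriv r f) (1 / \<sigma>))"
proof -
  let ?err = "\<lambda>f \<Phi> k. norm_var p (\<lambda>x. nth_deriv k f x - (deriv ^^ k) \<Phi> (complex_of_real x))"
  let ?\<Omega> = "\<lambda>f \<sigma>. smoothness_modulus s p (nth_deriv r f) (1 / \<sigma>)" and ?L = jackson_diff and ?S = steklov_diff
  note r = assms(1) and lp = assms(3)
  have pe: "p \<in> exponents" using lp by (simp add: log_exponents_def)
  obtain A where A: "1 \<le> A" "\<And>\<delta> g. 0 < \<delta> \<Longrightarrow> cauchy_integrable g \<Longrightarrow> norm_var p (jackson_diff \<delta> g) \<le> ennreal A * norm_var p g"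
    by (rule norm_jackson_diff_le[OF lp]) (rule that)
  obtain D where D: "0 < D" "\<And>\<delta> F f. 0 < \<delta> \<Longrightarrow> cauchy_integrable F \<Longrightarrow> cauchy_integrable f \<Longrightarrow> antiderivative F f \<Longrightarrow>
     norm_var p (jackson_diff \<delta> F) \<le> ennreal (D * \<delta>) * norm_var p f"
    by (rule norm_jackson_diff_le_derivative[OF lp]) (rule that)
  obtain S where S: "0 < S" "\<And>\<delta> g. 0 < \<delta> \<Longrightarrow> cauchy_integrable g \<Longrightarrow>
     norm_var p (jackson_diff \<delta> g) \<le> ennreal S * norm_var p (steklov_diff \<delta> g)"
    by (rule norm_jackson_diff_le_steklov_diff[OF lp]) (rule that)
  have A0: "0 < A" using A(1) by simp
  define C where "C k = D ^ (r - k) * A ^ k * S ^ s" for k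
  have main: "\<exists>\<Phi>\<in>entire_var (2 * \<sigma>) p. \<forall>k\<le>r.
       ?err f \<Phi> k
         \<le> ennreal (C k / \<sigma> ^ (r - k)) * ?\<Omega> f \<sigma>"
    if \<sigma>: "0 < \<sigma>" and f: "f \<in> sobolev_var r p" for \<sigma> f
  proof -
    define \<delta> where "\<delta> = 1 / \<sigma>"
    have \<delta>: "0 < \<delta>" "\<delta> \<noteq> 0" using \<sigma> by (simp_all add: \<delta>_def)
    obtain h where h: "\<And>j. j < r \<Longrightarrow> h j = nth_deriv j f" "AE x in lborel. h r x = nth_deriv r f x"
      "\<And>j. j \<le> r \<Longrightarrow> cauchy_integrable (h j)" "\<And>j. j < r \<Longrightarrow> antiderivative (h j) (h (Suc j))"
      by (rule sobolev_var_chain[OF f r pe]) (rule that)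
    have h0: "h 0 = f" using h(1)[of 0] r by (simp add: nth_deriv_def)
    define n where "n = r + s"
    define W where "W k = jackson_sum \<delta> n (h k)" for k
    have W: "cauchy_integrable (W k)" if "k \<le> r" for k
      unfolding W_def by (rule cauchy_integrable_jackson_sum[OF h(3)[OF that] \<delta>(2)])
    have Wad: "antiderivative (W k) (W (Suc k))" if "k < r" for k
      unfolding W_def using that by (intro antiderivative_jackson_sum h \<delta>) auto
    define \<Phi> where "\<Phi> = jext \<delta> (W 0)"
    have d: "(deriv ^^ k) \<Phi> = jext \<delta> (W k)" if "k \<le> r" for k
      using that
    proof (induction k)
      case (Suc k)
      then show ?case using deriv_jext[OF W W Wad \<delta>(1), of k] by simp
    qed (simp add: \<Phi>_def)
    have dr: "(deriv ^^ k) \<Phi> (complex_of_real x) = h k x - (?L \<delta> ^^ n) (h k) x" if "k \<le> r" for k x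
      unfolding d[OF that] jext_of_real[OF W[OF that] \<delta>(1)] unfolding W_def
      by (rule cconv_jackson_sum[OF h(3)[OF that] \<delta>(2)])
    have "\<Phi> \<in> entire_var (2 * \<sigma>) p"
      unfolding entire_var_def
    proof (intro CollectI conjI)
      show "\<Phi> holomorphic_on UNIV" unfolding \<Phi>_def by (rule jext_holomorphic[OF W \<delta>(1)]) simp
      have "exp_type_le (2 / \<delta>) \<Phi>" unfolding \<Phi>_def by (rule jext_exp_type[OF W \<delta>(1)]) simp
      then show "exp_type_le (2 * \<sigma>) \<Phi>" by (simp add: \<delta>_def)
      have e: "(\<lambda>x. \<Phi> (complex_of_real x)) = (\<lambda>x. f x - (?L \<delta> ^^ n) f x)"
        using dr[of 0] by (simp add: h0)
      have fc: "cauchy_integrable f" using h(3)[of 0] h0 by simp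
      note jc = cauchy_integrable_jackson_diff_funpow[OF fc \<delta>(2), of n]
      have fL: "norm_var p f < \<infinity>"
        using Lp_var_iff_norm_var_finite[OF pe, of f] f by (auto simp: sobolev_var_def)
      have "norm_var p ((?L \<delta> ^^ n) f) \<le> ennreal (A ^ n) * norm_var p f"
        by (rule norm_jackson_diff_funpow_le[OF A0 A(2)[OF \<delta>(1)] fc \<delta>(2)])
      also have "\<dots> < \<infinity>" using fL by (simp add: ennreal_mult_less_top)
      finally have "norm_var p (\<lambda>x. f x - (?L \<delta> ^^ n) f x) < \<infinity>"
        using norm_var_diff_le[OF pe cauchy_integrable_lebesgue[OF fc] cauchy_integrable_lebesgue[OF jc]] fL
        by (simp add: le_less_trans)
      then show "(\<lambda>x. \<Phi> (complex_of_real x)) \<in> Lp_var p"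
        unfolding e Lp_var_iff_norm_var_finite[OF pe]
        by (intro conjI borel_measurable_diff cauchy_integrable_lebesgue fc jc)
    qed
    moreover have "?err f \<Phi> k
         \<le> ennreal (C k / \<sigma> ^ (r - k)) * ?\<Omega> f \<sigma>" if k: "k \<le> r" for k
    proof -
      have hk: "AE x in lborel. h k x = nth_deriv k f x"
        using h(1)[of k] h(2) k by (cases "k = r") auto
      have "AE x in lborel. nth_deriv k f x - (deriv ^^ k) \<Phi> (complex_of_real x) = (?L \<delta> ^^ n) (h k) x"
        using hk by eventually_elim (simp add: dr[OF k])
      then have "?err f \<Phi> k = norm_var p ((?L \<delta> ^^ n) (h k))"
        by (rule norm_var_cong_AE[OF pe])
      also have "\<dots> = norm_var p ((?L \<delta> ^^ ((k + s) + (r - k))) (h k))"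
      proof -
        have "n = (k + s) + (r - k)" using k by (simp add: n_def)
        then show ?thesis by (simp only:)
      qed
      also have "\<dots> \<le> ennreal ((D * \<delta>) ^ (r - k)) * norm_var p ((?L \<delta> ^^ (k + s)) (h r))"
        by (rule norm_jackson_diff_funpow_le_derivative[where h=h and r=r and C="D * \<delta>", OF _ D(2)[OF \<delta>(1)] h(3) h(4) \<delta>(2)])
          (use D(1) \<delta> k in auto)
      also have "norm_var p ((?L \<delta> ^^ (k + s)) (h r)) \<le> ennreal (A ^ k * S ^ s) * norm_var p ((?S \<delta> ^^ s) (h r))"
      proof -
        note hr = h(3)[OF order_refl]
        have "norm_var p ((?L \<delta> ^^ (k + s)) (h r)) = norm_var p ((?L \<delta> ^^ k) ((?L \<delta> ^^ s) (h r)))"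
          by (simp only: funpow_add o_apply)
        also have "\<dots> \<le> ennreal (A ^ k) * norm_var p ((?L \<delta> ^^ s) (h r))"
          by (rule norm_jackson_diff_funpow_le[OF A0 A(2)[OF \<delta>(1)] cauchy_integrable_jackson_diff_funpow[OF hr \<delta>(2)] \<delta>(2)])
        also have "\<dots> \<le> ennreal (A ^ k) * (ennreal (S ^ s) * norm_var p ((?S \<delta> ^^ s) (h r)))"
          by (rule mult_left_mono[OF norm_jackson_diff_funpow_le_steklov[OF S(1) S(2)[OF \<delta>(1)] hr \<delta>(2)] zero_le])
        finally show ?thesis using A0 S(1) by (simp add: ennreal_mult mult.assoc)
      qed
      finally have le: "?err f \<Phi> k \<le>
          ennreal ((D * \<delta>) ^ (r - k)) * (ennreal (A ^ k * S ^ s) * norm_var p ((?S \<delta> ^^ s) (h r)))"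
        by (simp add: mult_left_mono)
      have frm: "nth_deriv r f \<in> borel_measurable lebesgue" using f by (auto simp: sobolev_var_def Lp_var_def)
      have "AE x in lborel. nth_deriv r f x = h r x" using h(2) by eventually_elim simp
      then have "AE y in lborel. ((\<lambda>g x. g x - steklov \<delta> g x) ^^ s) (nth_deriv r f) y = (?S \<delta> ^^ s) (h r) y"
        using steklov_diff_funpow_AE[OF frm _ h(3)[OF order_refl] \<delta>(1)] by blast
      then have sm: "?\<Omega> f \<sigma> = norm_var p ((?S \<delta> ^^ s) (h r))"
        unfolding smoothness_modulus_def \<delta>_def[symmetric] by (rule norm_var_cong_AE[OF pe])
      have "C k / \<sigma> ^ (r - k) = (D * \<delta>) ^ (r - k) * (A ^ k * S ^ s)"
        by (simp add: C_def \<delta>_def power_divide)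
      then have "ennreal (C k / \<sigma> ^ (r - k)) = ennreal ((D * \<delta>) ^ (r - k)) * ennreal (A ^ k * S ^ s)"
        using D(1) \<delta>(1) A0 S(1) by (simp add: ennreal_mult)
      then show ?thesis using le unfolding sm by (simp only: mult.assoc)
    qed
    ultimately show ?thesis by blast
  qed
  have "0 < C k" for k using D(1) A0 S(1) by (simp add: C_def)
  then show ?thesis using main by (intro exI[of _ C]) blast
qed

end
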